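(* Let $\mathcal Q$ be a complete subset of $\mathcal P_{\mathrm{gen}}$, let $\varphi:M\to M$ be a graphical homomorphism, let $Y$ be a topological space and let $\kappa:\mathcal Q\times Y\to\mathbf G$ be a map such that - $\kappa(\cdot,y):\mathcal Q\to\mathbf G$ is admissible for all $y\in Y$, and - $\kappa(\gamma,\cdot):Y\to\mathbf G$ is continuous for all $\gamma\in\mathcal Q$. Then there is a unique map $\Theta:\overline{\mathcal A}\times Y\to\overline{\mathcal A}$ with $$h_{\Theta(\overline A,y)}([\gamma])=\kappa(\gamma,y)^{-1}\,h_{\overline A}([\varphi\circ\gamma])\,\kappa(\gamma^{-1},y)$$ for all $\gamma\in\mathcal Q$, $\overline A\in\overline{\mathcal A}$, $y\in Y$. Moreover, $\Theta$ is continuous.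
   Context: Paths. Fix a manifold $M$, a connected Lie group $\mathbf G$, and $r$ a positive integer, $\infty$ or $\omega$. Fix also the choice whether all paths are required to be piecewise embedded or not. A path is a piecewise $C^r$ map $[0,1]\to M$ (piecewise embedded, if so chosen). A path is trivial iff its image is a single point. The inverse is $\gamma^{-1}(t):=\gamma(1-t)$. Paths $\gamma_1,\gamma_2$ are composable iff $\gamma_1(1)=\gamma_2(0)$; then $(\gamma_1\gamma_2)(t):=\gamma_1(2t)$ for $t\in[0,\frac12]$ and $\gamma_2(2t-1)$ for $t\in[\frac12,1]$. An edge is a path $e$ such that $e(t_1)=e(t_2)$ implies $|t_1-t_2|\in\{0,1\}$. Two paths $\gamma_1,\gamma_2$ coincide up to the parametrization iff $\gamma_1=\gamma_2\circ\phi$ for some orientation preserving piecewise $C^r$ diffeomorphism $\phi:[0,1]\to[0,1]$. A path is finite iff it equals, up to the parametrization, a finite product of edges and trivial paths; all paths are assumed finite. Two paths are equivalent iff there is a finite sequence of paths from one to the other in which any two subsequent paths coincide up to the parametrization or up to insertion or deletion of a retracing $\delta\delta^{-1}$ (e.g. $\gamma_1\gamma_2$ and $\gamma_1\delta\delta^{-1}\gamma_2$). $\mathcal P_{\mathrm{gen}}$ is the set of all paths, $\mathcal P$ the set of equivalence classes $[\gamma]$; $\mathcal P$ is a groupoid. A decomposition of a path $\gamma$ is a finite sequence $(\gamma_1,\dots,\gamma_n)$ of paths, also written $\gamma_1\cdots\gamma_n$, whose product equals $\gamma$ up to the parametrization. A subset $\mathcal Q\subseteq\mathcal P_{\mathrm{gen}}$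 is hereditary iff for each $\gamma\in\mathcal Q$ one has $\gamma^{-1}\in\mathcal Q$ and every decomposition of $\gamma$ consists of paths in $\mathcal Q$. It is complete iff it is hereditary and every path in $\mathcal P_{\mathrm{gen}}$ has a decomposition into paths in $\mathcal Q$. Segments of a path are its restrictions to connected subintervals, affinely stretched to domain $[0,1]$; initial segments are defined naturally. $\gamma_1\uparrow\uparrow\gamma_2$ means that there is a path which is (possibly up to the parametrization) an initial segment of both $\gamma_1$ and $\gamma_2$. Admissibility. For $\mathcal Q$ hereditary, a map $\kappa:\mathcal Q\to\mathbf G$ is admissible iff (i) $\kappa(\delta_1)=\kappa(\delta_2)$ for all $\delta_1,\delta_2\in\mathcal Q$ with $\delta_1\uparrow\uparrow\delta_2$, and (ii) $\kappa(\gamma_1^{-1})=\kappa(\gamma_2)$ for all $\gamma\in\mathcal Q$ and all decompositions $\gamma_1\gamma_2$ of $\gamma$. A map $\varphi:M\to M$ is a graphical homomorphism iff $\varphi\circ\gamma\in\mathcal P_{\mathrm{gen}}$ for all $\gamma\in\mathcal P_{\mathrm{gen}}$ and $\gamma\mapsto\varphi\circ\gamma$ induces a groupoid homomorphism on $\mathcal P$. Generalized connections. A hyph $\upsilon$ is a finite collection $(\gamma_1,\dots,\gamma_n)$ of edges each having a free point: $\gamma_i$ has a point such that, for at least one direction, none of the segments of $\gamma_i$ starting in that point in this direction is (up to the parametrization) a full segment of some $\gamma_j$ with $j<i$. The number of its edges is $\#\upsilon$. Hyphs are directed by the ordering generated by decomposition of paths and inclusion. $\mathcal P_\upsilon$ is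 the subgroupoid of $\mathcal P$ freely generated by the classes of edges in $\upsilon$, and $\overline{\mathcal A}_\upsilon:=\mathrm{Hom}(\mathcal P_\upsilon,\mathbf G)\cong\mathbf G^{\#\upsilon}$ with the topology of $\mathbf G^{\#\upsilon}$. The space of generalized connections is $\overline{\mathcal A}:=\mathrm{Hom}(\mathcal P,\mathbf G)=\varprojlim_\upsilon\overline{\mathcal A}_\upsilon$ with the projective limit topology. An element $\overline A\in\overline{\mathcal A}$ is also written $h_{\overline A}:\mathcal P\to\mathbf G$. *)

theory Defs
  imports "HOL-Analysis.Analysis" "HOL-Algebra.Group"
begin

section \<open>Differentiability classes\<close>

datatype diff_class = Order nat | Smooth | Analytic

fun positive_class :: "diff_class \<Rightarrow> bool" where
  "positive_class (Order k) = (k \<ge> 1)"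
| "positive_class Smooth = True"
| "positive_class Analytic = True"

text \<open>Only meaningful on open sets: all partial derivatives up to order \<open>k\<close> exist and are
  continuous.\<close>

primrec Ck_on :: "nat \<Rightarrow> 'a::euclidean_space set \<Rightarrow> ('a \<Rightarrow> 'b::euclidean_space) \<Rightarrow> bool" where
  "Ck_on 0 U f = continuous_on U f"
| "Ck_on (Suc k) U f =
     ((\<forall>x\<in>U. f differentiable (at x)) \<and>
      (\<forall>b\<in>Basis. Ck_on k U (\<lambda>x. frechet_derivative f (at x) b)))"

text \<open>Local expansion into a power series in several variables; the multi-indices are the
  functions from the standard basis to the naturals.\<close>

definition real_analytic_on :: "'a::euclidean_space set \<Rightarrow> ('a \<Rightarrow> 'b::euclidean_space) \<Rightarrow> bool" where
  "real_analytic_on U f \<longleftrightarrow>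
     (\<forall>x\<in>U. \<exists>\<epsilon>>0. \<exists>a :: ('a \<Rightarrow> nat) \<Rightarrow> 'b. \<forall>y\<in>ball x \<epsilon>.
        ((\<lambda>\<alpha>. (\<Prod>b\<in>Basis. ((y - x) \<bullet> b) ^ \<alpha> b) *\<^sub>R a \<alpha>) has_sum f y) (Basis \<rightarrow>\<^sub>E UNIV))"

fun Cr_open :: "diff_class \<Rightarrow> 'a::euclidean_space set \<Rightarrow> ('a \<Rightarrow> 'b::euclidean_space) \<Rightarrow> bool" where
  "Cr_open (Order k) U f = Ck_on k U f"
| "Cr_open Smooth U f = (\<forall>k. Ck_on k U f)"
| "Cr_open Analytic U f = real_analytic_on U f"

text \<open>On an arbitrary subset, \<open>C\<^sup>r\<close> means that locally there are \<open>C\<^sup>r\<close> extensions to open sets. This is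
  used for closed intervals and for (relatively) open subsets of linear subspaces.\<close>

definition Cr_on :: "diff_class \<Rightarrow> 'a::euclidean_space set \<Rightarrow> ('a \<Rightarrow> 'b::euclidean_space) \<Rightarrow> bool" where
  "Cr_on r S f \<longleftrightarrow>
     (\<forall>x\<in>S. \<exists>U g. open U \<and> x \<in> U \<and> Cr_open r U g \<and> (\<forall>y\<in>U \<inter> S. g y = f y))"

section \<open>Manifolds and Lie groups\<close>

text \<open>The model space is a linear subspace of a Euclidean space and not the whole Euclidean space,
  because the dimension of a type of class \<open>euclidean_space\<close> is never 0. A chart is a pair of its
  domain and its coordinate map; only the values of the latter on the domain matter.\<close>

record ('p, 'e) mfd =
  mtop :: "'p topology"
  model :: "'e set"
  atlas :: "('p set \<times> ('p \<Rightarrow> 'e)) set"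

definition Cr_manifold :: "diff_class \<Rightarrow> ('p, 'e::euclidean_space) mfd \<Rightarrow> bool" where
  "Cr_manifold r M \<longleftrightarrow>
     Hausdorff_space (mtop M) \<and> second_countable (mtop M) \<and> subspace (model M) \<and>
     topspace (mtop M) = (\<Union>(U, c)\<in>atlas M. U) \<and>
     (\<forall>(U, c)\<in>atlas M. openin (mtop M) U \<and> openin (top_of_set (model M)) (c ` U) \<and>
        homeomorphic_map (subtopology (mtop M) U) (top_of_set (c ` U)) c) \<and>
     (\<forall>(U, c)\<in>atlas M. \<forall>(W, d)\<in>atlas M. Cr_on r (c ` (U \<inter> W)) (d \<circ> inv_into U c))"

definition prod_mfd :: "('p, 'e) mfd \<Rightarrow> ('q, 'f) mfd \<Rightarrow> ('p \<times> 'q, 'e \<times> 'f) mfd" where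
  "prod_mfd M N =
     \<lparr>mtop = prod_topology (mtop M) (mtop N), model = model M \<times> model N,
      atlas = {(U \<times> W, map_prod c d) | U c W d. (U, c) \<in> atlas M \<and> (W, d) \<in> atlas N}\<rparr>"

definition Cr_map :: "diff_class \<Rightarrow> ('p, 'e::euclidean_space) mfd \<Rightarrow> ('q, 'f::euclidean_space) mfd
    \<Rightarrow> ('p \<Rightarrow> 'q) \<Rightarrow> bool" where
  "Cr_map r M N f \<longleftrightarrow>
     (\<forall>p\<in>topspace (mtop M). \<exists>(U, c)\<in>atlas M. \<exists>(W, d)\<in>atlas N. \<exists>V.
        openin (mtop M) V \<and> p \<in> V \<and> V \<subseteq> U \<and> f ` V \<subseteq> W \<and>
        Cr_on r (c ` V) (d \<circ> f \<circ> inv_into U c))"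

definition lie_group :: "('g, 'z) monoid_scheme \<Rightarrow> ('g, 'f::euclidean_space) mfd \<Rightarrow> bool" where
  "lie_group G L \<longleftrightarrow>
     group G \<and> Cr_manifold Smooth L \<and> topspace (mtop L) = carrier G \<and>
     Cr_map Smooth (prod_mfd L L) L (\<lambda>(x, y). x \<otimes>\<^bsub>G\<^esub> y) \<and>
     Cr_map Smooth L L (\<lambda>x. inv\<^bsub>G\<^esub> x)"

section \<open>Paths\<close>

text \<open>As for the library's paths, a path is a function on the whole real line of which only the
  values on \<open>[0,1]\<close> are relevant, and product and inverse are \<^const>\<open>joinpaths\<close> and
  \<^const>\<open>reversepath\<close>. Functions agreeing on \<open>[0,1]\<close> coincide up to the parametrization below, so that
  the irrelevant values influence neither hereditary sets nor admissible maps nor path classes.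

  Throughout, \<open>r\<close> is the differentiability class, \<open>emb\<close> says whether paths have to be piecewise
  embedded, and \<open>M\<close> is the manifold, whose point set is the whole type.\<close>

definition piecewise :: "(real set \<Rightarrow> bool) \<Rightarrow> bool" where
  "piecewise P \<longleftrightarrow>
     (\<exists>n>0. \<exists>t :: nat \<Rightarrow> real. t 0 = 0 \<and> t n = 1 \<and> (\<forall>i<n. t i < t (Suc i) \<and> P {t i..t (Suc i)}))"

definition Cr_curve :: "diff_class \<Rightarrow> ('m, 'e::euclidean_space) mfd \<Rightarrow> real set \<Rightarrow> (real \<Rightarrow> 'm) \<Rightarrow> bool"
  where
  "Cr_curve r M S \<gamma> \<longleftrightarrow>
     (\<forall>t\<in>S. \<exists>(U, c)\<in>atlas M. \<exists>J. open J \<and> t \<in> J \<and> \<gamma> ` (J \<inter> S) \<subseteq> U \<and> Cr_on r (J \<inter> S) (c \<circ> \<gamma>))"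

text \<open>On a compact interval, an embedding is the same as an injective immersion.\<close>

definition embedded_on :: "('m, 'e::euclidean_space) mfd \<Rightarrow> real set \<Rightarrow> (real \<Rightarrow> 'm) \<Rightarrow> bool" where
  "embedded_on M I \<gamma> \<longleftrightarrow>
     inj_on \<gamma> I \<and>
     (\<forall>t\<in>I. \<exists>(U, c)\<in>atlas M. \<gamma> t \<in> U \<and>
        (\<exists>v. v \<noteq> 0 \<and> ((c \<circ> \<gamma>) has_vector_derivative v) (at t within I)))"

definition pw_path :: "diff_class \<Rightarrow> bool \<Rightarrow> ('m, 'e::euclidean_space) mfd \<Rightarrow> (real \<Rightarrow> 'm) \<Rightarrow> bool" where
  "pw_path r emb M \<gamma> \<longleftrightarrow>
     piecewise (\<lambda>I. Cr_curve r M I \<gamma> \<and> (emb \<longrightarrow> embedded_on M I \<gamma>))"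

definition pw_diffeo :: "diff_class \<Rightarrow> (real \<Rightarrow> real) \<Rightarrow> bool" where
  "pw_diffeo r \<phi> \<longleftrightarrow>
     bij_betw \<phi> {0..1} {0..1} \<and> strict_mono_on {0..1} \<phi> \<and>
     piecewise (\<lambda>I. Cr_on r I \<phi>) \<and> piecewise (\<lambda>I. Cr_on r I (inv_into {0..1} \<phi>))"

definition same_upto_param :: "diff_class \<Rightarrow> (real \<Rightarrow> 'm) \<Rightarrow> (real \<Rightarrow> 'm) \<Rightarrow> bool" where
  "same_upto_param r \<gamma>\<^sub>1 \<gamma>\<^sub>2 \<longleftrightarrow> (\<exists>\<phi>. pw_diffeo r \<phi> \<and> (\<forall>t\<in>{0..1}. \<gamma>\<^sub>1 t = \<gamma>\<^sub>2 (\<phi> t)))"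

definition trivial_path :: "(real \<Rightarrow> 'm) \<Rightarrow> bool" where
  "trivial_path \<gamma> \<longleftrightarrow> (\<exists>x. \<gamma> ` {0..1} = {x})"

definition edge :: "diff_class \<Rightarrow> bool \<Rightarrow> ('m, 'e::euclidean_space) mfd \<Rightarrow> (real \<Rightarrow> 'm) \<Rightarrow> bool" where
  "edge r emb M e \<longleftrightarrow>
     pw_path r emb M e \<and> (\<forall>s\<in>{0..1}. \<forall>t\<in>{0..1}. e s = e t \<longrightarrow> \<bar>s - t\<bar> \<in> {0, 1})"

definition composable_list :: "(real \<Rightarrow> 'm::topological_space) list \<Rightarrow> bool" where
  "composable_list \<gamma>s \<longleftrightarrow>
     \<gamma>s \<noteq> [] \<and> successively (\<lambda>\<gamma> \<delta>. pathfinish \<gamma> = pathstart \<delta>) \<gamma>s"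

text \<open>The bracketing is immaterial up to the parametrization.\<close>

fun path_prod :: "(real \<Rightarrow> 'm::topological_space) list \<Rightarrow> real \<Rightarrow> 'm" where
  "path_prod [\<gamma>] = \<gamma>"
| "path_prod (\<gamma> # \<delta> # \<gamma>s) = \<gamma> +++ path_prod (\<delta> # \<gamma>s)"

definition P_gen :: "diff_class \<Rightarrow> bool \<Rightarrow> ('m::topological_space, 'e::euclidean_space) mfd
    \<Rightarrow> (real \<Rightarrow> 'm) set" where
  "P_gen r emb M =
     {\<gamma>. pw_path r emb M \<gamma> \<and>
        (\<exists>es. composable_list es \<and>
           (\<forall>e\<in>set es. edge r emb M e \<or> (pw_path r emb M e \<and> trivial_path e)) \<and>
           same_upto_param r \<gamma> (path_prod es))}"

text \<open>The second path arises from the first one by insertion of a retracing, which may also happen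
  at the beginning or at the end.\<close>

inductive inserts_retracing :: "(real \<Rightarrow> 'm::topological_space) set \<Rightarrow> (real \<Rightarrow> 'm) \<Rightarrow> (real \<Rightarrow> 'm) \<Rightarrow> bool"
  for P where
  middle: "\<lbrakk>\<gamma>\<^sub>1 \<in> P; \<gamma>\<^sub>2 \<in> P; \<delta> \<in> P; pathfinish \<gamma>\<^sub>1 = pathstart \<gamma>\<^sub>2; pathfinish \<gamma>\<^sub>1 = pathstart \<delta>\<rbrakk>
    \<Longrightarrow> inserts_retracing P (\<gamma>\<^sub>1 +++ \<gamma>\<^sub>2) (\<gamma>\<^sub>1 +++ (\<delta> +++ reversepath \<delta>) +++ \<gamma>\<^sub>2)"
| at_end: "\<lbrakk>\<gamma> \<in> P; \<delta> \<in> P; pathfinish \<gamma> = pathstart \<delta>\<rbrakk>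
    \<Longrightarrow> inserts_retracing P \<gamma> (\<gamma> +++ (\<delta> +++ reversepath \<delta>))"
| at_start: "\<lbrakk>\<gamma> \<in> P; \<delta> \<in> P; pathstart \<gamma> = pathstart \<delta>\<rbrakk>
    \<Longrightarrow> inserts_retracing P \<gamma> ((\<delta> +++ reversepath \<delta>) +++ \<gamma>)"

definition path_step :: "diff_class \<Rightarrow> bool \<Rightarrow> ('m::topological_space, 'e::euclidean_space) mfd
    \<Rightarrow> ((real \<Rightarrow> 'm) \<times> (real \<Rightarrow> 'm)) set" where
  "path_step r emb M =
     {(\<gamma>, \<delta>). \<gamma> \<in> P_gen r emb M \<and> \<delta> \<in> P_gen r emb M \<and>
        (same_upto_param r \<gamma> \<delta> \<or> inserts_retracing (P_gen r emb M) \<gamma> \<delta>)}"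

definition path_equiv :: "diff_class \<Rightarrow> bool \<Rightarrow> ('m::topological_space, 'e::euclidean_space) mfd
    \<Rightarrow> ((real \<Rightarrow> 'm) \<times> (real \<Rightarrow> 'm)) set" where
  "path_equiv r emb M =
     (path_step r emb M \<union> (path_step r emb M)\<inverse>)\<^sup>* \<inter> (P_gen r emb M \<times> P_gen r emb M)"

definition path_class :: "diff_class \<Rightarrow> bool \<Rightarrow> ('m::topological_space, 'e::euclidean_space) mfd
    \<Rightarrow> (real \<Rightarrow> 'm) \<Rightarrow> (real \<Rightarrow> 'm) set" where
  "path_class r emb M \<gamma> = path_equiv r emb M `` {\<gamma>}"

section \<open>Groupoids\<close>

text \<open>Groupoids are given by their arrows, with a partially defined multiplication. Preservation of
  units and inverses by homomorphisms is automatic. Homomorphisms are extensional functions, so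
  that equality of homomorphisms is equality on the arrows.\<close>

record 'a gpd =
  arr :: "'a set"
  gcomposable :: "'a \<Rightarrow> 'a \<Rightarrow> bool"
  gmult :: "'a \<Rightarrow> 'a \<Rightarrow> 'a"
  ginv :: "'a \<Rightarrow> 'a"

definition gpd_hom :: "'a gpd \<Rightarrow> 'b gpd \<Rightarrow> ('a \<Rightarrow> 'b) set" where
  "gpd_hom P H =
     {h \<in> arr P \<rightarrow>\<^sub>E arr H. \<forall>a\<in>arr P. \<forall>b\<in>arr P. gcomposable P a b \<longrightarrow>
        gcomposable H (h a) (h b) \<and> h (gmult P a b) = gmult H (h a) (h b)}"

definition group_gpd :: "('g, 'z) monoid_scheme \<Rightarrow> 'g gpd" where
  "group_gpd G =
     \<lparr>arr = carrier G, gcomposable = (\<lambda>_ _. True), gmult = mult G, ginv = m_inv G\<rparr>"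

inductive_set gpd_generated :: "'a gpd \<Rightarrow> 'a set \<Rightarrow> 'a set" for P S where
  base: "a \<in> S \<Longrightarrow> a \<in> gpd_generated P S"
| inverse: "a \<in> gpd_generated P S \<Longrightarrow> ginv P a \<in> gpd_generated P S"
| product: "\<lbrakk>a \<in> gpd_generated P S; b \<in> gpd_generated P S; gcomposable P a b\<rbrakk>
    \<Longrightarrow> gmult P a b \<in> gpd_generated P S"

definition path_gpd :: "diff_class \<Rightarrow> bool \<Rightarrow> ('m::topological_space, 'e::euclidean_space) mfd
    \<Rightarrow> (real \<Rightarrow> 'm) set gpd" where
  "path_gpd r emb M =
     \<lparr>arr = P_gen r emb M // path_equiv r emb M,
      gcomposable = (\<lambda>a b. \<exists>\<gamma>\<in>a. \<exists>\<delta>\<in>b. pathfinish \<gamma> = pathstart \<delta>),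
      gmult = (\<lambda>a b. \<Union>{path_class r emb M (\<gamma> +++ \<delta>) | \<gamma> \<delta>.
                  \<gamma> \<in> a \<and> \<delta> \<in> b \<and> pathfinish \<gamma> = pathstart \<delta>}),
      ginv = (\<lambda>a. \<Union>\<gamma>\<in>a. path_class r emb M (reversepath \<gamma>))\<rparr>"

definition graphical_hom :: "diff_class \<Rightarrow> bool \<Rightarrow> ('m::topological_space, 'e::euclidean_space) mfd
    \<Rightarrow> ('m \<Rightarrow> 'm) \<Rightarrow> bool" where
  "graphical_hom r emb M \<phi> \<longleftrightarrow>
     (\<forall>\<gamma>\<in>P_gen r emb M. \<phi> \<circ> \<gamma> \<in> P_gen r emb M) \<and>
     (\<exists>F\<in>gpd_hom (path_gpd r emb M) (path_gpd r emb M).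
        \<forall>\<gamma>\<in>P_gen r emb M. F (path_class r emb M \<gamma>) = path_class r emb M (\<phi> \<circ> \<gamma>))"

section \<open>Hereditary and complete sets, admissible maps\<close>

definition decomposition :: "diff_class \<Rightarrow> bool \<Rightarrow> ('m::topological_space, 'e::euclidean_space) mfd
    \<Rightarrow> (real \<Rightarrow> 'm) list \<Rightarrow> (real \<Rightarrow> 'm) \<Rightarrow> bool" where
  "decomposition r emb M \<gamma>s \<gamma> \<longleftrightarrow>
     composable_list \<gamma>s \<and> set \<gamma>s \<subseteq> P_gen r emb M \<and> same_upto_param r (path_prod \<gamma>s) \<gamma>"

definition hereditary :: "diff_class \<Rightarrow> bool \<Rightarrow> ('m::topological_space, 'e::euclidean_space) mfd
    \<Rightarrow> (real \<Rightarrow> 'm) set \<Rightarrow> bool" where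
  "hereditary r emb M Q \<longleftrightarrow>
     Q \<subseteq> P_gen r emb M \<and>
     (\<forall>\<gamma>\<in>Q. reversepath \<gamma> \<in> Q \<and> (\<forall>\<gamma>s. decomposition r emb M \<gamma>s \<gamma> \<longrightarrow> set \<gamma>s \<subseteq> Q))"

definition complete_paths :: "diff_class \<Rightarrow> bool \<Rightarrow> ('m::topological_space, 'e::euclidean_space) mfd
    \<Rightarrow> (real \<Rightarrow> 'm) set \<Rightarrow> bool" where
  "complete_paths r emb M Q \<longleftrightarrow>
     hereditary r emb M Q \<and>
     (\<forall>\<gamma>\<in>P_gen r emb M. \<exists>\<gamma>s. decomposition r emb M \<gamma>s \<gamma> \<and> set \<gamma>s \<subseteq> Q)"

text \<open>For \<open>b < a\<close> this is the inverse of the segment from \<open>b\<close> to \<open>a\<close>.\<close>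

definition segment :: "real \<Rightarrow> real \<Rightarrow> (real \<Rightarrow> 'm) \<Rightarrow> real \<Rightarrow> 'm" where
  "segment a b \<gamma> = (\<lambda>t. \<gamma> (a + (b - a) * t))"

text \<open>Initial segments are nondegenerate: one-point intervals cannot be stretched to \<open>[0,1]\<close>.\<close>

definition initial_segment_upto :: "diff_class \<Rightarrow> (real \<Rightarrow> 'm) \<Rightarrow> (real \<Rightarrow> 'm) \<Rightarrow> bool" where
  "initial_segment_upto r \<delta> \<gamma> \<longleftrightarrow> (\<exists>s\<in>{0<..1}. same_upto_param r \<delta> (segment 0 s \<gamma>))"

definition share_initial :: "diff_class \<Rightarrow> bool \<Rightarrow> ('m::topological_space, 'e::euclidean_space) mfd
    \<Rightarrow> (real \<Rightarrow> 'm) \<Rightarrow> (real \<Rightarrow> 'm) \<Rightarrow> bool" where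
  "share_initial r emb M \<gamma>\<^sub>1 \<gamma>\<^sub>2 \<longleftrightarrow>
     (\<exists>\<delta>\<in>P_gen r emb M. initial_segment_upto r \<delta> \<gamma>\<^sub>1 \<and> initial_segment_upto r \<delta> \<gamma>\<^sub>2)"

definition admissible :: "diff_class \<Rightarrow> bool \<Rightarrow> ('m::topological_space, 'e::euclidean_space) mfd
    \<Rightarrow> ('g, 'z) monoid_scheme \<Rightarrow> (real \<Rightarrow> 'm) set \<Rightarrow> ((real \<Rightarrow> 'm) \<Rightarrow> 'g) \<Rightarrow> bool" where
  "admissible r emb M G Q \<kappa> \<longleftrightarrow>
     \<kappa> \<in> Q \<rightarrow> carrier G \<and>
     (\<forall>\<delta>\<^sub>1\<in>Q. \<forall>\<delta>\<^sub>2\<in>Q. share_initial r emb M \<delta>\<^sub>1 \<delta>\<^sub>2 \<longrightarrow> \<kappa> \<delta>\<^sub>1 = \<kappa> \<delta>\<^sub>2) \<and>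
     (\<forall>\<gamma>\<in>Q. \<forall>\<gamma>\<^sub>1 \<gamma>\<^sub>2. decomposition r emb M [\<gamma>\<^sub>1, \<gamma>\<^sub>2] \<gamma> \<longrightarrow> \<kappa> (reversepath \<gamma>\<^sub>1) = \<kappa> \<gamma>\<^sub>2)"

section \<open>Hyphs and generalized connections\<close>

text \<open>Allowing \<open>b < a\<close> includes the inverses of segments: freeness is insensitive to orientation, as
  it has to be, since otherwise an edge and its inverse would form a hyph.\<close>

definition segment_upto :: "diff_class \<Rightarrow> (real \<Rightarrow> 'm) \<Rightarrow> (real \<Rightarrow> 'm) \<Rightarrow> bool" where
  "segment_upto r \<delta> \<gamma> \<longleftrightarrow>
     (\<exists>a\<in>{0..1}. \<exists>b\<in>{0..1}. a \<noteq> b \<and> same_upto_param r \<delta> (segment a b \<gamma>))"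

definition has_free_point :: "diff_class \<Rightarrow> (real \<Rightarrow> 'm) \<Rightarrow> (real \<Rightarrow> 'm) set \<Rightarrow> bool" where
  "has_free_point r \<gamma> \<Delta> \<longleftrightarrow>
     (\<exists>x\<in>{0..1}.
        x < 1 \<and> (\<forall>s\<in>{x<..1}. \<forall>\<delta>\<in>\<Delta>. \<not> segment_upto r (segment x s \<gamma>) \<delta>) \<or>
        0 < x \<and> (\<forall>s\<in>{0..<x}. \<forall>\<delta>\<in>\<Delta>. \<not> segment_upto r (segment x s \<gamma>) \<delta>))"

definition hyph :: "diff_class \<Rightarrow> bool \<Rightarrow> ('m, 'e::euclidean_space) mfd \<Rightarrow> (real \<Rightarrow> 'm) list \<Rightarrow> bool" where
  "hyph r emb M es \<longleftrightarrow>
     (\<forall>i<length es. edge r emb M (es ! i) \<and> has_free_point r (es ! i) (set (take i es)))"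

definition hyph_gpd :: "diff_class \<Rightarrow> bool \<Rightarrow> ('m::topological_space, 'e::euclidean_space) mfd
    \<Rightarrow> (real \<Rightarrow> 'm) list \<Rightarrow> (real \<Rightarrow> 'm) set gpd" where
  "hyph_gpd r emb M es =
     (path_gpd r emb M)
       \<lparr>arr := gpd_generated (path_gpd r emb M) (path_class r emb M ` set es)\<rparr>"

text \<open>The topology of the power of \<open>G\<close>, transported by evaluation on the edges of the hyph.\<close>

definition hyph_conn_topology :: "diff_class \<Rightarrow> bool \<Rightarrow> ('m::topological_space, 'e::euclidean_space) mfd
    \<Rightarrow> ('g, 'z) monoid_scheme \<Rightarrow> 'g topology \<Rightarrow> (real \<Rightarrow> 'm) list
    \<Rightarrow> ((real \<Rightarrow> 'm) set \<Rightarrow> 'g) topology" where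
  "hyph_conn_topology r emb M G T es =
     pullback_topology (gpd_hom (hyph_gpd r emb M es) (group_gpd G))
       (\<lambda>h. \<lambda>i\<in>{..<length es}. h (path_class r emb M (es ! i)))
       (product_topology (\<lambda>_. T) {..<length es})"

definition gen_conn :: "diff_class \<Rightarrow> bool \<Rightarrow> ('m::topological_space, 'e::euclidean_space) mfd
    \<Rightarrow> ('g, 'z) monoid_scheme \<Rightarrow> ((real \<Rightarrow> 'm) set \<Rightarrow> 'g) set" where
  "gen_conn r emb M G = gpd_hom (path_gpd r emb M) (group_gpd G)"

text \<open>The projective limit topology: the coarsest one for which the restrictions to all the
  subgroupoids given by hyphs are continuous. The empty hyph contributes the whole space.\<close>

definition gen_conn_topology :: "diff_class \<Rightarrow> bool \<Rightarrow> ('m::topological_space, 'e::euclidean_space) mfd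
    \<Rightarrow> ('g, 'z) monoid_scheme \<Rightarrow> 'g topology \<Rightarrow> ((real \<Rightarrow> 'm) set \<Rightarrow> 'g) topology" where
  "gen_conn_topology r emb M G T =
     topology_generated_by
       {{h \<in> gen_conn r emb M G. restrict h (arr (hyph_gpd r emb M es)) \<in> W} | es W.
          hyph r emb M es \<and> openin (hyph_conn_topology r emb M G T es) W}"

end

theory Submission
  imports Defs
begin

text \<open>
  Put \<open>f(\<gamma>) = \<kappa>(\<gamma>,y)\<inverse> A[\<phi> \<circ> \<gamma>] \<kappa>(\<gamma>\<inverse>,y)\<close> for \<open>\<gamma>\<close> in \<open>Q\<close>. In \<open>f(\<gamma>\<^sub>1) f(\<gamma>\<^sub>2)\<close> the inner factors \<open>\<kappa>(\<gamma>\<^sub>1\<inverse>,y)\<close>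
  and \<open>\<kappa>(\<gamma>\<^sub>2,y)\<inverse>\<close> cancel by admissibility, and the outer ones depend only on the germs of
  \<open>\<gamma>\<^sub>1 \<gamma>\<^sub>2\<close> at its two ends; so \<open>f\<close> is multiplicative on \<open>Q\<close>. Its extension to an arbitrary path
  is the product of its values along a subdivision into paths of \<open>Q\<close>. To see that this does not
  depend on the subdivision, one avoids common refinements: along a path there is a function
  \<open>u\<close> on the parameter interval with \<open>u(t) = u(s) f(\<gamma> restricted to [s,t])\<close> whenever that restriction
  is in \<open>Q\<close>, and the product equals \<open>u(0)\<inverse> u(1)\<close> for every subdivision. Continuity can be
  tested on single paths, because every edge alone is a hyph and every path is a finite
  product of edges and trivial paths.
\<close>

section \<open>Affine changes of the parameter\<close>

text \<open>For a splitting \<gamma> = \<gamma>1 \<gamma>2, condition (ii) gives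
  \<kappa>(\<gamma>1^-1) = \<kappa>(\<gamma>2), and (i) gives \<kappa>(\<gamma>) =
  \<kappa>(\<gamma>1) as well as \<kappa>(\<gamma>^-1) = \<kappa>(\<gamma>2^-1), because
  \<gamma>2^-1 is an initial segment of \<gamma>^-1. Passing to path classes also uses
  f(\<gamma>^-1) = f(\<gamma>)^-1, visible from the form of f: it makes every retracing contribute
  the unit. The obstacle is that the definitions quantify over arbitrary piecewise C^r
  reparametrizations, and composing two of them would call for chain rules for iterated derivatives
  and for power series. Reparametrizations are therefore only inverted, restricted, glued, reflected
  and changed by affine maps. A factor of a decomposition is always replaced by the segment of the
  given path that it parametrizes; membership in \<open>Q\<close> passes to that segment because a
  one-element list is a decomposition too.\<close>

lemma frechet_derivative_eqI:
  assumes "open U" "x \<in> U" "\<And>y. y \<in> U \<Longrightarrow> f y = g y"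
  shows "f differentiable (at x) \<longleftrightarrow> g differentiable (at x)"
    and "frechet_derivative f (at x) = frechet_derivative g (at x)"
proof -
  have *: "(f has_derivative D) (at x) \<longleftrightarrow> (g has_derivative D) (at x)" for D
    using assms has_derivative_transform_within_open[of f D x UNIV U g]
      has_derivative_transform_within_open[of g D x UNIV U f] by auto
  show "f differentiable (at x) \<longleftrightarrow> g differentiable (at x)"
    by (simp add: differentiable_def *)
  show "frechet_derivative f (at x) = frechet_derivative g (at x)"
    by (simp add: frechet_derivative_def *)
qed

lemma Ck_on_cong:
  assumes "open U" "\<And>x. x \<in> U \<Longrightarrow> f x = g x" "Ck_on k U f"
  shows "Ck_on k U g"
  using assms(2,3)
proof (induction k arbitrary: f g)
  case 0
  then show ?case by (simp cong: continuous_on_cong)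
next
  case (Suc k)
  note eq = frechet_derivative_eqI[OF assms(1) _ Suc.prems(1)]
  have "Ck_on k U (\<lambda>x. frechet_derivative g (at x) b)" if "b \<in> Basis" for b
    using Suc.IH[of "\<lambda>x. frechet_derivative f (at x) b" "\<lambda>x. frechet_derivative g (at x) b"]
      Suc.prems(2) that eq(2) by auto
  then show ?case
    using Suc.prems(2) eq(1) by auto
qed

text \<open>The constant \<open>p\<close> disappears in the first derivative, so the induction
  generalizes over it and uses its hypothesis with \<open>0\<close> in place of
  \<open>p\<close>.\<close>

lemma Ck_on_post_affine:
  assumes "open U" "Ck_on k U f"
  shows "Ck_on k U (\<lambda>x. p + q *\<^sub>R f x)"
  using assms(2)
proof (induction k arbitrary: f p)
  case 0
  then show ?case by (auto intro!: continuous_intros)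
next
  case (Suc k)
  have D: "((\<lambda>x. p + q *\<^sub>R f x) has_derivative (\<lambda>h. 0 + q *\<^sub>R frechet_derivative f (at x) h)) (at x)"
    if "x \<in> U" for x
    using that Suc.prems frechet_derivative_works
    by (auto intro!: derivative_eq_intros)
  have "Ck_on k U (\<lambda>x. frechet_derivative (\<lambda>x. p + q *\<^sub>R f x) (at x) b)" if "b \<in> Basis" for b
    using frechet_derivative_at[OF D, symmetric] Suc.prems that
      Ck_on_cong[OF assms(1) _ Suc.IH[of "\<lambda>x. frechet_derivative f (at x) b" 0]] by auto
  then show ?case
    using D by (auto simp: differentiable_def)
qed

lemma open_vimage_affine: "open U \<Longrightarrow> open ((\<lambda>x::real. p + q * x) -` U)"
  by (intro open_vimage continuous_intros)

text \<open>Differentiating puts a factor \<open>q\<close> in front of a function of the same shape,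
  so the induction step combines its hypothesis with \<open>Ck_on_post_affine\<close>.\<close>

lemma Ck_on_pre_affine:
  fixes f :: "real \<Rightarrow> 'b::euclidean_space"
  assumes "open U" "Ck_on k U f"
  shows "Ck_on k ((\<lambda>x. p + q * x) -` U) (\<lambda>x. f (p + q * x))"
  using assms(2)
proof (induction k arbitrary: f)
  case 0
  then show ?case
    by (auto intro!: continuous_intros continuous_on_compose2[of U f])
next
  case (Suc k)
  let ?V = "(\<lambda>x. p + q * x) -` U"
  have D: "((\<lambda>x. f (p + q * x)) has_derivative (\<lambda>h. frechet_derivative f (at (p + q * x)) (q * h))) (at x)"
    if "x \<in> ?V" for x
  proof -
    have "(f has_derivative frechet_derivative f (at (p + q * x))) (at (p + q * x))"
      using that Suc.prems frechet_derivative_works by auto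
    moreover have "((\<lambda>x. p + q * x) has_derivative (\<lambda>h. q * h)) (at x)"
      by (auto intro!: derivative_eq_intros)
    ultimately show ?thesis
      using has_derivative_compose by fastforce
  qed
  have lin: "frechet_derivative f (at (p + q * x)) (q * b)
      = 0 + q *\<^sub>R frechet_derivative f (at (p + q * x)) b" if "x \<in> ?V" for x b
    using linear_cmul[OF linear_frechet_derivative[of f "at (p + q * x)"], of q b] that Suc.prems
    by auto
  have "Ck_on k ?V (\<lambda>x. frechet_derivative (\<lambda>x. f (p + q * x)) (at x) b)" if b: "b \<in> Basis" for b
  proof -
    have "Ck_on k ?V (\<lambda>x. 0 + q *\<^sub>R frechet_derivative f (at (p + q * x)) b)"
      using Suc.IH[of "\<lambda>x. frechet_derivative f (at x) b"] Suc.prems b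
      by (intro Ck_on_post_affine open_vimage_affine assms) auto
    then show ?thesis
      using frechet_derivative_at[OF D, symmetric] lin
      by (elim Ck_on_cong[OF open_vimage_affine[OF assms(1)], rotated]) auto
  qed
  then show ?case
    using D by (auto simp: differentiable_def)
qed

lemma Ck_on_const: "Ck_on k U (\<lambda>x. c)"
  by (induction k arbitrary: c) auto

lemma Ck_on_ident: "Ck_on k U (\<lambda>x. x)"
  by (cases k) (auto simp: Ck_on_const)

section \<open>Local power series expansions under affine maps\<close>

lemma has_sum_single:
  assumes "x \<in> A" "\<And>y. y \<in> A \<Longrightarrow> y \<noteq> x \<Longrightarrow> f y = 0"
  shows "(f has_sum f x) A"
  using has_sum_cong_neutral[of A "{x}" f f] has_sum_finite[of "{x}" f] assms by auto

lemma real_analytic_on_post_affine: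
  assumes "real_analytic_on U f"
  shows "real_analytic_on U (\<lambda>x. p + q *\<^sub>R f x)"
  unfolding real_analytic_on_def
proof
  fix x assume "x \<in> U"
  then obtain \<epsilon> a where \<epsilon>: "\<epsilon> > 0" and a: "\<And>y. y \<in> ball x \<epsilon> \<Longrightarrow>
      ((\<lambda>\<alpha>. (\<Prod>b\<in>Basis. ((y - x) \<bullet> b) ^ \<alpha> b) *\<^sub>R a \<alpha>) has_sum f y) (Basis \<rightarrow>\<^sub>E UNIV)"
    using assms unfolding real_analytic_on_def by blast
  \<comment> \<open>The zero multi-index, whose coefficient absorbs \<open>p\<close>. It is
    extensional because the sum ranges over \<open>Basis \<rightarrow>\<^sub>E UNIV\<close>.\<close>
  define z :: "'a \<Rightarrow> nat" where "z = (\<lambda>b\<in>Basis. 0)"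
  have "((\<lambda>\<alpha>. (\<Prod>b\<in>Basis. ((y - x) \<bullet> b) ^ \<alpha> b) *\<^sub>R ((if \<alpha> = z then p else 0) + q *\<^sub>R a \<alpha>))
      has_sum p + q *\<^sub>R f y) (Basis \<rightarrow>\<^sub>E UNIV)" if y: "y \<in> ball x \<epsilon>" for y
  proof -
    have "((\<lambda>\<alpha>. (\<Prod>b\<in>Basis. ((y - x) \<bullet> b) ^ \<alpha> b) *\<^sub>R (if \<alpha> = z then p else 0)) has_sum p) (Basis \<rightarrow>\<^sub>E UNIV)"
      using has_sum_single[of z "Basis \<rightarrow>\<^sub>E UNIV"
        "\<lambda>\<alpha>. (\<Prod>b\<in>Basis. ((y - x) \<bullet> b) ^ \<alpha> b) *\<^sub>R (if \<alpha> = z then p else 0)"]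
      by (simp add: z_def)
    from has_sum_add[OF this has_sum_scaleR[OF a[OF y], of q]] show ?thesis
      by (simp add: algebra_simps)
  qed
  then show "\<exists>\<epsilon>>0. \<exists>a. \<forall>y\<in>ball x \<epsilon>.
      ((\<lambda>\<alpha>. (\<Prod>b\<in>Basis. ((y - x) \<bullet> b) ^ \<alpha> b) *\<^sub>R a \<alpha>) has_sum p + q *\<^sub>R f y) (Basis \<rightarrow>\<^sub>E UNIV)"
    using \<epsilon> by (intro exI[of _ \<epsilon>] conjI exI[of _ "\<lambda>\<alpha>. (if \<alpha> = z then p else 0) + q *\<^sub>R a \<alpha>"]) auto
qed

text \<open>The increment is multiplied by \<open>q\<close>, hence the coefficient of degree n by
  the n-th power of \<open>q\<close>; the only basis vector of the reals is 1, so the degree is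
  \<open>\<alpha> 1\<close>. The radius \<open>\<epsilon>\<close> turns into
  \<open>\<epsilon> / \<bar>q\<bar>\<close>.\<close>

lemma real_analytic_on_pre_affine:
  fixes f :: "real \<Rightarrow> 'b::euclidean_space"
  assumes "real_analytic_on U f" "q \<noteq> 0"
  shows "real_analytic_on ((\<lambda>x. p + q * x) -` U) (\<lambda>x. f (p + q * x))"
  unfolding real_analytic_on_def
proof
  fix x assume "x \<in> (\<lambda>x. p + q * x) -` U"
  then obtain \<epsilon> a where \<epsilon>: "\<epsilon> > 0" and a: "\<And>y. y \<in> ball (p + q * x) \<epsilon> \<Longrightarrow>
      ((\<lambda>\<alpha>. (\<Prod>b\<in>Basis. ((y - (p + q * x)) \<bullet> b) ^ \<alpha> b) *\<^sub>R a \<alpha>) has_sum f y) (Basis \<rightarrow>\<^sub>E UNIV)"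
    using assms unfolding real_analytic_on_def by blast
  have "((\<lambda>\<alpha>. (\<Prod>b\<in>Basis. ((y - x) \<bullet> b) ^ \<alpha> b) *\<^sub>R (q ^ \<alpha> 1 *\<^sub>R a \<alpha>))
      has_sum f (p + q * y)) (Basis \<rightarrow>\<^sub>E UNIV)" if y: "y \<in> ball x (\<epsilon> / \<bar>q\<bar>)" for y
  proof -
    have "dist (p + q * x) (p + q * y) = \<bar>q\<bar> * \<bar>x - y\<bar>"
      unfolding dist_real_def abs_mult[symmetric] by (simp add: right_diff_distrib)
    then have "p + q * y \<in> ball (p + q * x) \<epsilon>"
      using y assms(2) by (simp add: dist_real_def field_simps)
    moreover have "p + q * y - (p + q * x) = q * (y - x)"
      by (simp add: algebra_simps)
    ultimately show ?thesis
      using a[of "p + q * y"] by (simp add: power_mult_distrib mult.commute)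
  qed
  then show "\<exists>\<epsilon>>0. \<exists>a. \<forall>y\<in>ball x \<epsilon>.
      ((\<lambda>\<alpha>. (\<Prod>b\<in>Basis. ((y - x) \<bullet> b) ^ \<alpha> b) *\<^sub>R a \<alpha>) has_sum f (p + q * y)) (Basis \<rightarrow>\<^sub>E UNIV)"
    using \<epsilon> assms(2)
    by (intro exI[of _ "\<epsilon> / \<bar>q\<bar>"] conjI exI[of _ "\<lambda>\<alpha>. q ^ \<alpha> 1 *\<^sub>R a \<alpha>"]) auto
qed

lemma real_analytic_on_ident: "real_analytic_on U (\<lambda>x::real. x)"
  unfolding real_analytic_on_def
proof
  fix x :: real
  \<comment> \<open>The multi-indices of degree 0 and 1, for the expansion
    \<open>y = x + 1 * (y - x)\<close> around \<open>x\<close>.\<close>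
  define z o' :: "real \<Rightarrow> nat" where "z = (\<lambda>b\<in>Basis. 0)" and "o' = (\<lambda>b\<in>Basis. 1)"
  have ne: "z \<noteq> o'"
    by (auto simp: z_def o'_def fun_eq_iff)
  have "((\<lambda>\<alpha>. (\<Prod>b\<in>Basis. ((y - x) \<bullet> b) ^ \<alpha> b) *\<^sub>R ((if \<alpha> = z then x else 0) + (if \<alpha> = o' then 1 else 0)))
      has_sum y) (Basis \<rightarrow>\<^sub>E UNIV)" for y
  proof -
    have "((\<lambda>\<alpha>. (\<Prod>b\<in>Basis. ((y - x) \<bullet> b) ^ \<alpha> b) *\<^sub>R (if \<alpha> = z then x else 0)) has_sum x) (Basis \<rightarrow>\<^sub>E UNIV)"
      using has_sum_single[of z "Basis \<rightarrow>\<^sub>E UNIV"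
        "\<lambda>\<alpha>. (\<Prod>b\<in>Basis. ((y - x) \<bullet> b) ^ \<alpha> b) *\<^sub>R (if \<alpha> = z then x else 0)"]
      by (simp add: z_def)
    moreover have "((\<lambda>\<alpha>. (\<Prod>b\<in>Basis. ((y - x) \<bullet> b) ^ \<alpha> b) *\<^sub>R (if \<alpha> = o' then 1 else 0)) has_sum (y - x)) (Basis \<rightarrow>\<^sub>E UNIV)"
      using has_sum_single[of o' "Basis \<rightarrow>\<^sub>E UNIV"
        "\<lambda>\<alpha>. (\<Prod>b\<in>Basis. ((y - x) \<bullet> b) ^ \<alpha> b) *\<^sub>R (if \<alpha> = o' then 1 else 0 :: real)"]
      by (simp add: o'_def)
    ultimately show ?thesis
      using has_sum_add by (fastforce simp: algebra_simps)
  qed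
  then show "\<exists>\<epsilon>>0. \<exists>a. \<forall>y\<in>ball x \<epsilon>.
      ((\<lambda>\<alpha>. (\<Prod>b\<in>Basis. ((y - x) \<bullet> b) ^ \<alpha> b) *\<^sub>R a \<alpha>) has_sum y) (Basis \<rightarrow>\<^sub>E UNIV)"
    by (intro exI[of _ 1] conjI exI[of _ "\<lambda>\<alpha>. (if \<alpha> = z then x else 0) + (if \<alpha> = o' then 1 else 0)"]) auto
qed

lemma Cr_open_post_affine:
  "open U \<Longrightarrow> Cr_open r U f \<Longrightarrow> Cr_open r U (\<lambda>x. p + q *\<^sub>R f x)"
  by (cases r) (auto intro: Ck_on_post_affine real_analytic_on_post_affine)

lemma Cr_open_pre_affine:
  fixes f :: "real \<Rightarrow> 'b::euclidean_space"
  shows "open U \<Longrightarrow> q \<noteq> 0 \<Longrightarrow> Cr_open r U f \<Longrightarrow> Cr_open r ((\<lambda>x. p + q * x) -` U) (\<lambda>x. f (p + q * x))"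
  by (cases r) (auto intro: Ck_on_pre_affine real_analytic_on_pre_affine)

lemma Cr_open_ident: "Cr_open r U (\<lambda>x::real. x)"
  by (cases r) (auto intro: Ck_on_ident real_analytic_on_ident)

lemma Cr_on_cong: "(\<And>x. x \<in> S \<Longrightarrow> f x = g x) \<Longrightarrow> Cr_on r S f \<longleftrightarrow> Cr_on r S g"
  unfolding Cr_on_def by simp

lemma Cr_on_subset:
  assumes "Cr_on r S f" "T \<subseteq> S"
  shows "Cr_on r T f"
  unfolding Cr_on_def
proof
  fix x assume "x \<in> T"
  then obtain U g where "open U" "x \<in> U" "Cr_open r U g" "\<forall>y\<in>U \<inter> S. g y = f y"
    using assms unfolding Cr_on_def by blast
  then show "\<exists>U g. open U \<and> x \<in> U \<and> Cr_open r U g \<and> (\<forall>y\<in>U \<inter> T. g y = f y)"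
    using assms(2) by (intro exI[of _ U] exI[of _ g]) auto
qed

lemma Cr_on_post_affine:
  assumes "Cr_on r S f"
  shows "Cr_on r S (\<lambda>x. p + q *\<^sub>R f x)"
  unfolding Cr_on_def
proof
  fix x assume "x \<in> S"
  then obtain U g where "open U" "x \<in> U" "Cr_open r U g" "\<forall>y\<in>U \<inter> S. g y = f y"
    using assms unfolding Cr_on_def by blast
  then show "\<exists>U g. open U \<and> x \<in> U \<and> Cr_open r U g \<and> (\<forall>y\<in>U \<inter> S. g y = p + q *\<^sub>R f y)"
    by (intro exI[of _ U] exI[of _ "\<lambda>x. p + q *\<^sub>R g x"]) (auto intro: Cr_open_post_affine)
qed

lemma Cr_on_pre_affine:
  fixes f :: "real \<Rightarrow> 'b::euclidean_space"
  assumes "q \<noteq> 0" "Cr_on r S f"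
  shows "Cr_on r ((\<lambda>x. p + q * x) -` S) (\<lambda>x. f (p + q * x))"
  unfolding Cr_on_def
proof
  fix x assume "x \<in> (\<lambda>x. p + q * x) -` S"
  then obtain U g where "open U" "p + q * x \<in> U" "Cr_open r U g" "\<forall>y\<in>U \<inter> S. g y = f y"
    using assms(2) unfolding Cr_on_def by blast
  then show "\<exists>U g. open U \<and> x \<in> U \<and> Cr_open r U g \<and>
      (\<forall>y\<in>U \<inter> (\<lambda>x. p + q * x) -` S. g y = f (p + q * y))"
    using assms(1)
    by (intro exI[of _ "(\<lambda>x. p + q * x) -` U"] exI[of _ "\<lambda>x. g (p + q * x)"])
      (auto intro: Cr_open_pre_affine open_vimage_affine)
qed

lemma Cr_on_ident: "Cr_on r S (\<lambda>x::real. x)"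
  unfolding Cr_on_def using Cr_open_ident by blast

section \<open>Piecewise diffeomorphisms between intervals\<close>

text \<open>Subdivisions in a form suited to induction and concatenation, over arbitrary intervals.
  The predicate sees the two end points and not the interval as a set, so that it can speak of
  segments of a path and of lengths \<open>b - a\<close>.\<close>

inductive pw :: "(real \<Rightarrow> real \<Rightarrow> bool) \<Rightarrow> real \<Rightarrow> real \<Rightarrow> bool" for P where
  single: "\<lbrakk>a < b; P a b\<rbrakk> \<Longrightarrow> pw P a b"
| step: "\<lbrakk>a < c; P a c; pw P c b\<rbrakk> \<Longrightarrow> pw P a b"

lemma pw_less: "pw P a b \<Longrightarrow> a < b"
  by (induction rule: pw.induct) auto

lemma pw_append: "pw P a c \<Longrightarrow> pw P c b \<Longrightarrow> pw P a b"
  by (induction rule: pw.induct) (auto intro: pw.step)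

text \<open>The division points are moved by \<open>\<xi>\<close>, and strict monotonicity keeps the
  pieces nondegenerate. It is applied both to affine maps and to reparametrizations.\<close>

lemma pw_transfer:
  assumes "pw P c d" "strict_mono_on {c..d} \<xi>"
    and "\<And>x y. \<lbrakk>c \<le> x; x < y; y \<le> d; P x y\<rbrakk> \<Longrightarrow> P' (\<xi> x) (\<xi> y)"
  shows "pw P' (\<xi> c) (\<xi> d)"
  using assms
proof (induction rule: pw.induct)
  case (single a b)
  then show ?case by (auto intro!: pw.single simp: strict_mono_on_def)
next
  case (step a c b)
  have lt: "c < b" using step.hyps(3) by (rule pw_less)
  have "strict_mono_on {c..b} \<xi>"
    using step.hyps(1) step.prems(1) by (auto simp: strict_mono_on_def)
  then have "pw P' (\<xi> c) (\<xi> b)"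
    using step.hyps(1) step.prems(2) by (intro step.IH) auto
  then show ?case
    using lt step.hyps step.prems by (auto intro!: pw.step[of _ "\<xi> c"] simp: strict_mono_on_def)
qed

lemma pw_mono:
  assumes "pw P a b" "\<And>x y. \<lbrakk>a \<le> x; x < y; y \<le> b; P x y\<rbrakk> \<Longrightarrow> P' x y"
  shows "pw P' a b"
  using pw_transfer[OF assms(1), of "\<lambda>x. x" P'] assms(2) by (auto simp: strict_mono_on_def)

lemma pw_subinterval:
  assumes "pw P a b" "a \<le> s" "s < t" "t \<le> b"
    and "\<And>x y s t. \<lbrakk>P x y; x \<le> s; s < t; t \<le> y\<rbrakk> \<Longrightarrow> P s t"
  shows "pw P s t"
  using assms(1-4)
proof (induction arbitrary: s t rule: pw.induct)
  case (single a b)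
  then show ?case using assms(5) by (auto intro!: pw.single)
next
  case (step a c b)
  consider "t \<le> c" | "c \<le> s" | "s < c" "c < t" by linarith
  then show ?case
  proof cases
    case 1
    then show ?thesis using step.hyps(2) step.prems assms(5) by (auto intro!: pw.single)
  next
    case 2
    then show ?thesis using step.IH step.prems by auto
  next
    case 3
    then show ?thesis
      using step.IH[of c t] step.hyps(2) step.prems assms(5)[of a c s c] by (auto intro!: pw.step[of s c])
  qed
qed

lemma piecewise_iff_pw: "piecewise P \<longleftrightarrow> pw (\<lambda>a b. P {a..b}) 0 1"
proof
  assume "piecewise P"
  then obtain n t where t: "n > 0" "t 0 = 0" "t n = 1"
    "\<forall>i<n. t i < t (Suc i) \<and> P {t i..t (Suc i)}"
    unfolding piecewise_def by blast
  \<comment> \<open>The case \<open>k = 0\<close> is excluded because \<open>pw\<close> admits no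
    one-point interval.\<close>
  have "pw (\<lambda>a b. P {a..b}) (t 0) (t k)" if "0 < k" "k \<le> n" for k
    using that
  proof (induction k)
    case (Suc k)
    have "pw (\<lambda>a b. P {a..b}) (t k) (t (Suc k))"
      using t(4) Suc.prems by (intro pw.single) auto
    then show ?case
      using Suc by (cases "k = 0") (auto intro: pw_append)
  qed auto
  from this[of n] show "pw (\<lambda>a b. P {a..b}) 0 1"
    using t by simp
next
  have "\<exists>n>0. \<exists>t. t 0 = a \<and> t n = b \<and> (\<forall>i<n. t i < t (Suc i) \<and> P {t i..t (Suc i)})"
    if "pw (\<lambda>a b. P {a..b}) a b" for a b
    using that
  proof (induction rule: pw.induct)
    case (single a b)
    then show ?case
      by (intro exI[of _ 1] conjI exI[of _ "case_nat a (\<lambda>_. b)"]) auto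
  next
    case (step a c b)
    then obtain n t where t: "n > 0" "t 0 = c" "t n = b"
      "\<forall>i<n. t i < t (Suc i) \<and> P {t i..t (Suc i)}" by blast
    then show ?case
      using step.hyps
      by (intro exI[of _ "Suc n"] conjI exI[of _ "case_nat a t"]) (auto split: nat.splits)
  qed
  then show "pw (\<lambda>a b. P {a..b}) 0 1 \<Longrightarrow> piecewise P"
    unfolding piecewise_def by auto
qed

text \<open>The inverse \<open>\<xi>\<close> is carried as an explicit function, since
  \<open>inv_into\<close> depends on the domain: restriction to a subinterval then keeps the same
  pair of functions, and gluing acts on both alike.\<close>

definition pw_diffeo_between :: "diff_class \<Rightarrow> (real \<Rightarrow> real) \<Rightarrow> (real \<Rightarrow> real) \<Rightarrow> real \<Rightarrow> real \<Rightarrow> real \<Rightarrow> real \<Rightarrow> bool"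
  where
  "pw_diffeo_between r \<psi> \<xi> a b c d \<longleftrightarrow>
     a < b \<and> c < d \<and> strict_mono_on {a..b} \<psi> \<and> \<psi> ` {a..b} = {c..d} \<and> (\<forall>x\<in>{a..b}. \<xi> (\<psi> x) = x) \<and>
     pw (\<lambda>x y. Cr_on r {x..y} \<psi>) a b \<and> pw (\<lambda>x y. Cr_on r {x..y} \<xi>) c d"

lemma strict_mono_image_endpoints:
  fixes \<psi> :: "real \<Rightarrow> real"
  assumes "strict_mono_on {a..b} \<psi>" "\<psi> ` {a..b} = {c..d}" "a < b" "c < d"
  shows "\<psi> a = c" "\<psi> b = d"
proof -
  have "c \<in> \<psi> ` {a..b}" "d \<in> \<psi> ` {a..b}"
    using assms(2,4) by auto
  then obtain x y where "x \<in> {a..b}" "\<psi> x = c" "y \<in> {a..b}" "\<psi> y = d"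
    by blast
  moreover have "a \<in> {a..b}" "b \<in> {a..b}"
    using assms(3) by simp_all
  then have "\<psi> a \<in> {c..d}" "\<psi> b \<in> {c..d}"
    unfolding assms(2)[symmetric] by (simp_all add: imageI)
  ultimately show "\<psi> a = c" "\<psi> b = d"
    using strict_mono_on_leD[OF assms(1), of a x] strict_mono_on_leD[OF assms(1), of y b] assms(3)
    by auto
qed

lemma pw_diffeo_between_endpoints:
  assumes "pw_diffeo_between r \<psi> \<xi> a b c d"
  shows "\<psi> a = c" "\<psi> b = d"
  using strict_mono_image_endpoints[of a b \<psi> c d] assms by (auto simp: pw_diffeo_between_def)

lemma pw_diffeo_between_sym:
  assumes "pw_diffeo_between r \<psi> \<xi> a b c d"
  shows "pw_diffeo_between r \<xi> \<psi> c d a b"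
proof -
  note * = assms[unfolded pw_diffeo_between_def]
  have "strict_mono_on {c..d} \<xi>"
  proof (rule strict_mono_onI)
    fix u v assume "u \<in> {c..d}" "v \<in> {c..d}" "u < v"
    moreover obtain x y where "x \<in> {a..b}" "u = \<psi> x" "y \<in> {a..b}" "v = \<psi> y"
      using calculation * by blast
    ultimately show "\<xi> u < \<xi> v"
      using * strict_mono_on_leD[of "{a..b}" \<psi> y x] by force
  qed
  moreover have "\<xi> ` {c..d} = {a..b}"
    using * by force
  moreover have "\<forall>y\<in>{c..d}. \<psi> (\<xi> y) = y"
    using * by force
  ultimately show ?thesis
    using * by (simp add: pw_diffeo_between_def)
qed

lemma pw_Cr_on_cong:
  assumes "pw (\<lambda>x y. Cr_on r {x..y} f) a b" "\<And>x. x \<in> {a..b} \<Longrightarrow> f x = g x"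
  shows "pw (\<lambda>x y. Cr_on r {x..y} g) a b"
proof (rule pw_mono[OF assms(1)])
  fix x y assume "a \<le> x" "y \<le> b" "Cr_on r {x..y} f"
  then show "Cr_on r {x..y} g"
    using Cr_on_cong[of "{x..y}" f g] assms(2) by auto
qed

text \<open>Both branches of \<open>\<psi>\<close> take the value \<open>n\<close> at
  \<open>m\<close>, and both branches of \<open>\<xi>\<close> the value \<open>m\<close> at
  \<open>n\<close>, so each branch may be used on its whole closed interval.\<close>

lemma pw_diffeo_between_glue:
  assumes "pw_diffeo_between r \<psi>1 \<xi>1 a m c n" "pw_diffeo_between r \<psi>2 \<xi>2 m b n d"
  defines "\<psi> \<equiv> \<lambda>x. if x \<le> m then \<psi>1 x else \<psi>2 x" and "\<xi> \<equiv> \<lambda>y. if y \<le> n then \<xi>1 y else \<xi>2 y"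
  shows "pw_diffeo_between r \<psi> \<xi> a b c d"
proof -
  note 1 = assms(1)[unfolded pw_diffeo_between_def] and 2 = assms(2)[unfolded pw_diffeo_between_def]
  note e = pw_diffeo_between_endpoints[OF assms(1)] pw_diffeo_between_endpoints[OF assms(2)]
    pw_diffeo_between_endpoints[OF pw_diffeo_between_sym[OF assms(1)]] pw_diffeo_between_endpoints[OF pw_diffeo_between_sym[OF assms(2)]]
  have \<psi>1: "\<psi> x = \<psi>1 x" if "x \<in> {a..m}" for x
    using that by (auto simp: \<psi>_def)
  have \<psi>2: "\<psi> x = \<psi>2 x" if "x \<in> {m..b}" for x
    using that e by (auto simp: \<psi>_def)
  have \<xi>1: "\<xi> x = \<xi>1 x" if "x \<in> {c..n}" for x
    using that by (auto simp: \<xi>_def)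
  have \<xi>2: "\<xi> x = \<xi>2 x" if "x \<in> {n..d}" for x
    using that e by (auto simp: \<xi>_def)
  have i1: "\<psi> ` {a..m} = {c..n}" and i2: "\<psi> ` {m..b} = {n..d}"
    using 1 2 image_cong[of "{a..m}" "{a..m}" \<psi> \<psi>1] image_cong[of "{m..b}" "{m..b}" \<psi> \<psi>2] \<psi>1 \<psi>2
    by simp_all
  have ab: "{a..b} = {a..m} \<union> {m..b}" and cd: "{c..d} = {c..n} \<union> {n..d}"
    using 1 2 by auto
  have "strict_mono_on {a..b} \<psi>"
  proof (rule strict_mono_onI)
    fix x y assume xy: "x \<in> {a..b}" "y \<in> {a..b}" "x < y"
    consider "y \<le> m" | "m \<le> x" | "x < m" "m < y" by linarith
    then show "\<psi> x < \<psi> y"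
    proof cases
      case 1
      then show ?thesis using xy assms(1) \<psi>1[of x] \<psi>1[of y] by (auto simp: pw_diffeo_between_def strict_mono_on_def)
    next
      case 2
      then show ?thesis using xy assms(2) \<psi>2[of x] \<psi>2[of y] by (auto simp: pw_diffeo_between_def strict_mono_on_def)
    next
      case 3
      then have "\<psi> x < n" "n < \<psi> y"
        using xy 1 2 e \<psi>1[of x] \<psi>2[of y] strict_mono_onD[of "{a..m}" \<psi>1 x m]
          strict_mono_onD[of "{m..b}" \<psi>2 m y] by auto
      then show ?thesis by simp
    qed
  qed
  moreover have "\<psi> ` {a..b} = {c..d}"
    unfolding ab cd image_Un i1 i2 ..
  moreover have "\<xi> (\<psi> x) = x" if "x \<in> {a..b}" for x
  proof (cases "x \<le> m")
    case True
    then have "x \<in> {a..m}" using that by auto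
    then have "\<psi> x \<in> {c..n}" using i1 by blast
    then show ?thesis
      using 1 \<psi>1[of x] \<xi>1[of "\<psi> x"] \<open>x \<in> {a..m}\<close> by simp
  next
    case False
    then have "x \<in> {m..b}" using that by auto
    then have "\<psi> x \<in> {n..d}" using i2 by blast
    then show ?thesis
      using 2 \<psi>2[of x] \<xi>2[of "\<psi> x"] \<open>x \<in> {m..b}\<close> by simp
  qed
  moreover have "pw (\<lambda>x y. Cr_on r {x..y} \<psi>) a b"
    using pw_Cr_on_cong[of r \<psi>1 a m \<psi>] pw_Cr_on_cong[of r \<psi>2 m b \<psi>] 1 2 \<psi>1 \<psi>2
    by (intro pw_append[of _ a m b]) simp_all
  moreover have "pw (\<lambda>x y. Cr_on r {x..y} \<xi>) c d"
    using pw_Cr_on_cong[of r \<xi>1 c n \<xi>] pw_Cr_on_cong[of r \<xi>2 n d \<xi>] 1 2 \<xi>1 \<xi>2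
    by (intro pw_append[of _ c n d]) simp_all
  ultimately show ?thesis
    using 1 2 by (simp add: pw_diffeo_between_def)
qed

lemma pw_Cr_on_subinterval:
  assumes "pw (\<lambda>x y. Cr_on r {x..y} f) a b" "a \<le> s" "s < t" "t \<le> b"
  shows "pw (\<lambda>x y. Cr_on r {x..y} f) s t"
  by (rule pw_subinterval[OF assms]) (erule Cr_on_subset, simp)

lemma pw_diffeo_between_restrict:
  assumes "pw_diffeo_between r \<psi> \<xi> a b c d" "a \<le> s" "s < t" "t \<le> b"
  shows "pw_diffeo_between r \<psi> \<xi> s t (\<psi> s) (\<psi> t)"
proof -
  note * = assms(1)[unfolded pw_diffeo_between_def] and ** = pw_diffeo_between_sym[OF assms(1), unfolded pw_diffeo_between_def]
  have lt: "\<psi> s < \<psi> t" and le: "c \<le> \<psi> s" "\<psi> t \<le> d"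
    using * assms(2-4) by (auto simp: strict_mono_on_def)
  have "\<psi> ` {s..t} = {\<psi> s..\<psi> t}"
  proof safe
    fix x assume "x \<in> {s..t}"
    then show "\<psi> x \<in> {\<psi> s..\<psi> t}"
      using strict_mono_on_leD[of "{a..b}" \<psi>] * assms(2-4) by auto
  next
    fix y assume y: "y \<in> {\<psi> s..\<psi> t}"
    then have "\<xi> y \<in> {\<xi> (\<psi> s)..\<xi> (\<psi> t)}"
      using strict_mono_on_leD[of "{c..d}" \<xi>] ** le by auto
    then show "y \<in> \<psi> ` {s..t}"
      using y * ** le assms(2-4) by (intro image_eqI[of _ _ "\<xi> y"]) auto
  qed
  moreover have "pw (\<lambda>x y. Cr_on r {x..y} \<psi>) s t"
    using * assms(2-4) pw_Cr_on_subinterval[of r \<psi> a b] by blast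
  moreover have "pw (\<lambda>x y. Cr_on r {x..y} \<xi>) (\<psi> s) (\<psi> t)"
    using * lt le pw_Cr_on_subinterval[of r \<xi> c d] by blast
  ultimately show ?thesis
    using * lt assms(2-4) by (auto simp: pw_diffeo_between_def strict_mono_on_def)
qed

lemma pw_Cr_on_pre_affine:
  fixes f :: "real \<Rightarrow> 'b::euclidean_space"
  assumes "pw (\<lambda>x y. Cr_on r {x..y} f) (p + q * a) (p + q * b)" "q > 0"
  shows "pw (\<lambda>x y. Cr_on r {x..y} (\<lambda>x. f (p + q * x))) a b"
proof -
  have "pw (\<lambda>x y. Cr_on r {x..y} (\<lambda>x. f (p + q * x))) ((p + q * a - p) / q) ((p + q * b - p) / q)"
  proof (rule pw_transfer[OF assms(1), of "\<lambda>x. (x - p) / q"])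
    show "strict_mono_on {p + q * a..p + q * b} (\<lambda>x. (x - p) / q)"
      using assms(2) by (auto simp: strict_mono_on_def divide_strict_right_mono)
    fix x y assume "Cr_on r {x..y} f"
    then have "Cr_on r ((\<lambda>x. p + q * x) -` {x..y}) (\<lambda>x. f (p + q * x))"
      using assms(2) by (intro Cr_on_pre_affine) auto
    then show "Cr_on r {(x - p) / q..(y - p) / q} (\<lambda>x. f (p + q * x))"
      by (rule Cr_on_subset) (use assms(2) in \<open>auto simp: field_simps\<close>)
  qed
  then show ?thesis using assms(2) by simp
qed

lemma pw_Cr_on_post_affine:
  assumes "pw (\<lambda>x y. Cr_on r {x..y} f) a b"
  shows "pw (\<lambda>x y. Cr_on r {x..y} (\<lambda>x. p + q *\<^sub>R f x)) a b"
  using assms by (rule pw_mono) (rule Cr_on_post_affine)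

lemma image_affine_interval: "q > 0 \<Longrightarrow> (\<lambda>x::real. p + q * x) ` {a..b} = {p + q * a..p + q * b}"
  using image_affinity_atLeastAtMost[of q p a b] by (auto simp: add.commute)

text \<open>The new inverse is \<open>(\<xi> y - p) / q\<close>, written so that
  \<open>pw_Cr_on_post_affine\<close> applies to it literally.\<close>

lemma pw_diffeo_between_pre_affine:
  assumes "pw_diffeo_between r \<psi> \<xi> (p + q * a) (p + q * b) c d" "q > 0"
  shows "pw_diffeo_between r (\<lambda>x. \<psi> (p + q * x)) (\<lambda>y. - p / q + (1 / q) *\<^sub>R \<xi> y) a b c d"
proof -
  note * = assms(1)[unfolded pw_diffeo_between_def]
  have "strict_mono_on {a..b} (\<lambda>x. \<psi> (p + q * x))"
    using * assms(2) by (auto simp: strict_mono_on_def)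
  moreover have "(\<lambda>x. \<psi> (p + q * x)) ` {a..b} = {c..d}"
    using * image_affine_interval[OF assms(2), of p a b] image_image[of \<psi> "\<lambda>x. p + q * x" "{a..b}"]
    by simp
  moreover have "- p / q + (1 / q) *\<^sub>R \<xi> (\<psi> (p + q * x)) = x" if "x \<in> {a..b}" for x
  proof -
    have "p + q * x \<in> {p + q * a..p + q * b}" using that assms(2) by auto
    then show ?thesis using * assms(2) by (simp add: field_simps)
  qed
  ultimately show ?thesis
    using * assms(2) pw_Cr_on_pre_affine[of r \<psi> p q a b]
      pw_Cr_on_post_affine[of r \<xi> c d "- p / q" "1 / q"]
    by (simp add: pw_diffeo_between_def)
qed

text \<open>Reflection reverses the order of the pieces, so the first piece has to be appended at
  the far end; \<open>pw_transfer\<close> covers increasing maps only.\<close>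

lemma pw_reflect:
  assumes "pw P a b" "\<And>x y. \<lbrakk>a \<le> x; x < y; y \<le> b; P x y\<rbrakk> \<Longrightarrow> P' (1 - y) (1 - x)"
  shows "pw P' (1 - b) (1 - a)"
  using assms
proof (induction rule: pw.induct)
  case (single a b)
  then show ?case by (auto intro!: pw.single)
next
  case (step a c b)
  have "c < b" using step.hyps(3) by (rule pw_less)
  then have "pw P' (1 - b) (1 - c)" "pw P' (1 - c) (1 - a)"
    using step by (auto intro!: pw.single step.IH)
  then show ?case by (rule pw_append)
qed

lemma pw_Cr_on_reflect:
  fixes f :: "real \<Rightarrow> real"
  assumes "pw (\<lambda>x y. Cr_on r {x..y} f) a b"
  shows "pw (\<lambda>x y. Cr_on r {x..y} (\<lambda>x. 1 - f (1 - x))) (1 - b) (1 - a)"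
  using assms
proof (rule pw_reflect)
  fix x y assume "Cr_on r {x..y} f"
  then have "Cr_on r ((\<lambda>x. 1 + (-1) * x) -` {x..y}) (\<lambda>x. 1 + (-1) *\<^sub>R f (1 + (-1) * x))"
    by (intro Cr_on_post_affine Cr_on_pre_affine) auto
  then have "Cr_on r {1 - y..1 - x} (\<lambda>x. 1 + (-1) *\<^sub>R f (1 + (-1) * x))"
    by (rule Cr_on_subset) auto
  then show "Cr_on r {1 - y..1 - x} (\<lambda>x. 1 - f (1 - x))"
    by simp
qed

lemma image_reflect_interval: "(\<lambda>x::real. 1 - x) ` {a..b} = {1 - b..1 - a}"
  using image_affinity_atLeastAtMost[of "-1" 1 a b] by auto

text \<open>Conjugation with \<open>1 - x\<close> reverses the orientation twice, hence preserves
  it.\<close>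

lemma pw_diffeo_between_reflect:
  assumes "pw_diffeo_between r \<psi> \<xi> a b c d"
  shows "pw_diffeo_between r (\<lambda>x. 1 - \<psi> (1 - x)) (\<lambda>x. 1 - \<xi> (1 - x)) (1 - b) (1 - a) (1 - d) (1 - c)"
proof -
  note * = assms(1)[unfolded pw_diffeo_between_def]
  have "strict_mono_on {1 - b..1 - a} (\<lambda>x. 1 - \<psi> (1 - x))"
    using * by (auto simp: strict_mono_on_def)
  moreover have "(\<lambda>x. 1 - \<psi> (1 - x)) ` {1 - b..1 - a} = (\<lambda>x. 1 - x) ` \<psi> ` (\<lambda>x. 1 - x) ` {1 - b..1 - a}"
    by (simp only: image_image)
  then have "(\<lambda>x. 1 - \<psi> (1 - x)) ` {1 - b..1 - a} = {1 - d..1 - c}"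
    using * by (simp add: image_reflect_interval)
  ultimately show ?thesis
    using * by (auto simp: pw_diffeo_between_def intro: pw_Cr_on_reflect)
qed

text \<open>Compares pieces of two paths in place, without stretching them to \<open>{0..1}\<close>,
  so that they can be restricted and glued directly.\<close>

definition reparam :: "diff_class \<Rightarrow> (real \<Rightarrow> 'm) \<Rightarrow> real \<Rightarrow> real \<Rightarrow> (real \<Rightarrow> 'm) \<Rightarrow> real \<Rightarrow> real \<Rightarrow> bool" where
  "reparam r \<gamma> a b \<gamma>' c d \<longleftrightarrow> (\<exists>\<psi> \<xi>. pw_diffeo_between r \<psi> \<xi> a b c d \<and> (\<forall>t\<in>{a..b}. \<gamma> t = \<gamma>' (\<psi> t)))"

lemma same_upto_param_iff_reparam: "same_upto_param r \<gamma> \<gamma>' \<longleftrightarrow> reparam r \<gamma> 0 1 \<gamma>' 0 1"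
proof
  assume "same_upto_param r \<gamma> \<gamma>'"
  then obtain \<psi> where \<psi>: "pw_diffeo r \<psi>" "\<forall>t\<in>{0..1}. \<gamma> t = \<gamma>' (\<psi> t)"
    unfolding same_upto_param_def by blast
  have "pw_diffeo_between r \<psi> (inv_into {0..1} \<psi>) 0 1 0 1"
    using \<psi>(1) by (simp add: pw_diffeo_def pw_diffeo_between_def piecewise_iff_pw bij_betw_def)
  then show "reparam r \<gamma> 0 1 \<gamma>' 0 1"
    using \<psi>(2) unfolding reparam_def by blast
next
  assume "reparam r \<gamma> 0 1 \<gamma>' 0 1"
  then obtain \<psi> \<xi> where p: "pw_diffeo_between r \<psi> \<xi> 0 1 0 1" and \<psi>: "\<forall>t\<in>{0..1}. \<gamma> t = \<gamma>' (\<psi> t)"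
    unfolding reparam_def by blast
  note * = p[unfolded pw_diffeo_between_def]
  have inj: "inj_on \<psi> {0..1}"
    using * by (auto intro: inj_on_inverseI)
  have "\<xi> y = inv_into {0..1} \<psi> y" if "y \<in> {0..1}" for y
  proof -
    have "y \<in> \<psi> ` {0..1}"
      using that * by simp
    then obtain x where "x \<in> {0..1}" "y = \<psi> x"
      by blast
    then show ?thesis
      using * inj by simp
  qed
  then have "pw (\<lambda>x y. Cr_on r {x..y} (inv_into {0..1} \<psi>)) 0 1"
    using * pw_Cr_on_cong[of r \<xi> 0 1] by auto
  then have "pw_diffeo r \<psi>"
    using * inj by (simp add: pw_diffeo_def piecewise_iff_pw bij_betw_def)
  then show "same_upto_param r \<gamma> \<gamma>'"
    using \<psi> unfolding same_upto_param_def by blast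
qed

lemma reparam_less: "reparam r \<gamma> a b \<gamma>' c d \<Longrightarrow> a < b" "reparam r \<gamma> a b \<gamma>' c d \<Longrightarrow> c < d"
  by (auto simp: reparam_def pw_diffeo_between_def)

lemma reparam_sym:
  assumes "reparam r \<gamma> a b \<gamma>' c d"
  shows "reparam r \<gamma>' c d \<gamma> a b"
proof -
  obtain \<psi> \<xi> where p: "pw_diffeo_between r \<psi> \<xi> a b c d" and \<psi>: "\<forall>t\<in>{a..b}. \<gamma> t = \<gamma>' (\<psi> t)"
    using assms unfolding reparam_def by blast
  note 1 = p[unfolded pw_diffeo_between_def] and 2 = pw_diffeo_between_sym[OF p, unfolded pw_diffeo_between_def]
  have "\<gamma>' t = \<gamma> (\<xi> t)" if "t \<in> {c..d}" for t
  proof -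
    have "\<xi> t \<in> {a..b}" using that 2 by blast
    then show ?thesis using \<psi> that 2 by simp
  qed
  then show ?thesis
    using pw_diffeo_between_sym[OF p] unfolding reparam_def by blast
qed

lemma reparam_refl:
  assumes "a < b" "\<And>t. t \<in> {a..b} \<Longrightarrow> \<gamma> t = \<gamma>' t"
  shows "reparam r \<gamma> a b \<gamma>' a b"
proof -
  have "pw_diffeo_between r (\<lambda>x. x) (\<lambda>x. x) a b a b"
    using assms(1) by (auto simp: pw_diffeo_between_def strict_mono_on_def intro: pw.single Cr_on_ident)
  then show ?thesis
    using assms(2) unfolding reparam_def by (intro exI[of _ "\<lambda>x. x"]) auto
qed

lemma reparam_glue:
  assumes "reparam r \<gamma> a m \<gamma>' c n" "reparam r \<gamma> m b \<gamma>' n d"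
  shows "reparam r \<gamma> a b \<gamma>' c d"
proof -
  obtain \<psi>1 \<xi>1 \<psi>2 \<xi>2 where p: "pw_diffeo_between r \<psi>1 \<xi>1 a m c n" "pw_diffeo_between r \<psi>2 \<xi>2 m b n d"
    and \<psi>: "\<forall>t\<in>{a..m}. \<gamma> t = \<gamma>' (\<psi>1 t)" "\<forall>t\<in>{m..b}. \<gamma> t = \<gamma>' (\<psi>2 t)"
    using assms unfolding reparam_def by blast
  show ?thesis
    using pw_diffeo_between_glue[OF p] \<psi> unfolding reparam_def by fastforce
qed

text \<open>As \<open>\<delta>\<close> is only required to agree with the rescaled
  \<open>\<gamma>\<close> on \<open>{a..b}\<close>, this one rule serves segments, both halves of a
  joined path, and the respective converses via the inverse affine map.\<close>

lemma reparam_pre_affine: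
  assumes "reparam r \<gamma> (p + q * a) (p + q * b) \<gamma>' c d" "q > 0"
    and "\<And>t. t \<in> {a..b} \<Longrightarrow> \<delta> t = \<gamma> (p + q * t)"
  shows "reparam r \<delta> a b \<gamma>' c d"
proof -
  obtain \<psi> \<xi> where p: "pw_diffeo_between r \<psi> \<xi> (p + q * a) (p + q * b) c d"
    and \<psi>: "\<forall>t\<in>{p + q * a..p + q * b}. \<gamma> t = \<gamma>' (\<psi> t)"
    using assms(1) unfolding reparam_def by blast
  have "\<delta> t = \<gamma>' (\<psi> (p + q * t))" if "t \<in> {a..b}" for t
    using that assms(2,3) \<psi> by simp
  then show ?thesis
    using pw_diffeo_between_pre_affine[OF p assms(2)] unfolding reparam_def by blast
qed

lemma reparam_segment:
  assumes "p < q"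
  shows "reparam r (segment p q \<gamma>) a b \<gamma>' c d \<longleftrightarrow> reparam r \<gamma> (p + (q - p) * a) (p + (q - p) * b) \<gamma>' c d"
proof
  assume *: "reparam r (segment p q \<gamma>) a b \<gamma>' c d"
  \<comment> \<open>The map \<open>x \<mapsto> - p / k + x / k\<close> inverts
    \<open>x \<mapsto> p + k * x\<close>; with \<open>k = q - p\<close> it recovers
    \<open>\<gamma>\<close> from its segment.\<close>
  have inv: "- p / k + 1 / k * (p + k * x) = x" "p + k * (- p / k + 1 / k * x) = x"
    if "k > 0" for k x :: real
    using that by (simp_all add: field_simps)
  show "reparam r \<gamma> (p + (q - p) * a) (p + (q - p) * b) \<gamma>' c d"
  proof (rule reparam_pre_affine)
    show "reparam r (segment p q \<gamma>) (- p / (q - p) + 1 / (q - p) * (p + (q - p) * a))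
        (- p / (q - p) + 1 / (q - p) * (p + (q - p) * b)) \<gamma>' c d"
      using * inv(1)[of "q - p"] assms by simp
    show "\<gamma> t = segment p q \<gamma> (- p / (q - p) + 1 / (q - p) * t)" for t
      unfolding segment_def using inv(2)[of "q - p" t] assms by simp
  qed (use assms in auto)
next
  assume "reparam r \<gamma> (p + (q - p) * a) (p + (q - p) * b) \<gamma>' c d"
  then show "reparam r (segment p q \<gamma>) a b \<gamma>' c d"
    using assms by (rule_tac reparam_pre_affine[of r \<gamma> p "q - p"]) (auto simp: segment_def)
qed

lemma reparam_self_segment: "p < q \<Longrightarrow> reparam r \<gamma> p q (segment p q \<gamma>) 0 1"
  using reparam_segment[of p q r \<gamma> 0 1] reparam_sym reparam_refl[of 0 1 "segment p q \<gamma>"] by fastforce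

text \<open>A single \<open>\<psi>\<close> serves all subintervals at once. This is how a whole
  subdivision is carried from one parametrization to another.\<close>

lemma reparam_restrict:
  assumes "reparam r \<gamma> a b \<gamma>' c d"
  obtains \<psi> where "\<psi> a = c" "\<psi> b = d" "strict_mono_on {a..b} \<psi>" "\<psi> ` {a..b} = {c..d}"
    "\<And>t. t \<in> {a..b} \<Longrightarrow> \<gamma> t = \<gamma>' (\<psi> t)"
    "\<And>s t. \<lbrakk>a \<le> s; s < t; t \<le> b\<rbrakk> \<Longrightarrow> reparam r \<gamma> s t \<gamma>' (\<psi> s) (\<psi> t)"
proof -
  obtain \<psi> \<xi> where p: "pw_diffeo_between r \<psi> \<xi> a b c d" and \<psi>: "\<forall>t\<in>{a..b}. \<gamma> t = \<gamma>' (\<psi> t)"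
    using assms unfolding reparam_def by blast
  have "reparam r \<gamma> s t \<gamma>' (\<psi> s) (\<psi> t)" if "a \<le> s" "s < t" "t \<le> b" for s t
    using pw_diffeo_between_restrict[OF p that] \<psi> that unfolding reparam_def by fastforce
  then show ?thesis
    using that[of \<psi>] pw_diffeo_between_endpoints[OF p] p \<psi> unfolding pw_diffeo_between_def by blast
qed

lemma reparam_reversepath:
  assumes "reparam r \<gamma> a b \<gamma>' c d"
  shows "reparam r (reversepath \<gamma>) (1 - b) (1 - a) (reversepath \<gamma>') (1 - d) (1 - c)"
proof -
  obtain \<psi> \<xi> where p: "pw_diffeo_between r \<psi> \<xi> a b c d" and \<psi>: "\<forall>t\<in>{a..b}. \<gamma> t = \<gamma>' (\<psi> t)"
    using assms unfolding reparam_def by blast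
  then show ?thesis
    using pw_diffeo_between_reflect[OF p] unfolding reparam_def by (fastforce simp: reversepath_def)
qed

lemma reparam_comp: "reparam r \<gamma> a b \<gamma>' c d \<Longrightarrow> reparam r (f \<circ> \<gamma>) a b (f \<circ> \<gamma>') c d"
  unfolding reparam_def by fastforce

lemma reparam_join1:
  fixes \<gamma> :: "real \<Rightarrow> 'm::topological_space"
  assumes "b \<le> 1/2"
  shows "reparam r (\<gamma> +++ \<delta>) a b \<gamma>' c d \<longleftrightarrow> reparam r \<gamma> (2 * a) (2 * b) \<gamma>' c d"
proof
  assume "reparam r (\<gamma> +++ \<delta>) a b \<gamma>' c d"
  then show "reparam r \<gamma> (2 * a) (2 * b) \<gamma>' c d"
    using assms by (rule_tac reparam_pre_affine[of r "\<gamma> +++ \<delta>" 0 "1/2"]) (auto simp: joinpaths_def)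
next
  assume "reparam r \<gamma> (2 * a) (2 * b) \<gamma>' c d"
  then show "reparam r (\<gamma> +++ \<delta>) a b \<gamma>' c d"
    using assms by (rule_tac reparam_pre_affine[of r \<gamma> 0 2]) (auto simp: joinpaths_def)
qed

text \<open>At \<open>t = 1/2\<close> the definition of \<open>joinpaths\<close> uses its first
  formula; composability makes the second one valid there as well.\<close>

lemma joinpaths_second_half:
  assumes "pathfinish \<gamma> = pathstart \<delta>" "t \<ge> 1/2"
  shows "(\<gamma> +++ \<delta>) t = \<delta> (2 * t - 1)"
proof (cases "t = 1/2")
  case True
  then show ?thesis
    unfolding True using assms(1) by (simp add: joinpaths_def pathstart_def pathfinish_def)
qed (use assms(2) in \<open>simp add: joinpaths_def\<close>)

lemma reparam_join2:
  fixes \<gamma> :: "real \<Rightarrow> 'm::topological_space"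
  assumes "a \<ge> 1/2" "pathfinish \<gamma> = pathstart \<delta>"
  shows "reparam r (\<gamma> +++ \<delta>) a b \<gamma>' c d \<longleftrightarrow> reparam r \<delta> (2 * a - 1) (2 * b - 1) \<gamma>' c d"
proof
  assume "reparam r (\<gamma> +++ \<delta>) a b \<gamma>' c d"
  then show "reparam r \<delta> (2 * a - 1) (2 * b - 1) \<gamma>' c d"
    using assms by (rule_tac reparam_pre_affine[of r "\<gamma> +++ \<delta>" "1/2" "1/2"])
      (auto simp: joinpaths_second_half field_simps)
next
  assume "reparam r \<delta> (2 * a - 1) (2 * b - 1) \<gamma>' c d"
  then show "reparam r (\<gamma> +++ \<delta>) a b \<gamma>' c d"
    using assms by (rule_tac reparam_pre_affine[of r \<delta> "-1" 2]) (auto simp: joinpaths_second_half)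
qed

lemma reparam_join:
  fixes \<gamma> :: "real \<Rightarrow> 'm::topological_space"
  assumes "pathfinish \<gamma> = pathstart \<delta>" "reparam r \<gamma> 0 1 \<gamma>' a m" "reparam r \<delta> 0 1 \<gamma>' m b"
  shows "reparam r (\<gamma> +++ \<delta>) 0 1 \<gamma>' a b"
proof (rule reparam_glue)
  show "reparam r (\<gamma> +++ \<delta>) 0 (1/2) \<gamma>' a m"
    using assms by (subst reparam_join1) auto
  show "reparam r (\<gamma> +++ \<delta>) (1/2) 1 \<gamma>' m b"
    using assms by (subst reparam_join2) auto
qed

section \<open>Finite paths\<close>

text \<open>\<open>q\<close> may be negative, so that inverse paths are covered along with
  segments.\<close>

lemma Cr_curve_pre_affine:
  assumes "Cr_curve r M S \<gamma>" "q \<noteq> 0" "\<And>t. t \<in> T \<Longrightarrow> \<delta> t = \<gamma> (p + q * t) \<and> p + q * t \<in> S"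
  shows "Cr_curve r M T \<delta>"
  unfolding Cr_curve_def
proof
  fix t assume t: "t \<in> T"
  then have "p + q * t \<in> S" using assms(3) by blast
  then obtain U c J where *: "(U, c) \<in> atlas M" "open J" "p + q * t \<in> J" "\<gamma> ` (J \<inter> S) \<subseteq> U"
    "Cr_on r (J \<inter> S) (c \<circ> \<gamma>)"
    using assms(1) unfolding Cr_curve_def by blast
  let ?K = "(\<lambda>x. p + q * x) -` J"
  have K: "open ?K" "t \<in> ?K"
    using *(2,3) by (auto intro: open_vimage_affine)
  have "\<delta> ` (?K \<inter> T) \<subseteq> U"
    using *(4) assms(3) by fastforce
  moreover have "Cr_on r (?K \<inter> T) (c \<circ> \<delta>)"
  proof -
    have "Cr_on r ((\<lambda>x. p + q * x) -` (J \<inter> S)) (\<lambda>x. (c \<circ> \<gamma>) (p + q * x))"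
      by (rule Cr_on_pre_affine[OF assms(2) *(5)])
    then have "Cr_on r (?K \<inter> T) (\<lambda>x. (c \<circ> \<gamma>) (p + q * x))"
      by (rule Cr_on_subset) (use assms(3) in auto)
    then show ?thesis
      using Cr_on_cong[of "?K \<inter> T" "\<lambda>x. (c \<circ> \<gamma>) (p + q * x)" "c \<circ> \<delta>" r] assms(3) by simp
  qed
  ultimately show "\<exists>(U, c)\<in>atlas M. \<exists>J. open J \<and> t \<in> J \<and> \<delta> ` (J \<inter> T) \<subseteq> U \<and> Cr_on r (J \<inter> T) (c \<circ> \<delta>)"
    using *(1) K by blast
qed

text \<open>The velocity is multiplied by \<open>q\<close>, hence stays nonzero, for either sign of
  \<open>q\<close>.\<close>

lemma embedded_on_pre_affine:
  assumes "embedded_on M S \<gamma>" "q \<noteq> 0" "\<And>t. t \<in> T \<Longrightarrow> \<delta> t = \<gamma> (p + q * t) \<and> p + q * t \<in> S"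
  shows "embedded_on M T \<delta>"
  unfolding embedded_on_def
proof (intro conjI ballI)
  show "inj_on \<delta> T"
  proof (rule inj_onI)
    fix x y assume xy: "x \<in> T" "y \<in> T" "\<delta> x = \<delta> y"
    have "inj_on \<gamma> S" using assms(1) unfolding embedded_on_def by blast
    then have "p + q * x = p + q * y"
      by (rule inj_onD) (use assms(3) xy in auto)
    then show "x = y" using assms(2) by simp
  qed
  fix t assume t: "t \<in> T"
  then have "p + q * t \<in> S" using assms(3) by blast
  then obtain U c v where *: "(U, c) \<in> atlas M" "\<gamma> (p + q * t) \<in> U" "v \<noteq> 0"
    "((c \<circ> \<gamma>) has_vector_derivative v) (at (p + q * t) within S)"
    using assms(1) unfolding embedded_on_def by blast
  have "((c \<circ> \<gamma>) has_vector_derivative v) (at (p + q * t) within (\<lambda>x. p + q * x) ` T)"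
    by (rule has_vector_derivative_within_subset[OF *(4)]) (use assms(3) in auto)
  moreover have "((\<lambda>x. p + q * x) has_vector_derivative q) (at t within T)"
    by (auto intro!: derivative_eq_intros simp: has_real_derivative_iff_has_vector_derivative[symmetric])
  ultimately have "((c \<circ> \<gamma>) \<circ> (\<lambda>x. p + q * x) has_vector_derivative q *\<^sub>R v) (at t within T)"
    by (intro vector_diff_chain_within)
  then have "((c \<circ> \<delta>) has_vector_derivative q *\<^sub>R v) (at t within T)"
    by (rule has_vector_derivative_transform_within[OF _ zero_less_one t]) (use assms(3) in auto)
  then show "\<exists>(U, c)\<in>atlas M. \<delta> t \<in> U \<and> (\<exists>v. v \<noteq> 0 \<and> ((c \<circ> \<delta>) has_vector_derivative v) (at t within T))"
    using *(1-3) assms(2,3) t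
    by (intro bexI[OF _ *(1)]) (simp, intro exI[of _ "q *\<^sub>R v"], simp)
qed

section \<open>Smooth pieces and simple pieces of a path\<close>

definition smooth_piece :: "diff_class \<Rightarrow> bool \<Rightarrow> ('m, 'e::euclidean_space) mfd \<Rightarrow> (real \<Rightarrow> 'm) \<Rightarrow> real \<Rightarrow> real \<Rightarrow> bool"
  where "smooth_piece r emb M \<gamma> a b \<longleftrightarrow> Cr_curve r M {a..b} \<gamma> \<and> (emb \<longrightarrow> embedded_on M {a..b} \<gamma>)"

lemma smooth_piece_pre_affine:
  assumes "smooth_piece r emb M \<gamma> c d" "q \<noteq> 0"
    and "\<And>t. t \<in> {a..b} \<Longrightarrow> \<delta> t = \<gamma> (p + q * t) \<and> p + q * t \<in> {c..d}"
  shows "smooth_piece r emb M \<delta> a b"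
  using assms(1) Cr_curve_pre_affine[of r M "{c..d}" \<gamma> q "{a..b}" \<delta> p, OF _ assms(2,3)]
    embedded_on_pre_affine[of M "{c..d}" \<gamma> q "{a..b}" \<delta> p, OF _ assms(2,3)]
  unfolding smooth_piece_def by blast

abbreviation pw_smooth :: "diff_class \<Rightarrow> bool \<Rightarrow> ('m, 'e::euclidean_space) mfd \<Rightarrow> (real \<Rightarrow> 'm) \<Rightarrow> real \<Rightarrow> real \<Rightarrow> bool"
  where "pw_smooth r emb M \<gamma> \<equiv> pw (smooth_piece r emb M \<gamma>)"

lemma pw_path_iff: "pw_path r emb M \<gamma> \<longleftrightarrow> pw_smooth r emb M \<gamma> 0 1"
  unfolding pw_path_def piecewise_iff_pw smooth_piece_def ..

lemma pw_smooth_subinterval: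
  assumes "pw_smooth r emb M \<gamma> a b" "a \<le> s" "s < t" "t \<le> b"
  shows "pw_smooth r emb M \<gamma> s t"
  using assms
proof (rule pw_subinterval)
  fix x y s t assume "smooth_piece r emb M \<gamma> x y" "x \<le> s" "t \<le> y"
  then show "smooth_piece r emb M \<gamma> s t"
    by (intro smooth_piece_pre_affine[of r emb M \<gamma> x y 1 s t \<gamma> 0]) auto
qed

lemma pw_smooth_pre_affine:
  assumes "pw_smooth r emb M \<gamma> (p + q * a) (p + q * b)" "q > 0"
    and "\<And>t. t \<in> {a..b} \<Longrightarrow> \<delta> t = \<gamma> (p + q * t)"
  shows "pw_smooth r emb M \<delta> a b"
proof -
  have "pw_smooth r emb M \<delta> ((p + q * a - p) / q) ((p + q * b - p) / q)"
  proof (rule pw_transfer[OF assms(1), of "\<lambda>x. (x - p) / q"])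
    show "strict_mono_on {p + q * a..p + q * b} (\<lambda>x. (x - p) / q)"
      using assms(2) by (auto simp: strict_mono_on_def divide_strict_right_mono)
    fix x y assume xy: "p + q * a \<le> x" "x < y" "y \<le> p + q * b" "smooth_piece r emb M \<gamma> x y"
    have "\<delta> t = \<gamma> (p + q * t) \<and> p + q * t \<in> {x..y}" if "t \<in> {(x - p) / q..(y - p) / q}" for t
    proof -
      have *: "x - p \<le> q * t" "q * t \<le> y - p"
        using that assms(2) by (auto simp: field_simps)
      then have "q * a \<le> q * t" "q * t \<le> q * b"
        using xy by linarith+
      then have "t \<in> {a..b}" using assms(2) by auto
      then show ?thesis using assms(3) * by auto
    qed
    then show "smooth_piece r emb M \<delta> ((x - p) / q) ((y - p) / q)"
      using assms(2) by (intro smooth_piece_pre_affine[OF xy(4), of q _ _ \<delta> p]) auto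
  qed
  then show ?thesis using assms(2) by simp
qed

lemma pw_smooth_segment:
  assumes "pw_smooth r emb M \<gamma> a b" "a < b"
  shows "pw_smooth r emb M (segment a b \<gamma>) 0 1"
  by (rule pw_smooth_pre_affine[of r emb M \<gamma> a "b - a"]) (use assms in \<open>simp_all add: segment_def\<close>)

lemma pw_smooth_reversepath:
  assumes "pw_smooth r emb M \<gamma> a b"
  shows "pw_smooth r emb M (reversepath \<gamma>) (1 - b) (1 - a)"
  using assms
proof (rule pw_reflect)
  fix x y assume "smooth_piece r emb M \<gamma> x y"
  then show "smooth_piece r emb M (reversepath \<gamma>) (1 - y) (1 - x)"
    by (rule smooth_piece_pre_affine[of _ _ _ _ _ _ "-1" _ _ _ 1]) (auto simp: reversepath_def)
qed

text \<open>The restriction to \<open>{a..b}\<close> is an edge or constant. The distance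
  \<open>b - a\<close> plays the role of the 1 in the definition of an edge: it allows the two ends
  to coincide.\<close>

definition simple_piece :: "(real \<Rightarrow> 'm) \<Rightarrow> real \<Rightarrow> real \<Rightarrow> bool" where
  "simple_piece \<gamma> a b \<longleftrightarrow>
     (\<forall>s\<in>{a..b}. \<forall>t\<in>{a..b}. \<gamma> s = \<gamma> t \<longrightarrow> \<bar>s - t\<bar> \<in> {0, b - a}) \<or> (\<exists>x. \<gamma> ` {a..b} = {x})"

text \<open>A reparametrization does not preserve distances, but within \<open>{c..d}\<close> the
  distance \<open>d - c\<close> occurs only between the two end points, and those correspond to
  \<open>a\<close> and \<open>b\<close>.\<close>

lemma simple_piece_reparam:
  assumes "reparam r \<gamma> a b \<gamma>' c d" "simple_piece \<gamma>' c d"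
  shows "simple_piece \<gamma> a b"
proof -
  obtain \<psi> where \<psi>: "\<psi> a = c" "\<psi> b = d" "strict_mono_on {a..b} \<psi>" "\<psi> ` {a..b} = {c..d}"
    "\<And>t. t \<in> {a..b} \<Longrightarrow> \<gamma> t = \<gamma>' (\<psi> t)"
    using reparam_restrict[OF assms(1)] by metis
  consider "\<forall>s\<in>{c..d}. \<forall>t\<in>{c..d}. \<gamma>' s = \<gamma>' t \<longrightarrow> \<bar>s - t\<bar> \<in> {0, d - c}"
    | x where "\<gamma>' ` {c..d} = {x}"
    using assms(2) unfolding simple_piece_def by blast
  then show ?thesis
  proof cases
    case 1
    have "\<bar>s - t\<bar> \<in> {0, b - a}" if st: "s \<in> {a..b}" "t \<in> {a..b}" "\<gamma> s = \<gamma> t" "s < t" for s t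
    proof -
      have lt: "\<psi> s < \<psi> t" using \<psi>(3) st by (auto simp: strict_mono_on_def)
      have in': "\<psi> s \<in> {c..d}" "\<psi> t \<in> {c..d}" using \<psi>(4) st by blast+
      then have "\<bar>\<psi> s - \<psi> t\<bar> \<in> {0, d - c}" using 1 \<psi>(5) st by simp
      then have "\<psi> s = \<psi> a" "\<psi> t = \<psi> b" using lt in' \<psi>(1,2) by auto
      then have "s = a" "t = b"
        using st strict_mono_onD[OF \<psi>(3), of a s] strict_mono_onD[OF \<psi>(3), of t b] by force+
      then show ?thesis using st by auto
    qed
    then have "\<bar>s - t\<bar> \<in> {0, b - a}" if "s \<in> {a..b}" "t \<in> {a..b}" "\<gamma> s = \<gamma> t" for s t
      using that by (cases s t rule: linorder_cases) (fastforce simp: abs_minus_commute)+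
    then show ?thesis unfolding simple_piece_def by blast
  next
    case (2 x)
    have "\<gamma> ` {a..b} = \<gamma>' ` \<psi> ` {a..b}"
      using \<psi>(5) by (simp add: image_image)
    then show ?thesis using 2 \<psi>(4) unfolding simple_piece_def by auto
  qed
qed

lemma simple_piece_reversepath:
  assumes "simple_piece \<gamma> a b"
  shows "simple_piece (reversepath \<gamma>) (1 - b) (1 - a)"
proof -
  consider "\<forall>s\<in>{a..b}. \<forall>t\<in>{a..b}. \<gamma> s = \<gamma> t \<longrightarrow> \<bar>s - t\<bar> \<in> {0, b - a}"
    | x where "\<gamma> ` {a..b} = {x}"
    using assms unfolding simple_piece_def by blast
  then show ?thesis
  proof cases
    case 1
    have "\<bar>s - t\<bar> \<in> {0, 1 - a - (1 - b)}"
      if "s \<in> {1 - b..1 - a}" "t \<in> {1 - b..1 - a}" "reversepath \<gamma> s = reversepath \<gamma> t" for s t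
      using 1[rule_format, of "1 - s" "1 - t"] that by (auto simp: reversepath_def abs_minus_commute)
    then show ?thesis unfolding simple_piece_def by blast
  next
    case (2 x)
    have "reversepath \<gamma> ` {1 - b..1 - a} = \<gamma> ` (\<lambda>x. 1 - x) ` {1 - b..1 - a}"
      unfolding image_image reversepath_def ..
    also have "\<dots> = {x}"
      unfolding image_reflect_interval using 2 by simp
    finally show ?thesis unfolding simple_piece_def by blast
  qed
qed

text \<open>The factors of a product, seen as pieces of the given path: products are bracketed to
  the right, so the preimage of \<open>1/2\<close> under the reparametrization cuts off the first
  factor, and the induction continues with the rest.\<close>

lemma pw_path_prod:
  fixes \<gamma> :: "real \<Rightarrow> 'm::topological_space"
  assumes "composable_list \<gamma>s" "reparam r \<gamma> a b (path_prod \<gamma>s) 0 1"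
    and "\<And>g s t. \<lbrakk>g \<in> set \<gamma>s; a \<le> s; s < t; t \<le> b; reparam r \<gamma> s t g 0 1\<rbrakk> \<Longrightarrow> R s t"
  shows "pw R a b"
  using assms
proof (induction \<gamma>s arbitrary: a rule: path_prod.induct)
  case (1 g)
  then show ?case using reparam_less(1)[OF "1.prems"(2)] by (auto intro: pw.single)
next
  case (2 g h gs)
  obtain \<psi> where \<psi>: "\<psi> a = 0" "\<psi> b = 1" "strict_mono_on {a..b} \<psi>" "\<psi> ` {a..b} = {0..1}"
    "\<And>s t. \<lbrakk>a \<le> s; s < t; t \<le> b\<rbrakk> \<Longrightarrow> reparam r \<gamma> s t (g +++ path_prod (h # gs)) (\<psi> s) (\<psi> t)"
    using reparam_restrict[OF "2.prems"(2)[unfolded path_prod.simps]] by metis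
  \<comment> \<open>At the parameter \<open>m\<close> with \<open>\<psi> m = 1/2\<close> the path
    passes from the first factor to the remaining ones.\<close>
  have "1/2 \<in> \<psi> ` {a..b}" unfolding \<psi>(4) by simp
  then obtain m where m: "m \<in> {a..b}" "\<psi> m = 1/2" by auto
  then have "m \<noteq> a" "m \<noteq> b" using \<psi>(1,2) by auto
  then have lt: "a < m" "m < b" using m by auto
  have "reparam r (g +++ path_prod (h # gs)) 0 (1/2) \<gamma> a m"
    using reparam_sym[OF \<psi>(5)[of a m]] lt m(2) \<psi>(1) by simp
  then have s1: "reparam r \<gamma> a m g 0 1"
    by (rule_tac reparam_sym) (simp add: reparam_join1)
  have pf: "pathfinish g = pathstart h" "composable_list (h # gs)"
    using "2.prems"(1) by (auto simp: composable_list_def)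
  have ps: "pathstart (path_prod (h # gs)) = pathstart h"
    by (induction gs arbitrary: h) (auto)
  have "reparam r (g +++ path_prod (h # gs)) (1/2) 1 \<gamma> m b"
    using reparam_sym[OF \<psi>(5)[of m b]] lt m(2) \<psi>(2) by simp
  then have s2: "reparam r \<gamma> m b (path_prod (h # gs)) 0 1"
    using pf(1) ps by (rule_tac reparam_sym) (simp add: reparam_join2)
  have "pw R m b"
  proof (rule "2.IH"[OF pf(2) s2])
    fix g' s t assume "g' \<in> set (h # gs)" "m \<le> s" "s < t" "t \<le> b" "reparam r \<gamma> s t g' 0 1"
    then show "R s t" using lt by (intro "2.prems"(3)[of g']) auto
  qed
  moreover have "R a m"
    using "2.prems"(3)[OF _ _ _ _ s1] lt by auto
  ultimately show ?case using pw.step[OF lt(1)] by blast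
next
  case 3
  then show ?case by (simp add: composable_list_def)
qed

lemma pathstart_segment [simp]: "pathstart (segment a b \<gamma>) = \<gamma> a"
  and pathfinish_segment [simp]: "pathfinish (segment a b \<gamma>) = \<gamma> b"
  by (simp_all add: pathstart_def pathfinish_def segment_def)

text \<open>Converse of \<open>pw_path_prod\<close>, with the segments of the path as factors. The
  starting point of the head is carried along so that the next segment can be put in front.\<close>

lemma path_prod_of_pw:
  fixes \<gamma> :: "real \<Rightarrow> 'm::topological_space"
  assumes "pw R a b"
  shows "\<exists>\<gamma>s. composable_list \<gamma>s \<and> pathstart (hd \<gamma>s) = \<gamma> a \<and> reparam r \<gamma> a b (path_prod \<gamma>s) 0 1 \<and>
    (\<forall>g\<in>set \<gamma>s. \<exists>s t. a \<le> s \<and> s < t \<and> t \<le> b \<and> R s t \<and> g = segment s t \<gamma>)"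
  using assms
proof (induction rule: pw.induct)
  case (single a b)
  then show ?case
    by (intro exI[of _ "[segment a b \<gamma>]"])
      (auto simp: composable_list_def reparam_self_segment)
next
  case (step a c b)
  then obtain \<gamma>s where *: "composable_list \<gamma>s" "pathstart (hd \<gamma>s) = \<gamma> c" "reparam r \<gamma> c b (path_prod \<gamma>s) 0 1"
    "\<forall>g\<in>set \<gamma>s. \<exists>s t. c \<le> s \<and> s < t \<and> t \<le> b \<and> R s t \<and> g = segment s t \<gamma>"
    by blast
  obtain h gs where \<gamma>s: "\<gamma>s = h # gs"
    using *(1) by (auto simp: composable_list_def neq_Nil_conv)
  let ?g = "segment a c \<gamma>"
  have pf: "pathfinish ?g = \<gamma> c" "pathstart ?g = \<gamma> a"
    by simp_all
  have ps: "pathstart (path_prod \<gamma>s) = \<gamma> c"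
    using *(2) \<gamma>s by (cases gs) auto
  have "reparam r (?g +++ path_prod \<gamma>s) 0 1 \<gamma> a b"
  proof (rule reparam_join)
    show "pathfinish ?g = pathstart (path_prod \<gamma>s)" using pf ps by simp
    show "reparam r ?g 0 1 \<gamma> a c" by (rule reparam_sym[OF reparam_self_segment[OF step.hyps(1)]])
    show "reparam r (path_prod \<gamma>s) 0 1 \<gamma> c b" by (rule reparam_sym[OF *(3)])
  qed
  then have "reparam r \<gamma> a b (path_prod (?g # \<gamma>s)) 0 1"
    unfolding \<gamma>s by (simp add: reparam_sym)
  moreover have "composable_list (?g # \<gamma>s)"
    using *(1,2) pf \<gamma>s by (simp add: composable_list_def)
  moreover have "\<forall>g\<in>set (?g # \<gamma>s). \<exists>s t. a \<le> s \<and> s < t \<and> t \<le> b \<and> R s t \<and> g = segment s t \<gamma>"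
  proof
    fix g assume "g \<in> set (?g # \<gamma>s)"
    then consider "g = ?g" | "g \<in> set \<gamma>s" by auto
    then show "\<exists>s t. a \<le> s \<and> s < t \<and> t \<le> b \<and> R s t \<and> g = segment s t \<gamma>"
    proof cases
      case 1
      then show ?thesis using step.hyps pw_less[OF step.hyps(3)]
        by (intro exI[of _ a] exI[of _ c]) auto
    next
      case 2
      then obtain s t where "c \<le> s" "s < t" "t \<le> b" "R s t" "g = segment s t \<gamma>" using *(4) by blast
      then show ?thesis using step.hyps(1) by (intro exI[of _ s] exI[of _ t]) auto
    qed
  qed
  ultimately show ?case using pf by (intro exI[of _ "?g # \<gamma>s"]) auto
qed

text \<open>Here the pieces are restrictions of the path itself. Therefore the closure properties of the set
  of paths need only affine reparametrizations, and not that compositions of \<open>C\<^sup>r\<close> maps are \<open>C\<^sup>r\<close>.\<close>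

lemma P_gen_iff:
  fixes M :: "('m::topological_space, 'e::euclidean_space) mfd"
  shows "\<gamma> \<in> P_gen r emb M \<longleftrightarrow> pw_smooth r emb M \<gamma> 0 1 \<and> pw (simple_piece \<gamma>) 0 1"
proof safe
  assume "\<gamma> \<in> P_gen r emb M"
  then obtain es where p: "pw_path r emb M \<gamma>" and es: "composable_list es" "reparam r \<gamma> 0 1 (path_prod es) 0 1"
    "\<And>e. e \<in> set es \<Longrightarrow> edge r emb M e \<or> trivial_path e"
    unfolding P_gen_def same_upto_param_iff_reparam by blast
  show "pw_smooth r emb M \<gamma> 0 1" using p by (simp add: pw_path_iff)
  show "pw (simple_piece \<gamma>) 0 1"
  proof (rule pw_path_prod[OF es(1,2)])
    fix e s t assume "e \<in> set es" and reparam: "reparam r \<gamma> s t e 0 1"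
    then have "simple_piece e 0 1"
      using es(3)[of e] unfolding simple_piece_def edge_def trivial_path_def by auto
    then show "simple_piece \<gamma> s t" using simple_piece_reparam[OF reparam] by blast
  qed
next
  assume p: "pw_smooth r emb M \<gamma> 0 1" and "pw (simple_piece \<gamma>) 0 1"
  from path_prod_of_pw[OF this(2)] obtain es where es: "composable_list es" "reparam r \<gamma> 0 1 (path_prod es) 0 1"
    "\<And>e. e \<in> set es \<Longrightarrow> \<exists>s t. 0 \<le> s \<and> s < t \<and> t \<le> 1 \<and> simple_piece \<gamma> s t \<and> e = segment s t \<gamma>"
    by meson
  have "edge r emb M e \<or> (pw_path r emb M e \<and> trivial_path e)" if "e \<in> set es" for e
  proof -
    obtain s t where st: "0 \<le> s" "s < t" "t \<le> 1" "simple_piece \<gamma> s t" "e = segment s t \<gamma>"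
      using es(3)[OF \<open>e \<in> set es\<close>] by blast
    have "pw_path r emb M e"
      unfolding pw_path_iff st(5) by (rule pw_smooth_segment[OF pw_smooth_subinterval[OF p st(1-3)] st(2)])
    moreover have "simple_piece e 0 1"
      using simple_piece_reparam[OF reparam_sym[OF reparam_self_segment[OF st(2)]] st(4)] st(5) by simp
    ultimately show ?thesis
      unfolding simple_piece_def edge_def trivial_path_def by auto
  qed
  then show "\<gamma> \<in> P_gen r emb M"
    using p es(1,2) unfolding P_gen_def same_upto_param_iff_reparam pw_path_iff by blast
qed

lemma pw_simple_piece_reparam:
  assumes "reparam r \<gamma> a b \<gamma>' c d" "pw (simple_piece \<gamma>') c d"
  shows "pw (simple_piece \<gamma>) a b"
proof -
  obtain \<psi> where \<psi>: "\<psi> c = a" "\<psi> d = b" "strict_mono_on {c..d} \<psi>"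
    "\<And>s t. \<lbrakk>c \<le> s; s < t; t \<le> d\<rbrakk> \<Longrightarrow> reparam r \<gamma>' s t \<gamma> (\<psi> s) (\<psi> t)"
    using reparam_restrict[OF reparam_sym[OF assms(1)]] by metis
  have "pw (simple_piece \<gamma>) (\<psi> c) (\<psi> d)"
    by (rule pw_transfer[OF assms(2) \<psi>(3)]) (rule simple_piece_reparam[OF reparam_sym[OF \<psi>(4)]])
  then show ?thesis using \<psi>(1,2) by simp
qed

lemma segment_in_P_gen_iff:
  fixes M :: "('m::topological_space, 'e::euclidean_space) mfd"
  assumes "a < b"
  shows "segment a b \<gamma> \<in> P_gen r emb M \<longleftrightarrow> pw_smooth r emb M \<gamma> a b \<and> pw (simple_piece \<gamma>) a b"
proof -
  note reparam = reparam_self_segment[OF assms, of r \<gamma>]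
  have "pw_smooth r emb M \<gamma> a b" if "pw_smooth r emb M (segment a b \<gamma>) 0 1"
  proof (rule pw_smooth_pre_affine)
    have "- a / (b - a) + 1 / (b - a) * a = 0" "- a / (b - a) + 1 / (b - a) * b = 1"
      using assms by (simp_all add: divide_simps)
    then show "pw_smooth r emb M (segment a b \<gamma>) (- a / (b - a) + 1 / (b - a) * a) (- a / (b - a) + 1 / (b - a) * b)"
      using that by simp
    show "\<gamma> t = segment a b \<gamma> (- a / (b - a) + 1 / (b - a) * t)" for t
    proof -
      have "(b - a) * (- a / (b - a) + 1 / (b - a) * t) = t - a"
        using assms by (subst distrib_left) simp
      then show ?thesis unfolding segment_def by simp
    qed
  qed (use assms in auto)
  then show ?thesis
    using pw_simple_piece_reparam[OF reparam] pw_simple_piece_reparam[OF reparam_sym[OF reparam]] pw_smooth_segment[OF _ assms]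
      P_gen_iff by blast
qed

text \<open>Two points of \<open>{s..t}\<close> can have distance \<open>b - a\<close> only if
  \<open>{s..t}\<close> is all of \<open>{a..b}\<close>, and then \<open>t - s\<close> equals
  \<open>b - a\<close>.\<close>

lemma simple_piece_subinterval:
  assumes "simple_piece \<gamma> a b" "a \<le> s" "s < t" "t \<le> b"
  shows "simple_piece \<gamma> s t"
proof -
  consider "\<forall>s\<in>{a..b}. \<forall>t\<in>{a..b}. \<gamma> s = \<gamma> t \<longrightarrow> \<bar>s - t\<bar> \<in> {0, b - a}"
    | x where "\<gamma> ` {a..b} = {x}"
    using assms(1) unfolding simple_piece_def by blast
  then show ?thesis
  proof cases
    case 1
    have "\<bar>x - y\<bar> \<in> {0, t - s}" if "x \<in> {s..t}" "y \<in> {s..t}" "\<gamma> x = \<gamma> y" for x y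
      using 1[rule_format, of x y] that assms(2-4) by auto
    then show ?thesis unfolding simple_piece_def by blast
  next
    case (2 x)
    have "\<gamma> ` {s..t} \<subseteq> {x}"
      using 2 assms(2-4) image_mono[of "{s..t}" "{a..b}" \<gamma>] by auto
    moreover have "\<gamma> ` {s..t} \<noteq> {}" using assms(3) by simp
    ultimately show ?thesis unfolding simple_piece_def by blast
  qed
qed

lemma segment_in_P_gen:
  fixes M :: "('m::topological_space, 'e::euclidean_space) mfd"
  assumes "\<gamma> \<in> P_gen r emb M" "0 \<le> a" "a < b" "b \<le> 1"
  shows "segment a b \<gamma> \<in> P_gen r emb M"
  using assms(1)[unfolded P_gen_iff] pw_smooth_subinterval[of r emb M \<gamma> 0 1 a b]
    pw_subinterval[of "simple_piece \<gamma>" 0 1 a b, OF _ _ _ _ simple_piece_subinterval] assms(2-4)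
  by (auto simp: segment_in_P_gen_iff)

lemma P_gen_cong:
  fixes M :: "('m::topological_space, 'e::euclidean_space) mfd"
  assumes "\<gamma> \<in> P_gen r emb M" "\<And>t. t \<in> {0..1} \<Longrightarrow> \<delta> t = \<gamma> t"
  shows "\<delta> \<in> P_gen r emb M"
  using assms pw_smooth_pre_affine[of r emb M \<gamma> 0 1 0 1 \<delta>]
    pw_simple_piece_reparam[OF reparam_refl[of 0 1 \<delta> \<gamma>]]
  by (auto simp: P_gen_iff)

lemma reversepath_in_P_gen:
  fixes M :: "('m::topological_space, 'e::euclidean_space) mfd"
  assumes "\<gamma> \<in> P_gen r emb M"
  shows "reversepath \<gamma> \<in> P_gen r emb M"
  using assms pw_smooth_reversepath[of r emb M \<gamma> 0 1]
    pw_reflect[of "simple_piece \<gamma>" 0 1 "simple_piece (reversepath \<gamma>)"] simple_piece_reversepath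
  by (auto simp: P_gen_iff)

text \<open>The two halves of the joined path agree on \<open>{0..1}\<close>, after stretching, with
  the factors; their subdivisions are concatenated at \<open>1/2\<close>.\<close>

lemma join_in_P_gen:
  fixes M :: "('m::topological_space, 'e::euclidean_space) mfd"
  assumes "\<gamma> \<in> P_gen r emb M" "\<delta> \<in> P_gen r emb M" "pathfinish \<gamma> = pathstart \<delta>"
  shows "\<gamma> +++ \<delta> \<in> P_gen r emb M"
proof -
  have "segment 0 (1/2) (\<gamma> +++ \<delta>) \<in> P_gen r emb M"
    by (rule P_gen_cong[OF assms(1)]) (auto simp: segment_def joinpaths_def)
  moreover have "segment (1/2) 1 (\<gamma> +++ \<delta>) \<in> P_gen r emb M"
    by (rule P_gen_cong[OF assms(2)]) (auto simp: segment_def joinpaths_second_half[OF assms(3)])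
  ultimately have "pw_smooth r emb M (\<gamma> +++ \<delta>) 0 (1/2)" "pw_smooth r emb M (\<gamma> +++ \<delta>) (1/2) 1"
    "pw (simple_piece (\<gamma> +++ \<delta>)) 0 (1/2)" "pw (simple_piece (\<gamma> +++ \<delta>)) (1/2) 1"
    by (simp_all add: segment_in_P_gen_iff)
  then show ?thesis
    unfolding P_gen_iff by (blast intro: pw_append)
qed

section \<open>The groupoid of paths\<close>

lemma reparam_endpoints:
  assumes "reparam r \<gamma> 0 1 \<gamma>' 0 1"
  shows "pathstart \<gamma> = pathstart \<gamma>'" "pathfinish \<gamma> = pathfinish \<gamma>'"
proof -
  obtain \<psi> where "\<psi> 0 = 0" "\<psi> 1 = 1" "\<And>t. t \<in> {0..1} \<Longrightarrow> \<gamma> t = \<gamma>' (\<psi> t)"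
    by (rule reparam_restrict[OF assms]) blast
  then show "pathstart \<gamma> = pathstart \<gamma>'" "pathfinish \<gamma> = pathfinish \<gamma>'"
    by (simp_all add: pathstart_def pathfinish_def)
qed

lemma reparam_self: "a < b \<Longrightarrow> reparam r \<gamma> a b \<gamma> a b"
  by (rule reparam_refl) auto

lemma reparam_into_join1: "reparam r \<gamma> 0 1 \<gamma>' 0 1 \<Longrightarrow> reparam r \<gamma> 0 1 (\<gamma>' +++ \<delta>) 0 (1/2)"
  by (rule reparam_sym, subst reparam_join1, simp, drule reparam_sym, simp)

lemma reparam_into_join2:
  "pathfinish \<gamma> = pathstart \<delta>' \<Longrightarrow> reparam r \<delta> 0 1 \<delta>' 0 1 \<Longrightarrow> reparam r \<delta> 0 1 (\<gamma> +++ \<delta>') (1/2) 1"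
  by (rule reparam_sym, subst reparam_join2, simp, simp, drule reparam_sym, simp)

lemma reparam_join_cong:
  assumes "reparam r \<gamma> 0 1 \<gamma>' 0 1" "reparam r \<delta> 0 1 \<delta>' 0 1" "pathfinish \<gamma> = pathstart \<delta>"
  shows "reparam r (\<gamma> +++ \<delta>) 0 1 (\<gamma>' +++ \<delta>') 0 1"
  using assms reparam_endpoints[OF assms(1)] reparam_endpoints[OF assms(2)]
  by (intro reparam_join[of _ _ _ _ _ "1/2"] reparam_into_join1 reparam_into_join2) auto

lemma reparam_assoc:
  assumes "pathfinish \<alpha> = pathstart \<beta>" "pathfinish \<beta> = pathstart \<gamma>"
  shows "reparam r ((\<alpha> +++ \<beta>) +++ \<gamma>) 0 1 (\<alpha> +++ (\<beta> +++ \<gamma>)) 0 1"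
proof (intro reparam_join)
  \<comment> \<open>In \<open>?X\<close> the three factors occupy the intervals from 0 to 1/2, from
    1/2 to 3/4 and from 3/4 to 1.\<close>
  let ?X = "\<alpha> +++ (\<beta> +++ \<gamma>)"
  show "reparam r \<alpha> 0 1 ?X 0 (1/2)"
    by (intro reparam_into_join1 reparam_self) auto
  show "reparam r \<beta> 0 1 ?X (1/2) (3/4)"
    using assms reparam_self[of 0 1 r \<beta>] by (rule_tac reparam_sym, subst reparam_join2) (auto simp: reparam_join1)
  show "reparam r \<gamma> 0 1 ?X (3/4) 1"
    using assms reparam_self[of 0 1 r \<gamma>] by (rule_tac reparam_sym, subst reparam_join2) (auto simp: reparam_join2)
qed (use assms in auto)

context
  fixes r :: diff_class and emb :: bool and M :: "('m::topological_space, 'e::euclidean_space) mfd"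
begin

abbreviation (input) "paths \<equiv> P_gen r emb M"
abbreviation (input) "pclass \<equiv> path_class r emb M"
abbreviation (input) "path_groupoid \<equiv> path_gpd r emb M"

lemma equiv_path_equiv: "equiv paths (path_equiv r emb M)"
proof (rule equivI)
  let ?R = "(path_step r emb M \<union> (path_step r emb M)\<inverse>)\<^sup>*"
  have "sym ?R" "trans ?R"
    by (auto intro: sym_rtrancl sym_Un_converse trans_rtrancl)
  then show "sym (path_equiv r emb M)" "trans (path_equiv r emb M)"
    unfolding path_equiv_def
    by (auto intro!: sym_Int trans_Int symI[of "paths \<times> paths"] transI[of "paths \<times> paths"])
qed (auto simp: path_equiv_def refl_on_def)

lemma pclass_eq_iff: "\<gamma> \<in> paths \<Longrightarrow> \<delta> \<in> paths \<Longrightarrow> pclass \<gamma> = pclass \<delta> \<longleftrightarrow> (\<gamma>, \<delta>) \<in> path_equiv r emb M"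
  unfolding path_class_def by (rule eq_equiv_class_iff[OF equiv_path_equiv])

lemma in_pclass_iff: "\<gamma> \<in> paths \<Longrightarrow> \<delta> \<in> pclass \<gamma> \<longleftrightarrow> \<delta> \<in> paths \<and> pclass \<delta> = pclass \<gamma>"
  using pclass_eq_iff[of \<gamma> \<delta>] unfolding path_class_def path_equiv_def by auto

lemma pclass_step: "(\<gamma>, \<delta>) \<in> path_step r emb M \<Longrightarrow> pclass \<gamma> = pclass \<delta>"
  by (subst pclass_eq_iff) (auto simp: path_equiv_def path_step_def)

lemma pclass_reparam: "\<gamma> \<in> paths \<Longrightarrow> \<delta> \<in> paths \<Longrightarrow> reparam r \<gamma> 0 1 \<delta> 0 1 \<Longrightarrow> pclass \<gamma> = pclass \<delta>"
  by (rule pclass_step) (simp add: path_step_def same_upto_param_iff_reparam)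

lemma pclass_retracing: "\<gamma> \<in> paths \<Longrightarrow> \<delta> \<in> paths \<Longrightarrow> inserts_retracing paths \<gamma> \<delta> \<Longrightarrow> pclass \<gamma> = pclass \<delta>"
  by (rule pclass_step) (simp add: path_step_def)

text \<open>The one induction over chains of elementary moves. Every later claim that something
  depends only on the path class is reduced to the two kinds of moves by this rule.\<close>

lemma pclass_invariant:
  assumes "\<And>\<gamma> \<delta>. \<lbrakk>\<gamma> \<in> paths; \<delta> \<in> paths; reparam r \<gamma> 0 1 \<delta> 0 1\<rbrakk> \<Longrightarrow> F \<gamma> = F \<delta>"
    and "\<And>\<gamma> \<delta>. \<lbrakk>\<gamma> \<in> paths; \<delta> \<in> paths; inserts_retracing paths \<gamma> \<delta>\<rbrakk> \<Longrightarrow> F \<gamma> = F \<delta>"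
    and "\<gamma> \<in> paths" "\<delta> \<in> paths" "pclass \<gamma> = pclass \<delta>"
  shows "F \<gamma> = F \<delta>"
proof -
  have step: "F \<gamma> = F \<delta>" if "(\<gamma>, \<delta>) \<in> path_step r emb M" for \<gamma> \<delta>
    using that assms(1,2) by (auto simp: path_step_def same_upto_param_iff_reparam)
  have "(\<gamma>, \<delta>) \<in> (path_step r emb M \<union> (path_step r emb M)\<inverse>)\<^sup>*"
    using assms(3-5) by (simp add: pclass_eq_iff path_equiv_def)
  then show ?thesis
    by (induction rule: rtrancl_induct) (auto dest: step)
qed

lemma pclass_endpoints:
  assumes "\<gamma> \<in> paths" "\<delta> \<in> paths" "pclass \<gamma> = pclass \<delta>"
  shows "pathstart \<gamma> = pathstart \<delta>" "pathfinish \<gamma> = pathfinish \<delta>"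
proof -
  have "(pathstart \<gamma>, pathfinish \<gamma>) = (pathstart \<delta>, pathfinish \<delta>)"
  proof (rule pclass_invariant[OF _ _ assms])
    fix \<gamma> \<delta> assume "inserts_retracing paths \<gamma> \<delta>"
    then show "(pathstart \<gamma>, pathfinish \<gamma>) = (pathstart \<delta>, pathfinish \<delta>)"
      by cases auto
  qed (auto simp: reparam_endpoints)
  then show "pathstart \<gamma> = pathstart \<delta>" "pathfinish \<gamma> = pathfinish \<delta>"
    by auto
qed

lemma pclass_assoc:
  assumes "\<alpha> \<in> paths" "\<beta> \<in> paths" "\<gamma> \<in> paths" "pathfinish \<alpha> = pathstart \<beta>" "pathfinish \<beta> = pathstart \<gamma>"
  shows "pclass ((\<alpha> +++ \<beta>) +++ \<gamma>) = pclass (\<alpha> +++ (\<beta> +++ \<gamma>))"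
  using assms by (intro pclass_reparam reparam_assoc) (auto intro!: join_in_P_gen)

lemma retracing_in_P_gen: "\<delta> \<in> paths \<Longrightarrow> \<delta> +++ reversepath \<delta> \<in> paths"
  by (intro join_in_P_gen reversepath_in_P_gen) auto

text \<open>The elementary move uses the first bracketing, whereas its reversal produces the
  second.\<close>

lemma pclass_insert_retracing:
  assumes "\<gamma>\<^sub>1 \<in> paths" "\<gamma>\<^sub>2 \<in> paths" "\<delta> \<in> paths" "pathfinish \<gamma>\<^sub>1 = pathstart \<gamma>\<^sub>2" "pathfinish \<gamma>\<^sub>1 = pathstart \<delta>"
  shows "pclass (\<gamma>\<^sub>1 +++ ((\<delta> +++ reversepath \<delta>) +++ \<gamma>\<^sub>2)) = pclass (\<gamma>\<^sub>1 +++ \<gamma>\<^sub>2)"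
    and "pclass ((\<gamma>\<^sub>1 +++ (\<delta> +++ reversepath \<delta>)) +++ \<gamma>\<^sub>2) = pclass (\<gamma>\<^sub>1 +++ \<gamma>\<^sub>2)"
proof -
  show 1: "pclass (\<gamma>\<^sub>1 +++ ((\<delta> +++ reversepath \<delta>) +++ \<gamma>\<^sub>2)) = pclass (\<gamma>\<^sub>1 +++ \<gamma>\<^sub>2)"
    using assms retracing_in_P_gen[OF assms(3)]
    by (intro pclass_retracing[symmetric] inserts_retracing.middle) (auto intro!: join_in_P_gen)
  show "pclass ((\<gamma>\<^sub>1 +++ (\<delta> +++ reversepath \<delta>)) +++ \<gamma>\<^sub>2) = pclass (\<gamma>\<^sub>1 +++ \<gamma>\<^sub>2)"
    unfolding 1[symmetric] using assms retracing_in_P_gen[OF assms(3)] by (intro pclass_assoc) auto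
qed

text \<open>A retracing equals its own inverse, so reversal turns a move into a move: insertions in
  the middle stay there, and those at the start and at the end are exchanged.\<close>

lemma pclass_reversepath:
  assumes "\<gamma> \<in> paths" "\<delta> \<in> paths" "pclass \<gamma> = pclass \<delta>"
  shows "pclass (reversepath \<gamma>) = pclass (reversepath \<delta>)"
proof (rule pclass_invariant[OF _ _ assms])
  fix \<gamma> \<delta> assume "\<gamma> \<in> paths" "\<delta> \<in> paths" "reparam r \<gamma> 0 1 \<delta> 0 1"
  then show "pclass (reversepath \<gamma>) = pclass (reversepath \<delta>)"
    using reparam_reversepath[of r \<gamma> 0 1 \<delta> 0 1] by (intro pclass_reparam) (auto simp: reversepath_in_P_gen)
next
  fix \<gamma> \<delta> assume \<gamma>: "\<gamma> \<in> paths" "\<delta> \<in> paths" "inserts_retracing paths \<gamma> \<delta>"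
  from \<gamma>(3) show "pclass (reversepath \<gamma>) = pclass (reversepath \<delta>)"
  proof cases
    case (middle \<gamma>\<^sub>1 \<gamma>\<^sub>2 \<eta>)
    then show ?thesis
      using pclass_insert_retracing(2)[of "reversepath \<gamma>\<^sub>2" "reversepath \<gamma>\<^sub>1" \<eta>]
      by (simp add: reversepath_joinpaths reversepath_in_P_gen)
  next
    case (at_end \<eta>)
    then have "inserts_retracing paths (reversepath \<gamma>) ((\<eta> +++ reversepath \<eta>) +++ reversepath \<gamma>)"
      using \<gamma>(1) by (intro inserts_retracing.at_start) (auto simp: reversepath_in_P_gen)
    moreover have "reversepath \<delta> = (\<eta> +++ reversepath \<eta>) +++ reversepath \<gamma>"
      using at_end by (simp add: reversepath_joinpaths)
    ultimately show ?thesis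
      using pclass_retracing[OF reversepath_in_P_gen[OF \<gamma>(1)] reversepath_in_P_gen[OF \<gamma>(2)]] by simp
  next
    case (at_start \<eta>)
    then have "inserts_retracing paths (reversepath \<gamma>) (reversepath \<gamma> +++ (\<eta> +++ reversepath \<eta>))"
      using \<gamma>(1) by (intro inserts_retracing.at_end) (auto simp: reversepath_in_P_gen)
    moreover have "reversepath \<delta> = reversepath \<gamma> +++ (\<eta> +++ reversepath \<eta>)"
      using at_start by (simp add: reversepath_joinpaths)
    ultimately show ?thesis
      using pclass_retracing[OF reversepath_in_P_gen[OF \<gamma>(1)] reversepath_in_P_gen[OF \<gamma>(2)]] by simp
  qed
qed

lemma pclass_join_left:
  assumes "\<gamma> \<in> paths" "\<delta> \<in> paths" "pclass \<gamma> = pclass \<delta>" "\<eta> \<in> paths" "pathfinish \<gamma> = pathstart \<eta>"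
  shows "pclass (\<gamma> +++ \<eta>) = pclass (\<delta> +++ \<eta>)"
proof -
  \<comment> \<open>The default \<open>{}\<close> makes the function total, since
    \<open>pclass_invariant\<close> offers no composability with \<open>\<eta>\<close> along the
    chain of moves.\<close>
  let ?F = "\<lambda>\<gamma>. if pathfinish \<gamma> = pathstart \<eta> then pclass (\<gamma> +++ \<eta>) else {}"
  have "?F \<gamma> = ?F \<delta>"
  proof (rule pclass_invariant[OF _ _ assms(1-3)])
    fix \<gamma> \<delta> assume \<gamma>: "\<gamma> \<in> paths" "\<delta> \<in> paths" "reparam r \<gamma> 0 1 \<delta> 0 1"
    note e = reparam_endpoints(2)[OF \<gamma>(3)]
    have "pclass (\<gamma> +++ \<eta>) = pclass (\<delta> +++ \<eta>)" if "pathfinish \<delta> = pathstart \<eta>"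
      using \<gamma> assms(4) that e by (intro pclass_reparam join_in_P_gen reparam_join_cong reparam_self) auto
    then show "?F \<gamma> = ?F \<delta>"
      using e by simp
  next
    fix \<gamma> \<delta> assume \<gamma>: "\<gamma> \<in> paths" "\<delta> \<in> paths" "inserts_retracing paths \<gamma> \<delta>"
    show "?F \<gamma> = ?F \<delta>"
    proof (cases "pathfinish \<gamma> = pathstart \<eta>")
      case True
      from \<gamma>(3) have "pclass (\<gamma> +++ \<eta>) = pclass (\<delta> +++ \<eta>)"
      proof cases
        case (middle \<gamma>\<^sub>1 \<gamma>\<^sub>2 \<epsilon>)
        let ?D = "\<epsilon> +++ reversepath \<epsilon>"
        have f: "pathfinish \<gamma>\<^sub>2 = pathstart \<eta>"
          using True middle by simp
        \<comment> \<open>The retracing is inserted between \<open>\<gamma>\<^sub>1\<close> and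
          \<open>\<gamma>\<^sub>2 +++ \<eta>\<close>, after which the brackets are moved
          back.\<close>
        have "pclass ((\<gamma>\<^sub>1 +++ \<gamma>\<^sub>2) +++ \<eta>) = pclass (\<gamma>\<^sub>1 +++ (\<gamma>\<^sub>2 +++ \<eta>))"
          using middle f assms(4) by (intro pclass_assoc) auto
        also have "\<dots> = pclass ((\<gamma>\<^sub>1 +++ ?D) +++ (\<gamma>\<^sub>2 +++ \<eta>))"
          using middle f assms(4) by (intro pclass_insert_retracing(2)[symmetric] join_in_P_gen) auto
        also have "\<dots> = pclass (((\<gamma>\<^sub>1 +++ ?D) +++ \<gamma>\<^sub>2) +++ \<eta>)"
          using middle f assms(4)
          by (intro pclass_assoc[symmetric] join_in_P_gen) (auto simp: reversepath_in_P_gen)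
        also have "\<dots> = pclass ((\<gamma>\<^sub>1 +++ (?D +++ \<gamma>\<^sub>2)) +++ \<eta>)"
        proof (rule pclass_reparam)
          show "reparam r (((\<gamma>\<^sub>1 +++ ?D) +++ \<gamma>\<^sub>2) +++ \<eta>) 0 1 ((\<gamma>\<^sub>1 +++ (?D +++ \<gamma>\<^sub>2)) +++ \<eta>) 0 1"
            using middle f by (intro reparam_join_cong reparam_assoc reparam_self) auto
        qed (use middle f assms(4) in \<open>auto intro!: join_in_P_gen reversepath_in_P_gen\<close>)
        finally show ?thesis
          using middle by simp
      next
        case (at_end \<epsilon>)
        then show ?thesis
          using pclass_insert_retracing(2)[of \<gamma> \<eta> \<epsilon>] \<gamma>(1) assms(4) True by simp
      next
        case (at_start \<epsilon>)
        let ?D = "\<epsilon> +++ reversepath \<epsilon>"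
        note D = retracing_in_P_gen[OF at_start(3)]
        have "pclass (\<gamma> +++ \<eta>) = pclass (?D +++ (\<gamma> +++ \<eta>))"
          using at_start True assms(4) D \<gamma>(1)
          by (intro pclass_retracing inserts_retracing.at_start) (auto intro!: join_in_P_gen)
        also have "\<dots> = pclass ((?D +++ \<gamma>) +++ \<eta>)"
          using at_start True assms(4) D \<gamma>(1) by (intro pclass_assoc[symmetric]) auto
        finally show ?thesis
          using at_start by simp
      qed
      moreover have "pathfinish \<delta> = pathstart \<eta>"
        using pclass_endpoints(2)[OF \<gamma>(1,2) pclass_retracing[OF \<gamma>]] True by simp
      ultimately show ?thesis using True by simp
    next
      case False
      then show ?thesis
        using pclass_endpoints(2)[OF \<gamma>(1,2) pclass_retracing[OF \<gamma>]] by simp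
    qed
  qed
  then show ?thesis
    using pclass_endpoints(2)[OF assms(1-3)] assms(5) by simp
qed

text \<open>The left factor is exchanged by \<open>pclass_join_left\<close>. For the right factor
  the product is reversed, which makes it a left factor.\<close>

lemma pclass_join:
  assumes "\<gamma> \<in> paths" "\<gamma>' \<in> paths" "pclass \<gamma> = pclass \<gamma>'" "\<delta> \<in> paths" "\<delta>' \<in> paths" "pclass \<delta> = pclass \<delta>'"
    and "pathfinish \<gamma> = pathstart \<delta>"
  shows "pclass (\<gamma> +++ \<delta>) = pclass (\<gamma>' +++ \<delta>')"
proof -
  note e = pclass_endpoints[OF assms(1-3)] pclass_endpoints[OF assms(4-6)]
  have "pclass (\<gamma> +++ \<delta>) = pclass (\<gamma>' +++ \<delta>)"
    using assms by (intro pclass_join_left) auto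
  also have "\<dots> = pclass (reversepath (reversepath \<delta> +++ reversepath \<gamma>'))"
    using e assms by (subst reversepath_joinpaths) auto
  also have "\<dots> = pclass (reversepath (reversepath \<delta>' +++ reversepath \<gamma>'))"
    using e assms pclass_reversepath[OF assms(4-6)]
    by (intro pclass_reversepath pclass_join_left) (auto intro!: join_in_P_gen reversepath_in_P_gen)
  also have "\<dots> = pclass (\<gamma>' +++ \<delta>')"
    using e assms by (subst reversepath_joinpaths) auto
  finally show ?thesis .
qed

lemma arr_path_gpd: "arr path_groupoid = pclass ` paths"
  by (auto simp: path_gpd_def quotient_def path_class_def)

lemma gcomposable_pclass:
  assumes "\<gamma> \<in> paths" "\<delta> \<in> paths"
  shows "gcomposable path_groupoid (pclass \<gamma>) (pclass \<delta>) \<longleftrightarrow> pathfinish \<gamma> = pathstart \<delta>"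
proof
  assume "gcomposable path_groupoid (pclass \<gamma>) (pclass \<delta>)"
  then obtain \<gamma>' \<delta>' where "\<gamma>' \<in> pclass \<gamma>" "\<delta>' \<in> pclass \<delta>" "pathfinish \<gamma>' = pathstart \<delta>'"
    by (auto simp: path_gpd_def)
  then show "pathfinish \<gamma> = pathstart \<delta>"
    using assms pclass_endpoints[of \<gamma> \<gamma>'] pclass_endpoints[of \<delta> \<delta>'] by (simp add: in_pclass_iff)
next
  assume "pathfinish \<gamma> = pathstart \<delta>"
  moreover have "\<gamma> \<in> pclass \<gamma>" "\<delta> \<in> pclass \<delta>"
    using assms by (simp_all add: in_pclass_iff)
  ultimately show "gcomposable path_groupoid (pclass \<gamma>) (pclass \<delta>)"
    by (auto simp: path_gpd_def)
qed

text \<open>The union in the definition runs over a single class, because products of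
  representatives are equivalent by \<open>pclass_join\<close>.\<close>

lemma gmult_pclass:
  assumes "\<gamma> \<in> paths" "\<delta> \<in> paths" "pathfinish \<gamma> = pathstart \<delta>"
  shows "gmult path_groupoid (pclass \<gamma>) (pclass \<delta>) = pclass (\<gamma> +++ \<delta>)"
proof -
  have "{pclass (\<gamma>' +++ \<delta>') |\<gamma>' \<delta>'. \<gamma>' \<in> pclass \<gamma> \<and> \<delta>' \<in> pclass \<delta> \<and> pathfinish \<gamma>' = pathstart \<delta>'}
      = {pclass (\<gamma> +++ \<delta>)}"
  proof safe
    fix \<gamma>' \<delta>' assume "\<gamma>' \<in> pclass \<gamma>" "\<delta>' \<in> pclass \<delta>" "pathfinish \<gamma>' = pathstart \<delta>'"
    then have "pclass (\<gamma>' +++ \<delta>') = pclass (\<gamma> +++ \<delta>)"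
      using assms by (intro pclass_join) (auto simp: in_pclass_iff)
    then show "x \<in> pclass (\<gamma>' +++ \<delta>') \<Longrightarrow> x \<in> pclass (\<gamma> +++ \<delta>)" "x \<in> pclass (\<gamma> +++ \<delta>) \<Longrightarrow> x \<in> pclass (\<gamma>' +++ \<delta>')" for x
      by simp_all
  next
    show "\<exists>\<gamma>' \<delta>'. pclass (\<gamma> +++ \<delta>) = pclass (\<gamma>' +++ \<delta>') \<and> \<gamma>' \<in> pclass \<gamma> \<and> \<delta>' \<in> pclass \<delta> \<and> pathfinish \<gamma>' = pathstart \<delta>'"
      using assms by (intro exI[of _ \<gamma>] exI[of _ \<delta>]) (simp add: in_pclass_iff)
  qed
  then show ?thesis by (simp add: path_gpd_def)
qed

lemma ginv_pclass:
  assumes "\<gamma> \<in> paths"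
  shows "ginv path_groupoid (pclass \<gamma>) = pclass (reversepath \<gamma>)"
proof -
  have "pclass (reversepath \<delta>) = pclass (reversepath \<gamma>)" if "\<delta> \<in> pclass \<gamma>" for \<delta>
    using that assms by (intro pclass_reversepath) (simp_all add: in_pclass_iff)
  then have "(\<Union>\<delta>\<in>pclass \<gamma>. pclass (reversepath \<delta>)) = (\<Union>\<delta>\<in>pclass \<gamma>. pclass (reversepath \<gamma>))"
    by (intro SUP_cong refl)
  moreover have "pclass \<gamma> \<noteq> {}" using in_pclass_iff[OF assms, of \<gamma>] assms by blast
  ultimately show ?thesis by (simp add: path_gpd_def)
qed

lemma gpd_generated_subset_arr:
  assumes "S \<subseteq> arr path_groupoid"
  shows "gpd_generated path_groupoid S \<subseteq> arr path_groupoid"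
proof
  fix a assume "a \<in> gpd_generated path_groupoid S"
  then show "a \<in> arr path_groupoid"
  proof induction
    case (inverse a)
    then show ?case by (auto simp: arr_path_gpd ginv_pclass reversepath_in_P_gen)
  next
    case (product a b)
    then show ?case by (auto simp: arr_path_gpd gmult_pclass gcomposable_pclass join_in_P_gen)
  qed (use assms in auto)
qed

section \<open>Values of generalized connections on products, trivial paths and inverses\<close>

context
  fixes G :: "('g, 'z) monoid_scheme"
  assumes group: "group G"
begin

lemma gen_conn_closed: "A \<in> gen_conn r emb M G \<Longrightarrow> \<gamma> \<in> paths \<Longrightarrow> A (pclass \<gamma>) \<in> carrier G"
  by (auto simp: gen_conn_def gpd_hom_def group_gpd_def arr_path_gpd)

lemma gen_conn_join:
  assumes "A \<in> gen_conn r emb M G" "\<gamma> \<in> paths" "\<delta> \<in> paths" "pathfinish \<gamma> = pathstart \<delta>"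
  shows "A (pclass (\<gamma> +++ \<delta>)) = A (pclass \<gamma>) \<otimes>\<^bsub>G\<^esub> A (pclass \<delta>)"
proof -
  have "A (gmult path_groupoid (pclass \<gamma>) (pclass \<delta>)) = A (pclass \<gamma>) \<otimes>\<^bsub>G\<^esub> A (pclass \<delta>)"
    using assms by (auto simp: gen_conn_def gpd_hom_def group_gpd_def arr_path_gpd gcomposable_pclass)
  then show ?thesis using assms by (simp add: gmult_pclass)
qed

lemma gen_connI:
  assumes "h \<in> extensional (arr path_groupoid)" "\<And>\<gamma>. \<gamma> \<in> paths \<Longrightarrow> h (pclass \<gamma>) \<in> carrier G"
    and "\<And>\<gamma> \<delta>. \<lbrakk>\<gamma> \<in> paths; \<delta> \<in> paths; pathfinish \<gamma> = pathstart \<delta>\<rbrakk> \<Longrightarrow>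
      h (pclass (\<gamma> +++ \<delta>)) = h (pclass \<gamma>) \<otimes>\<^bsub>G\<^esub> h (pclass \<delta>)"
  shows "h \<in> gen_conn r emb M G"
  using assms
  by (auto simp: gen_conn_def gpd_hom_def group_gpd_def arr_path_gpd PiE_def gcomposable_pclass gmult_pclass)

lemma gen_conn_reparam:
  "\<lbrakk>\<gamma> \<in> paths; \<delta> \<in> paths; reparam r \<gamma> 0 1 \<delta> 0 1\<rbrakk> \<Longrightarrow> A (pclass \<gamma>) = A (pclass \<delta>)"
  by (simp add: pclass_reparam[of \<gamma> \<delta>])

lemma idempotent_imp_one: "x \<in> carrier G \<Longrightarrow> x \<otimes>\<^bsub>G\<^esub> x = x \<Longrightarrow> x = \<one>\<^bsub>G\<^esub>"
  using group by (simp add: group.r_cancel_one)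

text \<open>A trivial path agrees pointwise with its product with itself, so its value is idempotent
  in the group.\<close>

lemma gen_conn_trivial:
  assumes "A \<in> gen_conn r emb M G" "\<gamma> \<in> paths" "trivial_path \<gamma>"
  shows "A (pclass \<gamma>) = \<one>\<^bsub>G\<^esub>"
proof -
  obtain x where "\<gamma> ` {0..1} = {x}"
    using assms(3) unfolding trivial_path_def by blast
  then have x: "\<gamma> t = x" if "t \<in> {0..1}" for t
    using that by blast
  then have pf: "pathfinish \<gamma> = pathstart \<gamma>"
    by (simp add: pathfinish_def pathstart_def)
  have "reparam r (\<gamma> +++ \<gamma>) 0 1 \<gamma> 0 1"
    by (rule reparam_refl) (auto simp: joinpaths_def x)
  then have "A (pclass (\<gamma> +++ \<gamma>)) = A (pclass \<gamma>)"
    using assms(2) pf by (intro gen_conn_reparam join_in_P_gen) auto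
  then show ?thesis
    using gen_conn_join[OF assms(1,2,2) pf] gen_conn_closed[OF assms(1,2)] idempotent_imp_one by simp
qed

text \<open>The retracing \<open>?D\<close> is equivalent to \<open>?D +++ ?D\<close>, which arises
  from it by inserting the same retracing at the end; hence its value is idempotent.\<close>

lemma gen_conn_reversepath:
  assumes "A \<in> gen_conn r emb M G" "\<gamma> \<in> paths"
  shows "A (pclass (reversepath \<gamma>)) = inv\<^bsub>G\<^esub> A (pclass \<gamma>)"
proof -
  let ?D = "\<gamma> +++ reversepath \<gamma>"
  note D = retracing_in_P_gen[OF assms(2)] and R = reversepath_in_P_gen[OF assms(2)]
  have "pclass ?D = pclass (?D +++ ?D)"
    using assms(2) D by (intro pclass_retracing inserts_retracing.at_end) (auto intro!: join_in_P_gen)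
  then have "A (pclass ?D) = \<one>\<^bsub>G\<^esub>"
    using gen_conn_join[OF assms(1) D D] gen_conn_closed[OF assms(1) D] idempotent_imp_one by simp
  then have "A (pclass \<gamma>) \<otimes>\<^bsub>G\<^esub> A (pclass (reversepath \<gamma>)) = \<one>\<^bsub>G\<^esub>"
    using gen_conn_join[OF assms R] by simp
  then show ?thesis
    using group.inv_equality[OF group] group.inv_inv[OF group] gen_conn_closed[OF assms(1)] assms(2) R
    by metis
qed

end

end

section \<open>Multiplicative functions on complete sets of paths\<close>

lemma segment_segment:
  "segment s t (segment a b \<gamma>) = segment (a + (b - a) * s) (a + (b - a) * t) \<gamma>"
  by (simp add: segment_def fun_eq_iff algebra_simps)

lemma segment_0_1 [simp]: "segment 0 1 \<gamma> = \<gamma>"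
  by (simp add: segment_def)

lemma segment_reversepath: "segment (1 - b) (1 - a) (reversepath \<gamma>) = reversepath (segment a b \<gamma>)"
  by (simp add: segment_def reversepath_def fun_eq_iff algebra_simps)

lemma reparam_segments:
  assumes "reparam r \<gamma> a b \<gamma>' c d"
  shows "reparam r (segment a b \<gamma>) 0 1 (segment c d \<gamma>') 0 1"
proof -
  note lt = reparam_less[OF assms]
  have "reparam r \<gamma>' c d (segment a b \<gamma>) 0 1"
    using assms lt(1) by (rule_tac reparam_sym) (simp add: reparam_segment)
  then show ?thesis
    using lt(2) by (rule_tac reparam_sym) (simp add: reparam_segment)
qed

lemma reparam_join_segments:
  fixes \<gamma> :: "real \<Rightarrow> 'm::topological_space"
  assumes "a < c" "c < b"
  shows "reparam r (segment a b \<gamma>) 0 1 (segment a c \<gamma> +++ segment c b \<gamma>) 0 1"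
proof -
  have "reparam r (segment a c \<gamma> +++ segment c b \<gamma>) 0 1 \<gamma> a b"
    using assms by (intro reparam_join[of _ _ _ _ _ c] reparam_sym[OF reparam_self_segment]) auto
  then have "reparam r \<gamma> a b (segment a c \<gamma> +++ segment c b \<gamma>) 0 1" by (rule reparam_sym)
  from reparam_segments[OF this] show ?thesis by simp
qed

text \<open>The third argument after \<open>\<gamma>\<close> is the product of the values of
  \<open>f\<close> along some subdivision of the interval into segments in \<open>Q\<close>. It is a
  relation because independence of the subdivision is only proved later, in
  \<open>hol_unique\<close>.\<close>

inductive hol :: "('g, 'z) monoid_scheme \<Rightarrow> (real \<Rightarrow> 'm) set \<Rightarrow> ((real \<Rightarrow> 'm) \<Rightarrow> 'g) \<Rightarrow> (real \<Rightarrow> 'm) \<Rightarrow>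
    real \<Rightarrow> real \<Rightarrow> 'g \<Rightarrow> bool" for G Q f \<gamma> where
  single: "\<lbrakk>a < b; segment a b \<gamma> \<in> Q\<rbrakk> \<Longrightarrow> hol G Q f \<gamma> a b (f (segment a b \<gamma>))"
| step: "\<lbrakk>a < c; segment a c \<gamma> \<in> Q; hol G Q f \<gamma> c b x\<rbrakk> \<Longrightarrow>
    hol G Q f \<gamma> a b (f (segment a c \<gamma>) \<otimes>\<^bsub>G\<^esub> x)"

lemma hol_less: "hol G Q f \<gamma> a b x \<Longrightarrow> a < b"
  by (induction rule: hol.induct) auto

lemma hol_imp_pw: "hol G Q f \<gamma> a b x \<Longrightarrow> pw (\<lambda>a b. segment a b \<gamma> \<in> Q) a b"
  by (induction rule: hol.induct) (auto intro: pw.intros)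

lemma hol_exists: "pw (\<lambda>a b. segment a b \<gamma> \<in> Q) a b \<Longrightarrow> \<exists>x. hol G Q f \<gamma> a b x"
  by (induction rule: pw.induct) (blast intro: hol.intros)+

section \<open>Segments of paths in a complete set\<close>

locale complete_set =
  fixes r :: diff_class and emb :: bool and M :: "('m::topological_space, 'e::euclidean_space) mfd"
    and Q :: "(real \<Rightarrow> 'm) set"
  assumes complete_Q: "complete_paths r emb M Q"
begin

lemma Q_subset: "\<gamma> \<in> Q \<Longrightarrow> \<gamma> \<in> P_gen r emb M"
  using complete_Q by (auto simp: complete_paths_def hereditary_def)

lemma Q_reversepath: "\<gamma> \<in> Q \<Longrightarrow> reversepath \<gamma> \<in> Q"
  using complete_Q by (auto simp: complete_paths_def hereditary_def)

lemma Q_decomposition: "\<gamma> \<in> Q \<Longrightarrow> decomposition r emb M \<gamma>s \<gamma> \<Longrightarrow> set \<gamma>s \<subseteq> Q"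
  using complete_Q by (auto simp: complete_paths_def hereditary_def)

text \<open>The one-element list consisting of \<open>\<delta>\<close> is a decomposition of
  \<open>\<gamma>\<close>.\<close>

lemma Q_reparam:
  assumes "\<gamma> \<in> Q" "\<delta> \<in> P_gen r emb M" "reparam r \<delta> 0 1 \<gamma> 0 1"
  shows "\<delta> \<in> Q"
  using Q_decomposition[OF assms(1), of "[\<delta>]"] assms(2,3)
  by (simp add: decomposition_def composable_list_def same_upto_param_iff_reparam)

lemma decomposition_segments:
  assumes "\<gamma> \<in> P_gen r emb M" "0 < m" "m < 1"
  shows "decomposition r emb M [segment 0 m \<gamma>, segment m 1 \<gamma>] \<gamma>"
  using assms reparam_sym[OF reparam_join_segments[of 0 m 1 r \<gamma>]]
  by (auto simp: decomposition_def composable_list_def same_upto_param_iff_reparam intro!: segment_in_P_gen)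

lemma Q_split:
  assumes "\<gamma> \<in> Q" "0 < m" "m < 1"
  shows "segment 0 m \<gamma> \<in> Q" "segment m 1 \<gamma> \<in> Q"
  using Q_decomposition[OF assms(1) decomposition_segments[OF Q_subset[OF assms(1)] assms(2,3)]]
  by auto

lemma Q_split_segment:
  assumes "segment a b \<gamma> \<in> Q" "a < c" "c < b"
  shows "segment a c \<gamma> \<in> Q" "segment c b \<gamma> \<in> Q"
proof -
  \<comment> \<open>The position of \<open>c\<close> after \<open>{a..b}\<close> has been stretched
    to \<open>{0..1}\<close>.\<close>
  have "0 < (c - a) / (b - a)" "(c - a) / (b - a) < 1" "(b - a) * ((c - a) / (b - a)) = c - a"
    using assms(2,3) by simp_all
  then show "segment a c \<gamma> \<in> Q" "segment c b \<gamma> \<in> Q"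
    using Q_split[OF assms(1), of "(c - a) / (b - a)"] by (simp_all add: segment_segment)
qed

lemma Q_subsegment:
  assumes "segment a b \<gamma> \<in> Q" "a \<le> s" "s < t" "t \<le> b"
  shows "segment s t \<gamma> \<in> Q"
proof -
  have "segment s b \<gamma> \<in> Q"
    using assms Q_split_segment(2)[of a b \<gamma> s] by (cases "a = s") auto
  then show ?thesis
    using assms Q_split_segment(1)[of s b \<gamma> t] by (cases "t = b") auto
qed

lemma Q_segment_reparam:
  assumes "reparam r \<gamma> a b \<gamma>' c d" "segment c d \<gamma>' \<in> Q" "segment a b \<gamma> \<in> P_gen r emb M"
  shows "segment a b \<gamma> \<in> Q"
  using Q_reparam[OF assms(2,3) reparam_segments[OF assms(1)]] .

text \<open>Completeness supplies factors in \<open>Q\<close> whose product is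
  \<open>\<gamma>\<close> only up to the parametrization. Each factor parametrizes a segment of
  \<open>\<gamma>\<close>, and \<open>Q_reparam\<close> puts that segment itself into
  \<open>Q\<close>.\<close>

lemma pw_Q:
  assumes "\<gamma> \<in> P_gen r emb M"
  shows "pw (\<lambda>a b. segment a b \<gamma> \<in> Q) 0 1"
proof -
  obtain \<gamma>s where \<gamma>s: "decomposition r emb M \<gamma>s \<gamma>" "set \<gamma>s \<subseteq> Q"
    using complete_Q assms unfolding complete_paths_def by blast
  then have *: "composable_list \<gamma>s" "reparam r \<gamma> 0 1 (path_prod \<gamma>s) 0 1"
    by (auto simp: decomposition_def same_upto_param_iff_reparam dest: reparam_sym)
  show ?thesis
  proof (rule pw_path_prod[OF *])
    fix g s t assume g: "g \<in> set \<gamma>s" "0 \<le> s" "s < t" "t \<le> 1" "reparam r \<gamma> s t g 0 1"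
    then show "segment s t \<gamma> \<in> Q"
      using Q_segment_reparam[OF g(5)] \<gamma>s(2) segment_in_P_gen[OF assms] by auto
  qed
qed

end

text \<open>What lets \<open>f\<close> extend to a homomorphism on path classes:
  \<open>f_split\<close> accounts for products, and \<open>f_reparam\<close> and
  \<open>f_reversepath\<close> for the two kinds of moves that generate path equivalence.\<close>

locale multiplicative = complete_set r emb M Q
  for r :: diff_class and emb :: bool and M :: "('m::topological_space, 'e::euclidean_space) mfd"
    and Q :: "(real \<Rightarrow> 'm) set" +
  fixes G :: "('g, 'z) monoid_scheme" (structure) and f :: "(real \<Rightarrow> 'm) \<Rightarrow> 'g"
  assumes group_G: "group G"
    and f_closed: "\<gamma> \<in> Q \<Longrightarrow> f \<gamma> \<in> carrier G"
    and f_reparam: "\<lbrakk>\<gamma> \<in> Q; \<delta> \<in> Q; reparam r \<gamma> 0 1 \<delta> 0 1\<rbrakk> \<Longrightarrow> f \<gamma> = f \<delta>"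
    and f_split: "\<lbrakk>\<gamma> \<in> Q; 0 < m; m < 1\<rbrakk> \<Longrightarrow> f \<gamma> = f (segment 0 m \<gamma>) \<otimes> f (segment m 1 \<gamma>)"
    and f_reversepath: "\<gamma> \<in> Q \<Longrightarrow> f (reversepath \<gamma>) = inv (f \<gamma>)"
begin

interpretation G: group G by (rule group_G)

lemma f_split_segment:
  assumes "segment a b \<gamma> \<in> Q" "a < c" "c < b"
  shows "f (segment a b \<gamma>) = f (segment a c \<gamma>) \<otimes> f (segment c b \<gamma>)"
proof -
  have "0 < (c - a) / (b - a)" "(c - a) / (b - a) < 1" "(b - a) * ((c - a) / (b - a)) = c - a"
    using assms(2,3) by simp_all
  then show ?thesis
    using f_split[OF assms(1), of "(c - a) / (b - a)"] by (simp add: segment_segment)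
qed

text \<open>The function \<open>u\<close> of the introduction: it compares all subdivisions at once.\<close>

definition transport :: "(real \<Rightarrow> 'm) \<Rightarrow> real \<Rightarrow> real \<Rightarrow> (real \<Rightarrow> 'g) \<Rightarrow> bool" where
  "transport \<gamma> a b u \<longleftrightarrow> (\<forall>t\<in>{a..b}. u t \<in> carrier G) \<and>
     (\<forall>s t. a \<le> s \<longrightarrow> s < t \<longrightarrow> t \<le> b \<longrightarrow> segment s t \<gamma> \<in> Q \<longrightarrow> u t = u s \<otimes> f (segment s t \<gamma>))"

text \<open>The property at general \<open>s < t\<close> is the splitting of the segment from
  \<open>a\<close> to \<open>t\<close> at \<open>s\<close>. The value at \<open>a\<close> is set to
  the unit separately, since the segment there would be degenerate.\<close>

lemma transport_single:
  assumes "a < b" "segment a b \<gamma> \<in> Q"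
  shows "transport \<gamma> a b (\<lambda>t. if t = a then \<one> else f (segment a t \<gamma>))"
  unfolding transport_def
proof (intro conjI allI impI ballI)
  fix t assume "t \<in> {a..b}"
  then show "(if t = a then \<one> else f (segment a t \<gamma>)) \<in> carrier G"
    using Q_subsegment[OF assms(2), of a t] f_closed by auto
next
  fix s t assume st: "a \<le> s" "s < t" "t \<le> b"
  have "segment a t \<gamma> \<in> Q"
    using Q_subsegment[OF assms(2), of a t] st by simp
  then show "(if t = a then \<one> else f (segment a t \<gamma>)) =
      (if s = a then \<one> else f (segment a s \<gamma>)) \<otimes> f (segment s t \<gamma>)"
    using st f_closed f_split_segment[of a t \<gamma> s] by auto
qed

text \<open>Multiplying \<open>v\<close> from the left by a constant preserves its property, and the
  constant \<open>u c \<otimes> inv (v c)\<close> makes both functions agree at \<open>c\<close>. A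
  segment in \<open>Q\<close> across \<open>c\<close> is cut there, and both halves are in
  \<open>Q\<close> again.\<close>

lemma transport_glue:
  assumes u: "transport \<gamma> a c u" and v: "transport \<gamma> c b v" and "a < c" "c < b"
  shows "transport \<gamma> a b (\<lambda>t. if t \<le> c then u t else u c \<otimes> inv (v c) \<otimes> v t)"
proof -
  let ?w = "\<lambda>t. if t \<le> c then u t else u c \<otimes> inv (v c) \<otimes> v t"
  have uC: "u t \<in> carrier G" if "a \<le> t" "t \<le> c" for t
    using u that by (auto simp: transport_def)
  have vC: "v t \<in> carrier G" if "c \<le> t" "t \<le> b" for t
    using v that by (auto simp: transport_def)
  have C: "u c \<in> carrier G" "v c \<in> carrier G" using uC vC assms(3,4) by auto
  have w: "?w t = u c \<otimes> inv (v c) \<otimes> v t" if "c \<le> t" for t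
    using that C by (auto simp: G.m_assoc)
  have left: "?w t = ?w s \<otimes> f (segment s t \<gamma>)" if "a \<le> s" "s < t" "t \<le> c" "segment s t \<gamma> \<in> Q" for s t
    using u that by (auto simp: transport_def)
  have right: "?w t = ?w s \<otimes> f (segment s t \<gamma>)" if st: "c \<le> s" "s < t" "t \<le> b" "segment s t \<gamma> \<in> Q" for s t
  proof -
    have "v t = v s \<otimes> f (segment s t \<gamma>)"
      using v st by (auto simp: transport_def)
    then show ?thesis
      using w[of s] w[of t] st C vC[of s] f_closed by (simp add: G.m_assoc)
  qed
  have wC: "?w t \<in> carrier G" if "t \<in> {a..b}" for t
    using that uC[of t] vC[of t] C by auto
  have "?w t = ?w s \<otimes> f (segment s t \<gamma>)" if st: "a \<le> s" "s < t" "t \<le> b" "segment s t \<gamma> \<in> Q" for s t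
  proof -
    consider "t \<le> c" | "c \<le> s" | "s < c" "c < t" by linarith
    then show ?thesis
    proof cases
      case 3
      note Q = Q_split_segment[OF st(4) 3]
      have "?w t = (?w s \<otimes> f (segment s c \<gamma>)) \<otimes> f (segment c t \<gamma>)"
        using right[OF _ 3(2) st(3) Q(2)] left[OF st(1) 3(1) _ Q(1)] by auto
      then show ?thesis
        using f_split_segment[OF st(4) 3] wC[of s] f_closed Q st by (simp add: G.m_assoc)
    qed (use st left right in auto)
  qed
  then show ?thesis
    using wC unfolding transport_def by blast
qed

lemma transport_exists: "pw (\<lambda>a b. segment a b \<gamma> \<in> Q) a b \<Longrightarrow> \<exists>u. transport \<gamma> a b u"
proof (induction rule: pw.induct)
  case (step a c b)
  then show ?case
    using transport_glue transport_single pw_less[OF step.hyps(3)] by blast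
qed (blast intro: transport_single)

lemma transport_subinterval: "transport \<gamma> a b u \<Longrightarrow> a \<le> s \<Longrightarrow> t \<le> b \<Longrightarrow> transport \<gamma> s t u"
  unfolding transport_def by auto

section \<open>Products of values along subdivisions\<close>

lemma hol_closed: "hol G Q f \<gamma> a b x \<Longrightarrow> x \<in> carrier G"
  by (induction rule: hol.induct) (auto intro: f_closed)

lemma hol_transport: "hol G Q f \<gamma> a b x \<Longrightarrow> transport \<gamma> a b u \<Longrightarrow> u b = u a \<otimes> x"
proof (induction rule: hol.induct)
  case (single a b)
  then show ?case by (auto simp: transport_def)
next
  case (step a c b x)
  have lt: "c < b" using step.hyps(3) by (rule hol_less)
  have "u b = u c \<otimes> x"
    using step.IH transport_subinterval[OF step.prems, of c b] step.hyps(1) by simp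
  moreover have "u c = u a \<otimes> f (segment a c \<gamma>)" "u a \<in> carrier G"
    using step.prems step.hyps(1,2) lt by (auto simp: transport_def)
  ultimately show ?case
    using hol_closed[OF step.hyps(3)] f_closed[OF step.hyps(2)] by (simp add: G.m_assoc)
qed

lemma hol_unique:
  assumes "hol G Q f \<gamma> a b x" "hol G Q f \<gamma> a b y"
  shows "x = y"
proof -
  obtain u where u: "transport \<gamma> a b u"
    using transport_exists[OF hol_imp_pw[OF assms(1)]] by blast
  have "u a \<in> carrier G"
    using u hol_less[OF assms(1)] by (auto simp: transport_def)
  moreover have "u a \<otimes> x = u a \<otimes> y"
    using hol_transport[OF assms(1) u] hol_transport[OF assms(2) u] by simp
  ultimately show ?thesis
    using hol_closed[OF assms(1)] hol_closed[OF assms(2)] by simp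
qed

lemma hol_append:
  "hol G Q f \<gamma> a c x \<Longrightarrow> hol G Q f \<gamma> c b y \<Longrightarrow> hol G Q f \<gamma> a b (x \<otimes> y)"
proof (induction rule: hol.induct)
  case (single a c)
  then show ?case by (intro hol.step)
next
  case (step a c d x)
  then have "hol G Q f \<gamma> a b (f (segment a c \<gamma>) \<otimes> (x \<otimes> y))"
    by (intro hol.step[OF step.hyps(1,2)]) auto
  then show ?case
    using hol_closed[OF step.hyps(3)] hol_closed[OF step.prems] f_closed[OF step.hyps(2)]
    by (simp add: G.m_assoc)
qed

text \<open>The subdivision of \<open>\<gamma>'\<close> is carried over to \<open>\<gamma>\<close>,
  piece by piece. \<open>Q_reparam\<close> yields members of \<open>Q\<close> only among paths,
  hence the last hypothesis.\<close>

lemma hol_reparam: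
  assumes "hol G Q f \<gamma>' c d x" "reparam r \<gamma> a b \<gamma>' c d"
    and "\<And>s t. \<lbrakk>a \<le> s; s < t; t \<le> b\<rbrakk> \<Longrightarrow> segment s t \<gamma> \<in> P_gen r emb M"
  shows "hol G Q f \<gamma> a b x"
proof -
  have piece: "segment s t \<gamma> \<in> Q \<and> f (segment s t \<gamma>) = f (segment p q \<gamma>')"
    if "segment p q \<gamma>' \<in> Q" "reparam r \<gamma>' p q \<gamma> s t" "a \<le> s" "t \<le> b" for p q s t
  proof -
    have "segment s t \<gamma> \<in> Q"
      using Q_segment_reparam[OF reparam_sym[OF that(2)] that(1)] assms(3) that reparam_less[OF that(2)] by blast
    then show ?thesis
      using f_reparam[OF that(1) _ reparam_segments[OF that(2)]] by simp
  qed
  \<comment> \<open>Each induction step cuts off the first piece, so the starting point must vary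
    while \<open>b\<close> stays fixed; \<open>a \<le> a'\<close> keeps the segments within the
    range where they are known to be paths.\<close>
  have "hol G Q f \<gamma> a' b x" if "hol G Q f \<gamma>' c d x" "reparam r \<gamma>' c d \<gamma> a' b" "a \<le> a'" for a'
    using that
  proof (induction arbitrary: a' rule: hol.induct)
    case (single p q)
    then show ?case
      using piece[of p q a' b] reparam_less[of r \<gamma>' p q \<gamma> a' b] hol.single[of a' b \<gamma> Q G f] by auto
  next
    case (step p m q x)
    have lt: "m < q" using step.hyps(3) by (rule hol_less)
    obtain \<psi> where \<psi>: "\<psi> p = a'" "\<psi> q = b"
      "\<And>s t. \<lbrakk>p \<le> s; s < t; t \<le> q\<rbrakk> \<Longrightarrow> reparam r \<gamma>' s t \<gamma> (\<psi> s) (\<psi> t)"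
      by (rule reparam_restrict[OF step.prems(1)]) blast
    have s1: "reparam r \<gamma>' p m \<gamma> a' (\<psi> m)"
      using \<psi>(3)[of p m] \<psi>(1) step.hyps(1) lt by simp
    have s2: "reparam r \<gamma>' m q \<gamma> (\<psi> m) b"
      using \<psi>(3)[of m q] \<psi>(2) step.hyps(1) lt by simp
    note lts = reparam_less(2)[OF s1] reparam_less(2)[OF s2]
    have "hol G Q f \<gamma> (\<psi> m) b x"
      using step.IH[OF s2] lts step.prems(2) by simp
    then show ?case
      using piece[OF step.hyps(2) s1] lts step.prems(2) hol.step[of a' "\<psi> m" \<gamma> Q G f b x] by simp
  qed
  then show ?thesis
    using assms(1) reparam_sym[OF assms(2)] by blast
qed

text \<open>The pieces of the inverse path come in the opposite order, matching the order of factors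
  in the inverse of a product.\<close>

lemma hol_reversepath:
  "hol G Q f \<gamma> a b x \<Longrightarrow> hol G Q f (reversepath \<gamma>) (1 - b) (1 - a) (inv x)"
proof (induction rule: hol.induct)
  case (single a b)
  then have "hol G Q f (reversepath \<gamma>) (1 - b) (1 - a) (f (reversepath (segment a b \<gamma>)))"
    using hol.single[of "1 - b" "1 - a" "reversepath \<gamma>" Q G f] Q_reversepath
    by (simp add: segment_reversepath)
  then show ?case using single by (simp add: f_reversepath)
next
  case (step a c b x)
  have "hol G Q f (reversepath \<gamma>) (1 - c) (1 - a) (inv (f (segment a c \<gamma>)))"
    using hol.single[of "1 - c" "1 - a" "reversepath \<gamma>" Q G f] Q_reversepath[OF step.hyps(2)] step.hyps
    by (simp add: segment_reversepath f_reversepath)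
  from hol_append[OF step.IH this] show ?case
    using hol_closed[OF step.hyps(3)] f_closed[OF step.hyps(2)] by (simp add: G.inv_mult_group)
qed

definition hol_val :: "(real \<Rightarrow> 'm) \<Rightarrow> 'g" where
  "hol_val \<gamma> = (THE x. hol G Q f \<gamma> 0 1 x)"

lemma hol_valI: "hol G Q f \<gamma> 0 1 x \<Longrightarrow> hol_val \<gamma> = x"
  unfolding hol_val_def using hol_unique by blast

lemma hol_val: "\<gamma> \<in> P_gen r emb M \<Longrightarrow> hol G Q f \<gamma> 0 1 (hol_val \<gamma>)"
  using hol_exists[OF pw_Q, of \<gamma> G f] hol_valI by metis

lemma hol_val_Q: "\<gamma> \<in> Q \<Longrightarrow> hol_val \<gamma> = f \<gamma>"
  using hol_valI[OF hol.single[of 0 1 \<gamma>]] by simp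

lemma hol_val_reparam:
  assumes "\<gamma> \<in> P_gen r emb M" "\<delta> \<in> P_gen r emb M" "reparam r \<gamma> 0 1 \<delta> 0 1"
  shows "hol_val \<gamma> = hol_val \<delta>"
  using hol_reparam[OF hol_val[OF assms(2)] assms(3)] segment_in_P_gen[OF assms(1)] by (intro hol_valI) auto

lemma hol_val_join:
  assumes "\<gamma> \<in> P_gen r emb M" "\<delta> \<in> P_gen r emb M" "pathfinish \<gamma> = pathstart \<delta>"
  shows "hol_val (\<gamma> +++ \<delta>) = hol_val \<gamma> \<otimes> hol_val \<delta>"
proof (intro hol_valI hol_append)
  note J = segment_in_P_gen[OF join_in_P_gen[OF assms]]
  show "hol G Q f (\<gamma> +++ \<delta>) 0 (1/2) (hol_val \<gamma>)"
    using J by (intro hol_reparam[OF hol_val[OF assms(1)]]) (auto simp: reparam_join1 reparam_self)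
  show "hol G Q f (\<gamma> +++ \<delta>) (1/2) 1 (hol_val \<delta>)"
    using J assms(3) by (intro hol_reparam[OF hol_val[OF assms(2)]]) (auto simp: reparam_join2 reparam_self)
qed

lemma hol_val_reversepath: "\<gamma> \<in> P_gen r emb M \<Longrightarrow> hol_val (reversepath \<gamma>) = inv (hol_val \<gamma>)"
  using hol_reversepath[OF hol_val] by (intro hol_valI) auto

lemma hol_val_closed: "\<gamma> \<in> P_gen r emb M \<Longrightarrow> hol_val \<gamma> \<in> carrier G"
  using hol_closed[OF hol_val] .

lemma hol_val_retracing:
  assumes "\<delta> \<in> P_gen r emb M"
  shows "hol_val (\<delta> +++ reversepath \<delta>) = \<one>"
  using assms hol_val_closed[OF assms]
  by (simp add: hol_val_join reversepath_in_P_gen hol_val_reversepath)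

text \<open>Reparametrizations are handled by \<open>hol_val_reparam\<close>; an inserted retracing
  contributes the factor \<open>\<one>\<close>.\<close>

lemma hol_val_class:
  assumes "\<gamma> \<in> P_gen r emb M" "\<delta> \<in> P_gen r emb M" "path_class r emb M \<gamma> = path_class r emb M \<delta>"
  shows "hol_val \<gamma> = hol_val \<delta>"
proof (rule pclass_invariant[OF _ _ assms])
  fix \<gamma> \<delta> assume "inserts_retracing (P_gen r emb M) \<gamma> \<delta>"
  then show "hol_val \<gamma> = hol_val \<delta>"
    by cases (simp_all add: hol_val_join hol_val_retracing hol_val_closed join_in_P_gen retracing_in_P_gen)
qed (rule hol_val_reparam)

text \<open>The representative chosen by \<open>SOME\<close> is immaterial by
  \<open>hol_val_class\<close>; homomorphisms have to be extensional on the arrows.\<close>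

definition conn :: "(real \<Rightarrow> 'm) set \<Rightarrow> 'g" where
  "conn = (\<lambda>c\<in>arr (path_gpd r emb M). hol_val (SOME \<gamma>. \<gamma> \<in> P_gen r emb M \<and> path_class r emb M \<gamma> = c))"

lemma conn_class:
  assumes "\<gamma> \<in> P_gen r emb M"
  shows "conn (path_class r emb M \<gamma>) = hol_val \<gamma>"
proof -
  let ?P = "\<lambda>\<delta>. \<delta> \<in> P_gen r emb M \<and> path_class r emb M \<delta> = path_class r emb M \<gamma>"
  have "?P (SOME \<delta>. ?P \<delta>)"
    using assms by (intro someI[of ?P]) simp
  then have "hol_val (SOME \<delta>. ?P \<delta>) = hol_val \<gamma>"
    using assms by (intro hol_val_class) simp_all
  then show ?thesis
    using assms by (simp add: conn_def arr_path_gpd)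
qed

lemma conn_in_gen_conn: "conn \<in> gen_conn r emb M G"
proof (rule gen_connI[OF group_G])
  show "conn \<in> extensional (arr (path_gpd r emb M))"
    by (simp add: conn_def)
qed (simp_all add: conn_class hol_val_closed hol_val_join join_in_P_gen)

text \<open>A homomorphism multiplies along subdivisions, so its values on \<open>Q\<close> force
  its value on every path. This is the source of uniqueness.\<close>

lemma hol_gen_conn:
  assumes "hol G Q f \<gamma> a b x" "B \<in> gen_conn r emb M G" "\<gamma> \<in> P_gen r emb M" "0 \<le> a" "b \<le> 1"
    and "\<And>\<delta>. \<delta> \<in> Q \<Longrightarrow> B (path_class r emb M \<delta>) = f \<delta>"
  shows "B (path_class r emb M (segment a b \<gamma>)) = x"
  using assms
proof (induction rule: hol.induct)
  case (step a c b x)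
  have lt: "c < b" using step.hyps(3) by (rule hol_less)
  have P: "segment a c \<gamma> \<in> P_gen r emb M" "segment c b \<gamma> \<in> P_gen r emb M" "segment a b \<gamma> \<in> P_gen r emb M"
    using step lt by (auto intro!: segment_in_P_gen)
  have "path_class r emb M (segment a b \<gamma>) = path_class r emb M (segment a c \<gamma> +++ segment c b \<gamma>)"
    using P step.hyps(1) lt by (intro pclass_reparam reparam_join_segments join_in_P_gen) auto
  then show ?case
    using step lt P gen_conn_join[OF group_G step.prems(1) P(1,2)] by simp
qed auto

lemma conn_unique:
  assumes "B \<in> gen_conn r emb M G" "\<And>\<delta>. \<delta> \<in> Q \<Longrightarrow> B (path_class r emb M \<delta>) = f \<delta>"
  shows "B = conn"
proof (rule extensionalityI)
  show "B \<in> extensional (arr (path_gpd r emb M))"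
    using assms(1) by (auto simp: gen_conn_def gpd_hom_def PiE_def)
  show "conn \<in> extensional (arr (path_gpd r emb M))"
    by (simp add: conn_def)
  fix c assume "c \<in> arr (path_gpd r emb M)"
  then obtain \<gamma> where "\<gamma> \<in> P_gen r emb M" "c = path_class r emb M \<gamma>"
    by (auto simp: arr_path_gpd)
  then show "B c = conn c"
    using hol_gen_conn[OF hol_val assms(1) _ _ _ assms(2), of \<gamma>] by (simp add: conn_class)
qed

end

section \<open>Admissible maps and the topology on generalized connections\<close>

text \<open>The common initial segment is \<open>\<gamma>\<close> itself, taken in full on its own
  side.\<close>

lemma share_initialI:
  assumes "\<gamma> \<in> P_gen r emb M" "s \<in> {0<..1}" "reparam r \<gamma> 0 1 (segment 0 s \<delta>) 0 1"
  shows "share_initial r emb M \<gamma> \<delta>"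
  unfolding share_initial_def initial_segment_upto_def
proof (intro bexI[OF _ assms(1)] conjI)
  show "\<exists>s\<in>{0<..1}. same_upto_param r \<gamma> (segment 0 s \<gamma>)"
    by (rule bexI[of _ 1]) (auto simp: same_upto_param_iff_reparam reparam_self)
  show "\<exists>s\<in>{0<..1}. same_upto_param r \<gamma> (segment 0 s \<delta>)"
    using assms(2,3) by (auto simp: same_upto_param_iff_reparam)
qed

lemma multiplicative_action:
  fixes M :: "('m::topological_space, 'e::euclidean_space) mfd" and G :: "('g, 'z) monoid_scheme" (structure)
  assumes Q: "complete_paths r emb M Q" and G: "group G"
    and \<phi>: "\<And>\<gamma>. \<gamma> \<in> P_gen r emb M \<Longrightarrow> \<phi> \<circ> \<gamma> \<in> P_gen r emb M"
    and \<kappa>: "admissible r emb M G Q \<kappa>" and A: "A \<in> gen_conn r emb M G"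
  shows "multiplicative r emb M Q G
    (\<lambda>\<gamma>. inv (\<kappa> \<gamma>) \<otimes> A (path_class r emb M (\<phi> \<circ> \<gamma>)) \<otimes> \<kappa> (reversepath \<gamma>))"
proof -
  interpret G: group G by (rule G)
  interpret complete_set r emb M Q by unfold_locales (rule Q)
  let ?a = "\<lambda>\<gamma>. A (path_class r emb M (\<phi> \<circ> \<gamma>))"
  have kC: "\<kappa> \<gamma> \<in> carrier G" if "\<gamma> \<in> Q" for \<gamma>
    using that \<kappa> by (auto simp: admissible_def)
  have aC: "?a \<gamma> \<in> carrier G" if "\<gamma> \<in> P_gen r emb M" for \<gamma>
    using that by (intro gen_conn_closed[OF G A] \<phi>)
  have cancel: "x \<otimes> (inv x \<otimes> y) = y" if "x \<in> carrier G" "y \<in> carrier G" for x y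
    using that by (simp add: G.m_assoc[symmetric])
  have k_initial: "\<kappa> \<gamma> = \<kappa> \<delta>" if "\<gamma> \<in> Q" "\<delta> \<in> Q" "s \<in> {0<..1}" "reparam r \<gamma> 0 1 (segment 0 s \<delta>) 0 1" for \<gamma> \<delta> s
  proof -
    have "share_initial r emb M \<gamma> \<delta>"
      by (rule share_initialI[OF Q_subset[OF that(1)] that(3,4)])
    then show ?thesis
      using \<kappa> that(1,2) unfolding admissible_def by blast
  qed
  have k_reparam: "\<kappa> \<gamma> = \<kappa> \<delta>" if "\<gamma> \<in> Q" "\<delta> \<in> Q" "reparam r \<gamma> 0 1 \<delta> 0 1" for \<gamma> \<delta>
    using k_initial[OF that(1,2), of 1] that(3) by simp
  have k_segment: "\<kappa> (segment 0 m \<gamma>) = \<kappa> \<gamma>" if "\<gamma> \<in> Q" "0 < m" "m < 1" for \<gamma> m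
    using k_initial[OF Q_split(1)[OF that] that(1), of m] that by (simp add: reparam_self)
  show ?thesis
  proof unfold_locales
    fix \<gamma> assume "\<gamma> \<in> Q"
    then show "inv (\<kappa> \<gamma>) \<otimes> ?a \<gamma> \<otimes> \<kappa> (reversepath \<gamma>) \<in> carrier G"
      using kC aC Q_reversepath Q_subset by simp
  next
    fix \<gamma> \<delta> assume \<gamma>: "\<gamma> \<in> Q" "\<delta> \<in> Q" "reparam r \<gamma> 0 1 \<delta> 0 1"
    have "reparam r (reversepath \<gamma>) 0 1 (reversepath \<delta>) 0 1"
      using reparam_reversepath[OF \<gamma>(3)] by simp
    then have "\<kappa> (reversepath \<gamma>) = \<kappa> (reversepath \<delta>)"
      using \<gamma> by (intro k_reparam Q_reversepath)
    moreover have "?a \<gamma> = ?a \<delta>"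
      using \<gamma> by (intro gen_conn_reparam[OF G] \<phi> Q_subset reparam_comp)
    ultimately show "inv (\<kappa> \<gamma>) \<otimes> ?a \<gamma> \<otimes> \<kappa> (reversepath \<gamma>) = inv (\<kappa> \<delta>) \<otimes> ?a \<delta> \<otimes> \<kappa> (reversepath \<delta>)"
      using k_reparam[OF \<gamma>] by simp
  next
    fix \<gamma> m assume \<gamma>: "\<gamma> \<in> Q" "0 < m" "m < (1::real)"
    let ?\<gamma>1 = "segment 0 m \<gamma>" and ?\<gamma>2 = "segment m 1 \<gamma>"
    note Q = Q_split[OF \<gamma>] and P = Q_subset[OF Q_split(1)[OF \<gamma>]] Q_subset[OF Q_split(2)[OF \<gamma>]]
    \<comment> \<open>Condition (ii) for the two halves of \<open>\<gamma>\<close>; this cancels the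
      inner factors.\<close>
    have "\<kappa> (reversepath ?\<gamma>1) = \<kappa> ?\<gamma>2"
      using \<kappa> \<gamma>(1) decomposition_segments[OF Q_subset[OF \<gamma>(1)] \<gamma>(2,3)] unfolding admissible_def by blast
    \<comment> \<open>The inverse of the final segment is the initial segment of
      \<open>reversepath \<gamma>\<close> of length \<open>1 - m\<close>, so condition (i)
      applies.\<close>
    moreover have "\<kappa> (reversepath ?\<gamma>2) = \<kappa> (reversepath \<gamma>)"
      using k_segment[OF Q_reversepath[OF \<gamma>(1)], of "1 - m"] \<gamma>(2,3) segment_reversepath[of 1 m \<gamma>]
      by simp
    moreover have "?a \<gamma> = ?a ?\<gamma>1 \<otimes> ?a ?\<gamma>2"
    proof -
      have J: "pathfinish (\<phi> \<circ> ?\<gamma>1) = pathstart (\<phi> \<circ> ?\<gamma>2)"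
        by (simp add: pathfinish_compose pathstart_compose)
      have "reparam r \<gamma> 0 1 (?\<gamma>1 +++ ?\<gamma>2) 0 1"
        using reparam_join_segments[of 0 m 1 r \<gamma>] \<gamma>(2,3) by simp
      then have reparam: "reparam r (\<phi> \<circ> \<gamma>) 0 1 ((\<phi> \<circ> ?\<gamma>1) +++ (\<phi> \<circ> ?\<gamma>2)) 0 1"
        unfolding path_compose_join[symmetric] by (rule reparam_comp)
      have "?a \<gamma> = A (path_class r emb M ((\<phi> \<circ> ?\<gamma>1) +++ (\<phi> \<circ> ?\<gamma>2)))"
        by (rule gen_conn_reparam[OF G \<phi>[OF Q_subset[OF \<gamma>(1)]] join_in_P_gen[OF \<phi>[OF P(1)] \<phi>[OF P(2)] J] reparam])
      also have "\<dots> = ?a ?\<gamma>1 \<otimes> ?a ?\<gamma>2"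
        using P J by (intro gen_conn_join[OF G A] \<phi>)
      finally show ?thesis .
    qed
    ultimately show "inv (\<kappa> \<gamma>) \<otimes> ?a \<gamma> \<otimes> \<kappa> (reversepath \<gamma>) =
        (inv (\<kappa> ?\<gamma>1) \<otimes> ?a ?\<gamma>1 \<otimes> \<kappa> (reversepath ?\<gamma>1)) \<otimes> (inv (\<kappa> ?\<gamma>2) \<otimes> ?a ?\<gamma>2 \<otimes> \<kappa> (reversepath ?\<gamma>2))"
      using k_segment[OF \<gamma>] kC[OF Q(2)] kC[OF \<gamma>(1)] kC[OF Q_reversepath[OF \<gamma>(1)]] aC[OF P(1)] aC[OF P(2)]
      by (simp add: G.m_assoc cancel)
  next
    fix \<gamma> assume \<gamma>: "\<gamma> \<in> Q"
    have "?a (reversepath \<gamma>) = inv (?a \<gamma>)"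
      using gen_conn_reversepath[OF G A \<phi>[OF Q_subset[OF \<gamma>]]] by (simp add: path_compose_reversepath)
    then show "inv (\<kappa> (reversepath \<gamma>)) \<otimes> ?a (reversepath \<gamma>) \<otimes> \<kappa> (reversepath (reversepath \<gamma>)) =
        inv (inv (\<kappa> \<gamma>) \<otimes> ?a \<gamma> \<otimes> \<kappa> (reversepath \<gamma>))"
      using kC[OF \<gamma>] kC[OF Q_reversepath[OF \<gamma>]] aC[OF Q_subset[OF \<gamma>]]
      by (simp add: G.inv_mult_group G.m_assoc)
  qed
qed

lemma edge_in_P_gen:
  fixes M :: "('m::topological_space, 'e::euclidean_space) mfd"
  assumes "edge r emb M e"
  shows "e \<in> P_gen r emb M"
proof -
  have "simple_piece e 0 1"
    using assms unfolding edge_def simple_piece_def by simp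
  then show ?thesis
    using assms by (auto simp: P_gen_iff edge_def pw_path_iff intro: pw.single)
qed

lemma hyph_nth_in_P_gen:
  fixes M :: "('m::topological_space, 'e::euclidean_space) mfd"
  assumes "hyph r emb M es" "i < length es"
  shows "es ! i \<in> P_gen r emb M"
proof (rule edge_in_P_gen)
  show "edge r emb M (es ! i)"
    using assms unfolding hyph_def by blast
qed

lemma restrict_gen_conn_hyph:
  fixes M :: "('m::topological_space, 'e::euclidean_space) mfd"
  assumes "A \<in> gen_conn r emb M G" "hyph r emb M es"
  shows "restrict A (arr (hyph_gpd r emb M es)) \<in> gpd_hom (hyph_gpd r emb M es) (group_gpd G)"
proof -
  have "set es \<subseteq> P_gen r emb M"
    using assms(2) hyph_nth_in_P_gen[of r emb M es] by (auto simp: in_set_conv_nth)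
  then have "path_class r emb M ` set es \<subseteq> arr (path_gpd r emb M)"
    by (auto simp: arr_path_gpd)
  from gpd_generated_subset_arr[OF this] show ?thesis
    using assms(1) by (auto simp: gen_conn_def gpd_hom_def hyph_gpd_def intro: gpd_generated.product)
qed

lemma class_in_hyph_gpd: "e \<in> set es \<Longrightarrow> path_class r emb M e \<in> arr (hyph_gpd r emb M es)"
  by (auto simp: hyph_gpd_def intro: gpd_generated.base)

lemma topspace_gen_conn_topology:
  fixes M :: "('m::topological_space, 'e::euclidean_space) mfd" and G :: "('g, 'z) monoid_scheme"
  shows "topspace (gen_conn_topology r emb M G T) = gen_conn r emb M G"
proof
  show "topspace (gen_conn_topology r emb M G T) \<subseteq> gen_conn r emb M G"
    unfolding gen_conn_topology_def by auto
  have hyph: "hyph r emb M []"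
    by (simp add: hyph_def)
  let ?W = "topspace (hyph_conn_topology r emb M G T [])"
  have "restrict A (arr (hyph_gpd r emb M [])) \<in> ?W" if "A \<in> gen_conn r emb M G" for A
    using restrict_gen_conn_hyph[OF that hyph]
    by (simp add: hyph_conn_topology_def topspace_pullback_topology fun_eq_iff)
  then show "gen_conn r emb M G \<subseteq> topspace (gen_conn_topology r emb M G T)"
    using hyph unfolding gen_conn_topology_def topology_generated_by_topspace
    by (intro subsetI UnionI[of "{h \<in> gen_conn r emb M G. restrict h (arr (hyph_gpd r emb M [])) \<in> ?W}"]) blast+
qed

section \<open>Continuity into and out of the space of generalized connections\<close>

locale top_group =
  fixes G :: "('g, 'z) monoid_scheme" (structure) and T :: "'g topology"
  assumes is_group: "group G" and topspace_eq: "topspace T = carrier G"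
    and continuous_mult: "continuous_map (prod_topology T T) T (\<lambda>(x, y). x \<otimes> y)"
    and continuous_inv: "continuous_map T T (\<lambda>x. inv x)"
begin

lemma continuous_map_mult:
  assumes "continuous_map X T f" "continuous_map X T g"
  shows "continuous_map X T (\<lambda>x. f x \<otimes> g x)"
  using continuous_map_compose[OF continuous_map_pairedI[OF assms] continuous_mult] by (simp add: comp_def)

lemma continuous_map_inverse: "continuous_map X T f \<Longrightarrow> continuous_map X T (\<lambda>x. inv (f x))"
  using continuous_map_compose[OF _ continuous_inv] by (fastforce simp: comp_def)

text \<open>Continuity passes from pieces to products by continuity of the multiplication. It is
  used with \<open>R\<close> saying that a piece is simple, for evaluations, and with
  \<open>R\<close> saying that a segment is in \<open>Q\<close>, for the continuity of
  \<open>\<Theta>\<close>.\<close>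

lemma continuous_map_class_segment:
  fixes M :: "('m::topological_space, 'e::euclidean_space) mfd"
  assumes "pw R a b" "0 \<le> a" "b \<le> 1" "\<gamma> \<in> P_gen r emb M"
    and "\<And>x. x \<in> topspace X \<Longrightarrow> B x \<in> gen_conn r emb M G"
    and "\<And>s t. \<lbrakk>0 \<le> s; s < t; t \<le> 1; R s t\<rbrakk> \<Longrightarrow>
      continuous_map X T (\<lambda>x. B x (path_class r emb M (segment s t \<gamma>)))"
  shows "continuous_map X T (\<lambda>x. B x (path_class r emb M (segment a b \<gamma>)))"
  using assms(1-3)
proof (induction rule: pw.induct)
  case (single a b)
  then show ?case using assms(6) by auto
next
  case (step a c b)
  have lt: "c < b" using step.hyps(3) by (rule pw_less)
  have P: "segment a c \<gamma> \<in> P_gen r emb M" "segment c b \<gamma> \<in> P_gen r emb M" "segment a b \<gamma> \<in> P_gen r emb M"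
    using step lt assms(4) by (auto intro!: segment_in_P_gen)
  have "path_class r emb M (segment a b \<gamma>) = path_class r emb M (segment a c \<gamma> +++ segment c b \<gamma>)"
    using P step.hyps(1) lt by (intro pclass_reparam reparam_join_segments join_in_P_gen) auto
  then have eq: "B x (path_class r emb M (segment a c \<gamma>)) \<otimes> B x (path_class r emb M (segment c b \<gamma>))
      = B x (path_class r emb M (segment a b \<gamma>))" if "x \<in> topspace X" for x
    using gen_conn_join[OF is_group assms(5)[OF that] P(1,2)] by simp
  have "continuous_map X T (\<lambda>x. B x (path_class r emb M (segment a c \<gamma>)))"
    "continuous_map X T (\<lambda>x. B x (path_class r emb M (segment c b \<gamma>)))"
    using step lt assms(6) by auto
  from continuous_map_eq[OF continuous_map_mult[OF this] eq] show ?case .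
qed

lemma continuous_map_eval_edge:
  fixes M :: "('m::topological_space, 'e::euclidean_space) mfd"
  assumes "edge r emb M e"
  shows "continuous_map (gen_conn_topology r emb M G T) T (\<lambda>A. A (path_class r emb M e))"
proof -
  \<comment> \<open>No edge precedes \<open>e\<close>, so every point is free; 0 is chosen, with the
    positive direction.\<close>
  have hyph: "hyph r emb M [e]"
    using assms by (auto simp: hyph_def has_free_point_def intro!: bexI[of _ 0])
  let ?e = "path_class r emb M e" and ?H = "arr (hyph_gpd r emb M [e])"
  have e: "?e \<in> ?H" by (rule class_in_hyph_gpd) simp
  show ?thesis
    unfolding continuous_map_alt topspace_gen_conn_topology
  proof (intro conjI allI impI)
    fix U assume U: "openin T U"
    let ?F = "\<lambda>h. \<lambda>i\<in>{..<length [e]}. h (path_class r emb M ([e] ! i))"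
    \<comment> \<open>The cylinder over \<open>U\<close> in the power of the group with the single
      index 0.\<close>
    let ?V = "{g \<in> topspace (product_topology (\<lambda>_. T) {..<length [e]}). g 0 \<in> U}"
    let ?W = "?F -` ?V \<inter> gpd_hom (hyph_gpd r emb M [e]) (group_gpd G)"
    have "openin (product_topology (\<lambda>_. T) {..<length [e]}) ?V"
      using U by (intro openin_continuous_map_preimage[OF continuous_map_product_projection]) auto
    then have W: "openin (hyph_conn_topology r emb M G T [e]) ?W"
      unfolding hyph_conn_topology_def openin_pullback_topology by blast
    have C: "A ?e \<in> carrier G" if "A \<in> gen_conn r emb M G" for A
      using gen_conn_closed[OF is_group that edge_in_P_gen[OF assms]] .
    have "(\<lambda>A. A ?e) -` U \<inter> gen_conn r emb M G = {h \<in> gen_conn r emb M G. restrict h ?H \<in> ?W}"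
      using restrict_gen_conn_hyph[OF _ hyph] e C by (auto simp: topspace_eq)
    then show "openin (gen_conn_topology r emb M G T) ((\<lambda>A. A ?e) -` U \<inter> gen_conn r emb M G)"
      unfolding gen_conn_topology_def using W hyph by (intro topology_generated_by_Basis) blast
  next
    show "(\<lambda>A. A ?e) \<in> gen_conn r emb M G \<rightarrow> topspace T"
      using gen_conn_closed[OF is_group _ edge_in_P_gen[OF assms]] by (auto simp: topspace_eq)
  qed
qed

lemma continuous_map_eval:
  fixes M :: "('m::topological_space, 'e::euclidean_space) mfd"
  assumes "\<gamma> \<in> P_gen r emb M"
  shows "continuous_map (gen_conn_topology r emb M G T) T (\<lambda>A. A (path_class r emb M \<gamma>))"
proof -
  let ?X = "gen_conn_topology r emb M G T"
  have "continuous_map ?X T (\<lambda>A. A (path_class r emb M (segment s t \<gamma>)))"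
    if st: "0 \<le> s" "s < t" "t \<le> 1" "simple_piece \<gamma> s t" for s t
  proof -
    have P: "segment s t \<gamma> \<in> P_gen r emb M"
      using st assms by (intro segment_in_P_gen)
    have "simple_piece (segment s t \<gamma>) 0 1"
      using simple_piece_reparam[OF reparam_sym[OF reparam_self_segment[OF st(2)]] st(4)] .
    \<comment> \<open>Edges are covered by the one-edge hyphs, while on trivial pieces every
      connection has the constant value \<open>\<one>\<close>.\<close>
    then have "edge r emb M (segment s t \<gamma>) \<or> trivial_path (segment s t \<gamma>)"
      using P by (auto simp: simple_piece_def edge_def trivial_path_def P_gen_def)
    then show ?thesis
    proof
      assume triv: "trivial_path (segment s t \<gamma>)"
      have "continuous_map ?X T (\<lambda>_. \<one>)"
        using is_group by (simp add: topspace_eq group.is_monoid)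
      then show ?thesis
        by (rule continuous_map_eq) (simp add: topspace_gen_conn_topology gen_conn_trivial[OF is_group _ P triv])
    qed (rule continuous_map_eval_edge)
  qed
  from continuous_map_class_segment[of "simple_piece \<gamma>" 0 1 \<gamma> r emb M ?X "\<lambda>A. A", OF _ _ _ assms _ this]
  show ?thesis
    using assms by (simp add: P_gen_iff topspace_gen_conn_topology)
qed

text \<open>A generating open set is pulled back from a finite power of the group by evaluation on
  the edges of a hyph. Together with \<open>continuous_map_eval\<close>, the topology is thus the
  coarsest one making all evaluations on paths continuous.\<close>

lemma continuous_map_into_gen_conn:
  fixes M :: "('m::topological_space, 'e::euclidean_space) mfd"
  assumes B: "\<And>x. x \<in> topspace X \<Longrightarrow> B x \<in> gen_conn r emb M G"
    and cont: "\<And>\<gamma>. \<gamma> \<in> P_gen r emb M \<Longrightarrow> continuous_map X T (\<lambda>x. B x (path_class r emb M \<gamma>))"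
  shows "continuous_map X (gen_conn_topology r emb M G T) B"
  unfolding gen_conn_topology_def
proof (rule continuous_on_generated_topo)
  fix U
  assume "U \<in> {{h \<in> gen_conn r emb M G. restrict h (arr (hyph_gpd r emb M es)) \<in> W} | es W.
    hyph r emb M es \<and> openin (hyph_conn_topology r emb M G T es) W}"
  then obtain es W where U: "U = {h \<in> gen_conn r emb M G. restrict h (arr (hyph_gpd r emb M es)) \<in> W}"
    and es: "hyph r emb M es" and W: "openin (hyph_conn_topology r emb M G T es) W"
    by blast
  let ?F = "\<lambda>h. \<lambda>i\<in>{..<length es}. h (path_class r emb M (es ! i))"
  obtain V where V: "openin (product_topology (\<lambda>_. T) {..<length es}) V"
    "W = ?F -` V \<inter> gpd_hom (hyph_gpd r emb M es) (group_gpd G)"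
    using W unfolding hyph_conn_topology_def openin_pullback_topology by blast
  \<comment> \<open>Restriction to the subgroupoid of the hyph does not affect the values on its
    edges.\<close>
  have F: "?F (restrict h (arr (hyph_gpd r emb M es))) = ?F h" for h
    by (intro restrict_ext) (simp add: class_in_hyph_gpd)
  have "continuous_map X (product_topology (\<lambda>_. T) {..<length es}) (\<lambda>x. ?F (B x))"
    unfolding continuous_map_componentwise
  proof (intro conjI ballI)
    fix i assume i: "i \<in> {..<length es}"
    then have "es ! i \<in> P_gen r emb M"
      using hyph_nth_in_P_gen[OF es] by simp
    from cont[OF this] show "continuous_map X T (\<lambda>x. ?F (B x) i)"
      using i by simp
  qed auto
  then have "openin X {x \<in> topspace X. ?F (B x) \<in> V}"
    using V(1) by (rule openin_continuous_map_preimage)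
  moreover have "B -` U \<inter> topspace X = {x \<in> topspace X. ?F (B x) \<in> V}"
    using B restrict_gen_conn_hyph[OF _ es] unfolding U V(2) by (auto simp: F simp del: restrict_apply)
  ultimately show "openin X (B -` U \<inter> topspace X)"
    by simp
next
  have "B ` topspace X \<subseteq> topspace (gen_conn_topology r emb M G T)"
    unfolding topspace_gen_conn_topology using B by blast
  then show "B ` topspace X \<subseteq> \<Union> {{h \<in> gen_conn r emb M G. restrict h (arr (hyph_gpd r emb M es)) \<in> W} | es W.
    hyph r emb M es \<and> openin (hyph_conn_topology r emb M G T es) W}"
    unfolding gen_conn_topology_def topology_generated_by_topspace .
qed

end

section \<open>Lie groups as topological groups\<close>

lemma Cr_on_Smooth_imp_continuous_on:
  assumes "Cr_on Smooth S f"
  shows "continuous_on S f"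
  unfolding continuous_on_eq_continuous_within
proof
  fix x assume x: "x \<in> S"
  then obtain U g where *: "open U" "x \<in> U" "Cr_open Smooth U g" "\<forall>y\<in>U \<inter> S. g y = f y"
    using assms unfolding Cr_on_def by blast
  obtain d where d: "d > 0" "ball x d \<subseteq> U"
    using *(1,2) by (auto simp: open_contains_ball)
  have "Ck_on 0 U g" using *(3) unfolding Cr_open.simps by blast
  then have "isCont g x"
    using *(1,2) by (auto simp: continuous_on_eq_continuous_at)
  then have "continuous (at x within S) g"
    by (rule continuous_at_imp_continuous_at_within)
  then show "continuous (at x within S) f"
  proof (rule continuous_transform_within[OF _ d(1) x])
    fix y assume "y \<in> S" "dist y x < d"
    then have "y \<in> U \<inter> S"
      using d(2) by (auto simp: dist_commute)
    then show "g y = f y" using *(4) by blast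
  qed
qed

text \<open>The chart conditions on which the continuity of smooth maps rests, isolated because they
  pass directly to \<open>prod_mfd\<close>, the domain of the group multiplication.\<close>

definition charted :: "('p, 'e::euclidean_space) mfd \<Rightarrow> bool" where
  "charted M \<longleftrightarrow> (\<forall>(U, c)\<in>atlas M. openin (mtop M) U \<and>
     homeomorphic_map (subtopology (mtop M) U) (top_of_set (c ` U)) c)"

lemma chartedD:
  assumes "charted M" "(U, c) \<in> atlas M"
  shows "openin (mtop M) U" "homeomorphic_map (subtopology (mtop M) U) (top_of_set (c ` U)) c"
  using assms by (auto simp: charted_def)

text \<open>Near each point \<open>f\<close> is the composition of a chart, its smooth coordinate
  expression and the inverse of a chart; the local statements are pasted over an open cover.\<close>

lemma Cr_map_imp_continuous_map:
  assumes M: "charted M" and N: "charted N" and f: "Cr_map Smooth M N f"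
  shows "continuous_map (mtop M) (mtop N) f"
proof -
  have local: "\<exists>V. openin (mtop M) V \<and> p \<in> V \<and> continuous_map (subtopology (mtop M) V) (mtop N) f"
    if "p \<in> topspace (mtop M)" for p
  proof -
    obtain U c W d V where *: "(U, c) \<in> atlas M" "(W, d) \<in> atlas N" "openin (mtop M) V" "p \<in> V" "V \<subseteq> U"
      "f ` V \<subseteq> W" "Cr_on Smooth (c ` V) (d \<circ> f \<circ> inv_into U c)"
      using f \<open>p \<in> topspace (mtop M)\<close> unfolding Cr_map_def by blast
    note c = chartedD[OF M *(1)] and d = chartedD[OF N *(2)]
    obtain d' where d': "homeomorphic_maps (subtopology (mtop N) W) (top_of_set (d ` W)) d d'"
      using d(2) homeomorphic_map_maps by blast
    let ?g = "d \<circ> f \<circ> inv_into U c"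
    have "topspace (subtopology (mtop M) U) = U"
      using openin_subset[OF c(1)] by auto
    then have "inj_on c U"
      using homeomorphic_imp_injective_map[OF c(2)] by simp
    then have g: "?g (c x) = d (f x)" if "x \<in> V" for x
      using that *(5) by auto
    have "continuous_map (subtopology (mtop M) V) euclidean c"
      using homeomorphic_imp_continuous_map[OF c(2)] *(5)
      by (meson continuous_map_from_subtopology_mono continuous_map_into_fulltopology)
    then have c1: "continuous_map (subtopology (mtop M) V) (top_of_set (c ` V)) c"
      by (rule continuous_map_into_subtopology) auto
    have "continuous_map (top_of_set (c ` V)) euclidean ?g"
      using Cr_on_Smooth_imp_continuous_on[OF *(7)] by simp
    then have g1: "continuous_map (top_of_set (c ` V)) (top_of_set (d ` W)) ?g"
      using g *(6) by (intro continuous_map_into_subtopology) auto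
    have d1: "continuous_map (top_of_set (d ` W)) (mtop N) d'"
      using d' unfolding homeomorphic_maps_def by (blast intro: continuous_map_into_fulltopology)
    have "continuous_map (subtopology (mtop M) V) (mtop N) (d' \<circ> (?g \<circ> c))"
      by (intro continuous_map_compose[OF continuous_map_compose[OF c1 g1] d1])
    moreover have "(d' \<circ> (?g \<circ> c)) x = f x" if "x \<in> topspace (subtopology (mtop M) V)" for x
    proof -
      have x: "x \<in> V" using that by simp
      then have "f x \<in> topspace (subtopology (mtop N) W)"
        using *(6) openin_subset[OF d(1)] by auto
      then have "d' (d (f x)) = f x"
        using d' unfolding homeomorphic_maps_def by blast
      then show ?thesis using g[OF x] by simp
    qed
    ultimately have "continuous_map (subtopology (mtop M) V) (mtop N) f"
      by (rule continuous_map_eq)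
    then show ?thesis using *(3,4) by blast
  qed
  let ?I = "{V. openin (mtop M) V \<and> continuous_map (subtopology (mtop M) V) (mtop N) f}"
  show ?thesis
  proof (rule pasting_lemma[of ?I _ "\<lambda>V. V" _ "\<lambda>_. f"])
    fix p assume "p \<in> topspace (mtop M)"
    from local[OF this] show "\<exists>V. V \<in> ?I \<and> p \<in> V \<and> f p = f p"
      by blast
  qed simp_all
qed

lemma charted_prod:
  assumes M: "charted M" and N: "charted N"
  shows "charted (prod_mfd M N)"
  unfolding charted_def
proof clarify
  fix X k assume "(X, k) \<in> atlas (prod_mfd M N)"
  then obtain U c W d where *: "X = U \<times> W" "k = map_prod c d" "(U, c) \<in> atlas M" "(W, d) \<in> atlas N"
    by (auto simp: prod_mfd_def)
  note c = chartedD[OF M *(3)] and d = chartedD[OF N *(4)]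
  obtain c' d' where "homeomorphic_maps (subtopology (mtop M) U) (top_of_set (c ` U)) c c'"
    "homeomorphic_maps (subtopology (mtop N) W) (top_of_set (d ` W)) d d'"
    using c(2) d(2) homeomorphic_map_maps by metis
  then have "homeomorphic_maps (prod_topology (subtopology (mtop M) U) (subtopology (mtop N) W))
      (prod_topology (top_of_set (c ` U)) (top_of_set (d ` W))) (\<lambda>(x, y). (c x, d y)) (\<lambda>(x, y). (c' x, d' y))"
    unfolding homeomorphic_maps_prod by blast
  then have "homeomorphic_map (prod_topology (subtopology (mtop M) U) (subtopology (mtop N) W))
      (prod_topology (top_of_set (c ` U)) (top_of_set (d ` W))) (map_prod c d)"
    unfolding homeomorphic_map_maps map_prod_def by blast
  moreover have "map_prod c d ` (U \<times> W) = c ` U \<times> d ` W"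
    by auto
  ultimately show "openin (mtop (prod_mfd M N)) X \<and>
      homeomorphic_map (subtopology (mtop (prod_mfd M N)) X) (top_of_set (k ` X)) k"
    using c(1) d(1) * by (simp add: prod_mfd_def openin_prod_Times_iff subtopology_Times)
qed

lemma top_group_lie_group:
  assumes "lie_group G L"
  shows "top_group G (mtop L)"
proof -
  have L: "charted L"
    using assms unfolding lie_group_def Cr_manifold_def charted_def by fast
  show ?thesis
  proof (rule top_group.intro)
    show "group G" "topspace (mtop L) = carrier G"
      using assms by (auto simp: lie_group_def)
    have "continuous_map (mtop (prod_mfd L L)) (mtop L) (\<lambda>(x, y). x \<otimes>\<^bsub>G\<^esub> y)"
      using assms by (intro Cr_map_imp_continuous_map charted_prod L) (simp add: lie_group_def)
    then show "continuous_map (prod_topology (mtop L) (mtop L)) (mtop L) (\<lambda>(x, y). x \<otimes>\<^bsub>G\<^esub> y)"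
      by (simp add: prod_mfd_def)
    show "continuous_map (mtop L) (mtop L) (\<lambda>x. inv\<^bsub>G\<^esub> x)"
      using assms by (intro Cr_map_imp_continuous_map L) (simp add: lie_group_def)
  qed
qed

text \<open>\<open>\<Theta>\<close> is taken as an extensional function on pairs, so that uniqueness
  is plain equality of functions.\<close>

theorem corollary6p2:
  fixes r :: diff_class and emb :: bool
    and M :: "('m::topological_space, 'e::euclidean_space) mfd"
    and G :: "('g, 'z) monoid_scheme" and L :: "('g, 'f::euclidean_space) mfd"
    and Q :: "(real \<Rightarrow> 'm) set" and \<phi> :: "'m \<Rightarrow> 'm"
    and Y :: "'y topology" and \<kappa> :: "(real \<Rightarrow> 'm) \<times> 'y \<Rightarrow> 'g"
  assumes "positive_class r"
    and "Cr_manifold r M" and "mtop M = euclidean"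
    and "lie_group G L" and "connected_space (mtop L)"
    and "complete_paths r emb M Q"
    and "graphical_hom r emb M \<phi>"
    and "\<kappa> \<in> Q \<times> topspace Y \<rightarrow> carrier G"
    and "\<And>y. y \<in> topspace Y \<Longrightarrow> admissible r emb M G Q (\<lambda>\<gamma>. \<kappa> (\<gamma>, y))"
    and "\<And>\<gamma>. \<gamma> \<in> Q \<Longrightarrow> continuous_map Y (mtop L) (\<lambda>y. \<kappa> (\<gamma>, y))"
  shows "\<exists>\<Theta> \<in> gen_conn r emb M G \<times> topspace Y \<rightarrow>\<^sub>E gen_conn r emb M G.
      (\<forall>\<gamma>\<in>Q. \<forall>A\<in>gen_conn r emb M G. \<forall>y\<in>topspace Y.
         \<Theta> (A, y) (path_class r emb M \<gamma>) =
           inv\<^bsub>G\<^esub> \<kappa> (\<gamma>, y) \<otimes>\<^bsub>G\<^esub> A (path_class r emb M (\<phi> \<circ> \<gamma>)) \<otimes>\<^bsub>G\<^esub> \<kappa> (reversepath \<gamma>, y)) \<and>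
      (\<forall>\<Theta>' \<in> gen_conn r emb M G \<times> topspace Y \<rightarrow>\<^sub>E gen_conn r emb M G.
         (\<forall>\<gamma>\<in>Q. \<forall>A\<in>gen_conn r emb M G. \<forall>y\<in>topspace Y.
            \<Theta>' (A, y) (path_class r emb M \<gamma>) =
              inv\<^bsub>G\<^esub> \<kappa> (\<gamma>, y) \<otimes>\<^bsub>G\<^esub> A (path_class r emb M (\<phi> \<circ> \<gamma>)) \<otimes>\<^bsub>G\<^esub> \<kappa> (reversepath \<gamma>, y))
         \<longrightarrow> \<Theta>' = \<Theta>) \<and>
      continuous_map (prod_topology (gen_conn_topology r emb M G (mtop L)) Y)
        (gen_conn_topology r emb M G (mtop L)) \<Theta>"
proof -
  let ?A = "gen_conn r emb M G" and ?T = "gen_conn_topology r emb M G (mtop L)" and ?pclass = "path_class r emb M"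
  interpret top_group G "mtop L" by (rule top_group_lie_group[OF assms(4)])
  interpret complete_set r emb M Q by unfold_locales (rule assms(6))
  define f where "f = (\<lambda>A y \<gamma>. inv\<^bsub>G\<^esub> \<kappa> (\<gamma>, y) \<otimes>\<^bsub>G\<^esub> A (?pclass (\<phi> \<circ> \<gamma>)) \<otimes>\<^bsub>G\<^esub> \<kappa> (reversepath \<gamma>, y))"
  have \<phi>: "\<phi> \<circ> \<gamma> \<in> P_gen r emb M" if "\<gamma> \<in> P_gen r emb M" for \<gamma>
    using assms(7) that unfolding graphical_hom_def by blast
  have mult: "multiplicative r emb M Q G (f A y)" if "A \<in> ?A" "y \<in> topspace Y" for A y
    unfolding f_def
    using multiplicative_action[OF assms(6) is_group \<phi> assms(9)[OF that(2)] that(1)] .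
  \<comment> \<open>Each pair of a connection and a parameter gives one multiplicative function on
    \<open>Q\<close>, which is extended separately.\<close>
  define \<Theta> where "\<Theta> = (\<lambda>(A, y)\<in>?A \<times> topspace Y. multiplicative.conn r emb M Q G (f A y))"
  have \<Theta>: "\<Theta> (A, y) = multiplicative.conn r emb M Q G (f A y)" if "A \<in> ?A" "y \<in> topspace Y" for A y
    using that by (simp add: \<Theta>_def)
  have \<Theta>_conn: "\<Theta> (A, y) \<in> ?A" if "A \<in> ?A" "y \<in> topspace Y" for A y
    using multiplicative.conn_in_gen_conn[OF mult[OF that]] \<Theta>[OF that] by simp
  have \<Theta>_Q: "\<Theta> (A, y) (?pclass \<gamma>) = f A y \<gamma>" if "A \<in> ?A" "y \<in> topspace Y" "\<gamma> \<in> Q" for A y \<gamma>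
    using that \<Theta>[OF that(1,2)] multiplicative.conn_class[OF mult[OF that(1,2)] Q_subset[OF that(3)]]
      multiplicative.hol_val_Q[OF mult[OF that(1,2)] that(3)] by simp
  have unique: "\<Theta>' = \<Theta>"
    if "\<Theta>' \<in> ?A \<times> topspace Y \<rightarrow>\<^sub>E ?A"
      and eq: "\<And>\<gamma> A y. \<lbrakk>\<gamma> \<in> Q; A \<in> ?A; y \<in> topspace Y\<rbrakk> \<Longrightarrow> \<Theta>' (A, y) (?pclass \<gamma>) = f A y \<gamma>" for \<Theta>'
  proof (rule extensionalityI)
    show "\<Theta>' \<in> extensional (?A \<times> topspace Y)" "\<Theta> \<in> extensional (?A \<times> topspace Y)"
      using that(1) by (auto simp: PiE_def \<Theta>_def)
    fix p assume "p \<in> ?A \<times> topspace Y"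
    then obtain A y where p: "p = (A, y)" "A \<in> ?A" "y \<in> topspace Y"
      by blast
    have "\<Theta>' (A, y) \<in> ?A"
      using that(1) p by (simp add: PiE_iff)
    then show "\<Theta>' p = \<Theta> p"
      using multiplicative.conn_unique[OF mult[OF p(2,3)], of "\<Theta>' (A, y)"] eq p \<Theta>[OF p(2,3)] by simp
  qed
  let ?X = "prod_topology ?T Y"
  have X: "topspace ?X = ?A \<times> topspace Y"
    by (simp add: topspace_gen_conn_topology)
  have cont: "continuous_map ?X ?T \<Theta>"
  proof (rule continuous_map_into_gen_conn)
    show conn: "\<Theta> p \<in> ?A" if "p \<in> topspace ?X" for p
      using that \<Theta>_conn unfolding X by (cases p) simp
    fix \<gamma> assume \<gamma>: "\<gamma> \<in> P_gen r emb M"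
    have "continuous_map ?X (mtop L) (\<lambda>p. \<Theta> p (?pclass \<delta>))" if \<delta>: "\<delta> \<in> Q" for \<delta>
    proof -
      \<comment> \<open>On \<open>Q\<close> the explicit formula is available. Its middle factor is
        the evaluation at \<open>\<phi> \<circ> \<delta>\<close>, which may lie outside
        \<open>Q\<close> but is a path, so \<open>continuous_map_eval\<close> applies.\<close>
      have "continuous_map ?X (mtop L) (\<lambda>p. f (fst p) (snd p) \<delta>)"
        unfolding f_def
        using continuous_map_compose[OF continuous_map_fst continuous_map_eval[OF \<phi>[OF Q_subset[OF \<delta>]]]]
          continuous_map_compose[OF continuous_map_snd assms(10)[OF \<delta>]]
          continuous_map_compose[OF continuous_map_snd assms(10)[OF Q_reversepath[OF \<delta>]]]
        unfolding comp_def by (intro continuous_map_mult continuous_map_inverse)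
      then show ?thesis
        by (rule continuous_map_eq) (use \<Theta>_Q[OF _ _ \<delta>] in \<open>auto simp: topspace_gen_conn_topology\<close>)
    qed
    \<comment> \<open>A general path is subdivided into segments in \<open>Q\<close>; the
      subdivision depends on \<open>\<gamma>\<close> alone and not on the point of
      \<open>?X\<close>.\<close>
    then show "continuous_map ?X (mtop L) (\<lambda>p. \<Theta> p (?pclass \<gamma>))"
      using continuous_map_class_segment[OF pw_Q[OF \<gamma>] _ _ \<gamma>, of ?X \<Theta>] conn by simp
  qed
  show ?thesis
  proof (intro bexI[of _ \<Theta>] conjI ballI impI cont)
    show "\<Theta> \<in> ?A \<times> topspace Y \<rightarrow>\<^sub>E ?A"
      using \<Theta>_conn by (auto simp: \<Theta>_def PiE_iff)
  qed (use \<Theta>_Q unique in \<open>auto simp: f_def\<close>)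
qed

end
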